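(* Let $\mathfrak g=\mathfrak{gl}(2|2)$ with the distinguished Borel subalgebra, and write its positive odd roots as $$\alpha=\varepsilon_2-\delta_1,\quad \beta=\varepsilon_1-\delta_1,\quad \gamma=\varepsilon_2-\delta_2,\quad \delta=\varepsilon_1-\delta_2.$$ Let $\lambda\in\mathfrak h^*$ be a weight with degree of atypicality $2$ and let $A(\lambda)$ denote the set of all positive odd roots $\eta$ which are atypical for $\lambda$, i.e. $(\lambda+\rho,\eta)=0$. (1) If $\lambda$ is regular dominant integral, then $\mathcal S(\lambda)$ is the set of all subsets of mutually orthogonal roots in the set $\Delta^+_{\bar 1}=\{\alpha,\beta,\gamma,\delta\}$. (2) If $\lambda$ is regular integral and neither dominant nor anti-dominant, then $\mathcal S(\lambda)=\{\{\delta\},\{\beta,\gamma\},\{\beta\},\{\gamma\},\emptyset\}$. (3) If $\lambda=-\rho$, then $\mathcal S(\lambda)$ is the set of all subsets of mutually orthogonal roots in $\Delta^+_{\bar 1}=A(-\rho)$. (4) If $\lambda$ is regular and either non-integral or anti-dominant integral, then $\mathcal S(\lambda)$ is the set of all subsets of $A(\lambda)$.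
   Context: Work over $\mathbb C$. $\mathfrak g=\mathfrak{gl}(2|2)$; $\mathfrak h$ is the diagonal Cartan subalgebra, $\mathfrak h^*$ has the standard basis $\varepsilon_1,\varepsilon_2,\delta_1,\delta_2$ and the form $(\varepsilon_i,\varepsilon_i)=1$, $(\delta_j,\delta_j)=-1$, all other pairings of basis vectors being $0$. The distinguished Borel subalgebra $\mathfrak b$ has positive even roots $\varepsilon_1-\varepsilon_2$, $\delta_1-\delta_2$ and positive odd roots $\varepsilon_i-\delta_j$. $\rho$ is half the sum of the positive even roots minus half the sum of the positive odd roots. The degree of atypicality of $\lambda$ is the maximal number of mutually orthogonal positive odd roots $\eta$ with $(\lambda+\rho,\eta)=0$. $\lambda$ is regular if $(\lambda+\rho,\eta)\ne0$ for every even root $\eta$; integral means here that $(\lambda,\eta)\in\mathbb Z$ for all roots $\eta$. A regular integral $\lambda$ is dominant if $(\lambda+\rho,\varepsilon_1-\varepsilon_2)>0$ and $(\lambda+\rho,\delta_1-\delta_2)<0$, and anti-dominant if $(\lambda+\rho,\varepsilon_1-\varepsilon_2)<0$ and $(\lambda+\rho,\delta_1-\delta_2)>0$. $M(\lambda)=U(\mathfrak g)\otimes_{U(\mathfrak b)}\mathbb C_\lambda$ is the Verma module. Let $X=\{x\in\mathfrak g_{\bar 1}\mid [x,x]=0\}$, and for a $\mathfrak g$-module $M$ let $X_M=\{x\in X\mid xM\neq\ker(x|_M)\}$. Let $\mathcal S$ be the set of all subsets $S$ (including $\emptyset$) of mutually orthogonal, linearly independent odd isotropic roots; for $S=\{\alpha_1,\dots,\alpha_k\}\in\mathcal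 S$ let $x_S=x_1+\dots+x_k$ with $0\neq x_i\in\mathfrak g_{\alpha_i}$, whose orbit $\Phi(S)=B_{\bar 0}x_S$ under the Borel subgroup $B_{\bar 0}$ (with Lie algebra $\mathfrak b\cap \mathfrak g_{\bar 0}$) is independent of choices. Then $\mathcal S(\lambda)=\{S\in\mathcal S\mid \Phi(S)\subset X_{M(\lambda)}\}$. *)

theory Defs
  imports
    "HOL-Analysis.Analysis"
    "HOL-Library.Numeral_Type"
    "HOL-Library.Poly_Mapping"
    "HOL-Algebra.Free_Abelian_Groups"
begin

section \<open>The Lie superalgebra \<open>gl(2|2)\<close>\<close>

text \<open>Rows and columns are indexed by \<open>2 + 2\<close>: \<open>Inl i\<close> is the even index carrying
  \<open>\<epsilon>\<^sub>i\<close> and \<open>Inr j\<close> the odd index carrying \<open>\<delta>\<^sub>j\<close>.  Beware that in the type \<open>2\<close> the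
  elements are \<open>1\<close> and \<open>2 = 0\<close>.\<close>

type_synonym gl22 = "complex ^ (2 + 2) ^ (2 + 2)"

fun par :: "2 + 2 \<Rightarrow> nat" where
  "par (Inl i) = 0"
| "par (Inr j) = 1"

definition proj :: "nat \<Rightarrow> gl22 \<Rightarrow> gl22" where
  "proj p A = (\<chi> i j. if (par i + par j) mod 2 = p then A $ i $ j else 0)"

definition grade :: "nat \<Rightarrow> gl22 set" where
  "grade p = {A. proj p A = A}"

definition cscale :: "complex \<Rightarrow> gl22 \<Rightarrow> gl22" where
  "cscale c A = (\<chi> i j. c * A $ i $ j)"

text \<open>The bilinear extension of \<open>[a, b] = a b - (-1)\<^sup>p\<^sup>q b a\<close> for \<open>a\<close>, \<open>b\<close> homogeneous of
  parities \<open>p\<close>, \<open>q\<close>.\<close>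

definition sbracket :: "gl22 \<Rightarrow> gl22 \<Rightarrow> gl22" where
  "sbracket A B = (\<Sum>p<2. \<Sum>q<2.
     proj p A ** proj q B - (- 1) ^ (p * q) *\<^sub>R (proj q B ** proj p A))"

definition cartan :: "gl22 set" where
  "cartan = {A. \<forall>i j. i \<noteq> j \<longrightarrow> A $ i $ j = 0}"

text \<open>The distinguished Borel subalgebra: the upper triangular matrices for the ordering
  \<open>\<epsilon>\<^sub>1, \<epsilon>\<^sub>2, \<delta>\<^sub>1, \<delta>\<^sub>2\<close> of the indices.\<close>

definition pos :: "2 + 2 \<Rightarrow> nat" where
  "pos k = (if k = Inl 1 then 0 else if k = Inl 2 then 1 else if k = Inr 1 then 2 else 3)"

definition borel_alg :: "gl22 set" where
  "borel_alg = {A. \<forall>i j. pos j < pos i \<longrightarrow> A $ i $ j = 0}"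


section \<open>Weights and roots\<close>

text \<open>A weight is given by its coordinates in the basis \<open>\<epsilon>\<^sub>1, \<epsilon>\<^sub>2, \<delta>\<^sub>1, \<delta>\<^sub>2\<close> of the dual of the
  Cartan subalgebra, which is dual to the diagonal matrix units.\<close>

type_synonym weight = "complex ^ (2 + 2)"

definition eps :: "2 \<Rightarrow> weight" where
  "eps i = axis (Inl i) 1"

definition dlt :: "2 \<Rightarrow> weight" where
  "dlt j = axis (Inr j) 1"

definition wt_eval :: "weight \<Rightarrow> gl22 \<Rightarrow> complex" where
  "wt_eval l h = (\<Sum>i\<in>UNIV. l $ i * h $ i $ i)"

definition wform :: "weight \<Rightarrow> weight \<Rightarrow> complex" where
  "wform l m = (\<Sum>i\<in>UNIV. (- 1) ^ par i * l $ i * m $ i)"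

definition root_space :: "weight \<Rightarrow> gl22 set" where
  "root_space a = {x. \<forall>h\<in>cartan. sbracket h x = cscale (wt_eval a h) x}"

definition even_roots :: "weight set" where
  "even_roots = {a. a \<noteq> 0 \<and> root_space a \<inter> grade 0 \<noteq> {0}}"

definition odd_roots :: "weight set" where
  "odd_roots = {a. a \<noteq> 0 \<and> root_space a \<inter> grade 1 \<noteq> {0}}"

definition pos_even_roots :: "weight set" where
  "pos_even_roots = {eps 1 - eps 2, dlt 1 - dlt 2}"

definition pos_odd_roots :: "weight set" where
  "pos_odd_roots = {eps i - dlt j | i j. True}"

definition r_alpha :: weight where "r_alpha = eps 2 - dlt 1"
definition r_beta :: weight where "r_beta = eps 1 - dlt 1"
definition r_gamma :: weight where "r_gamma = eps 2 - dlt 2"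
definition r_delta :: weight where "r_delta = eps 1 - dlt 2"

definition rho :: weight where
  "rho = (1 / 2) *s \<Sum>pos_even_roots - (1 / 2) *s \<Sum>pos_odd_roots"

definition mut_orth :: "weight set \<Rightarrow> bool" where
  "mut_orth S \<longleftrightarrow> pairwise (\<lambda>a b. wform a b = 0) S"

definition atyp_roots :: "weight \<Rightarrow> weight set" where
  "atyp_roots l = {a \<in> pos_odd_roots. wform (l + rho) a = 0}"

definition atyp_degree :: "weight \<Rightarrow> nat" where
  "atyp_degree l = Max (card ` {S. S \<subseteq> atyp_roots l \<and> mut_orth S})"

definition regular_wt :: "weight \<Rightarrow> bool" where
  "regular_wt l \<longleftrightarrow> (\<forall>a\<in>even_roots. wform (l + rho) a \<noteq> 0)"

definition integral_wt :: "weight \<Rightarrow> bool" where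
  "integral_wt l \<longleftrightarrow> (\<forall>a\<in>even_roots \<union> odd_roots. wform l a \<in> \<int>)"

text \<open>The next two notions are only meant for regular integral weights; the pairings are then
  integers, so taking real parts only serves to express their sign.\<close>

definition dominant_wt :: "weight \<Rightarrow> bool" where
  "dominant_wt l \<longleftrightarrow>
     Re (wform (l + rho) (eps 1 - eps 2)) > 0 \<and> Re (wform (l + rho) (dlt 1 - dlt 2)) < 0"

definition antidominant_wt :: "weight \<Rightarrow> bool" where
  "antidominant_wt l \<longleftrightarrow>
     Re (wform (l + rho) (eps 1 - eps 2)) < 0 \<and> Re (wform (l + rho) (dlt 1 - dlt 2)) > 0"


section \<open>The universal enveloping algebra\<close>

text \<open>The free unital associative algebra on the set \<open>gl22\<close> is the monoid algebra of the free
  monoid of words; the universal enveloping algebra is its quotient by the two-sided ideal that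
  makes the generators linear and subject to the super commutation relations.\<close>

datatype gword = GWord "gl22 list"

instantiation gword :: monoid_add
begin

definition zero_gword :: gword where "0 = GWord []"

fun plus_gword :: "gword \<Rightarrow> gword \<Rightarrow> gword" where
  "GWord u + GWord v = GWord (u @ v)"

instance
proof
  fix a b c :: gword
  show "a + b + c = a + (b + c)" by (cases a; cases b; cases c) simp
  show "0 + a = a" by (cases a) (simp add: zero_gword_def)
  show "a + 0 = a" by (cases a) (simp add: zero_gword_def)
qed

end

type_synonym free_alg = "gword \<Rightarrow>\<^sub>0 complex"

definition fgen :: "gl22 \<Rightarrow> free_alg" where
  "fgen x = Poly_Mapping.single (GWord [x]) 1"

definition fconst :: "complex \<Rightarrow> free_alg" where
  "fconst c = Poly_Mapping.single 0 c"

inductive_set uea_ideal :: "free_alg set" where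
  lin: "fgen (cscale a x + cscale b y) - (fconst a * fgen x + fconst b * fgen y) \<in> uea_ideal"
| comm: "\<lbrakk>p < 2; q < 2; x \<in> grade p; y \<in> grade q\<rbrakk> \<Longrightarrow>
    fgen x * fgen y - (- 1) ^ (p * q) * (fgen y * fgen x) - fgen (sbracket x y) \<in> uea_ideal"
| zero: "0 \<in> uea_ideal"
| diff: "\<lbrakk>f \<in> uea_ideal; g \<in> uea_ideal\<rbrakk> \<Longrightarrow> f - g \<in> uea_ideal"
| mult: "f \<in> uea_ideal \<Longrightarrow> u * f * v \<in> uea_ideal"

lemma uea_ideal_uminus: "f \<in> uea_ideal \<Longrightarrow> - f \<in> uea_ideal"
  using uea_ideal.diff[OF uea_ideal.zero] by fastforce

lemma uea_ideal_add: "\<lbrakk>f \<in> uea_ideal; g \<in> uea_ideal\<rbrakk> \<Longrightarrow> f + g \<in> uea_ideal"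
  using uea_ideal.diff[OF _ uea_ideal_uminus] by fastforce

lemma uea_ideal_left: "f \<in> uea_ideal \<Longrightarrow> u * f \<in> uea_ideal"
  using uea_ideal.mult[of f u 1] by simp

lemma uea_ideal_right: "f \<in> uea_ideal \<Longrightarrow> f * u \<in> uea_ideal"
  using uea_ideal.mult[of f 1 u] by simp

definition uea_rel :: "free_alg \<Rightarrow> free_alg \<Rightarrow> bool" where
  "uea_rel f g \<longleftrightarrow> f - g \<in> uea_ideal"

lemma equivp_uea_rel: "equivp uea_rel"
proof (rule equivpI)
  show "reflp uea_rel" by (simp add: reflp_def uea_rel_def uea_ideal.zero)
  show "symp uea_rel"
    unfolding symp_def uea_rel_def using uea_ideal_uminus by fastforce
  show "transp uea_rel"
    unfolding transp_def uea_rel_def using uea_ideal_add by fastforce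
qed

quotient_type uea = free_alg / uea_rel
  by (rule equivp_uea_rel)

instantiation uea :: ring
begin

lift_definition zero_uea :: uea is 0 .

lift_definition plus_uea :: "uea \<Rightarrow> uea \<Rightarrow> uea" is "(+)"
  unfolding uea_rel_def by (simp only: add_diff_add uea_ideal_add)

lift_definition uminus_uea :: "uea \<Rightarrow> uea" is uminus
  unfolding uea_rel_def by (simp only: minus_diff_minus uea_ideal_uminus)

lift_definition minus_uea :: "uea \<Rightarrow> uea \<Rightarrow> uea" is "(-)"
proof -
  fix f f' g g' :: free_alg
  assume "uea_rel f f'" "uea_rel g g'"
  then have "(f - f') - (g - g') \<in> uea_ideal"
    unfolding uea_rel_def by (rule uea_ideal.diff)
  then show "uea_rel (f - g) (f' - g')"
    unfolding uea_rel_def by (simp add: algebra_simps)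
qed

lift_definition times_uea :: "uea \<Rightarrow> uea \<Rightarrow> uea" is "(*)"
proof -
  fix f f' g g' :: free_alg
  assume "uea_rel f f'" "uea_rel g g'"
  then have "(f - f') * g + f' * (g - g') \<in> uea_ideal"
    unfolding uea_rel_def by (intro uea_ideal_add uea_ideal_left uea_ideal_right)
  then show "uea_rel (f * g) (f' * g')"
    unfolding uea_rel_def by (simp add: algebra_simps)
qed

instance
  by standard (transfer; simp add: uea_rel_def uea_ideal.zero algebra_simps)+

end

instantiation uea :: monoid_mult
begin

lift_definition one_uea :: uea is 1 .

instance
  by standard (transfer; simp add: uea_rel_def uea_ideal.zero)+

end

lift_definition uconst :: "complex \<Rightarrow> uea" is fconst .

lift_definition iota :: "gl22 \<Rightarrow> uea" is fgen .


section \<open>Verma modules\<close>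

text \<open>\<open>borel_char l w a\<close> says that \<open>w \<in> U(b)\<close>, the unital subalgebra of \<open>U(g)\<close> generated by
  the Borel subalgebra, acts on the one-dimensional module \<open>C\<^sub>l\<close> by the scalar \<open>a\<close>.  On the
  Borel subalgebra itself \<open>l\<close> is extended by zero to the strictly upper triangular matrices,
  which is what evaluating \<open>l\<close> on the diagonal does.\<close>

inductive borel_char :: "weight \<Rightarrow> uea \<Rightarrow> complex \<Rightarrow> bool" for l where
  const: "borel_char l (uconst c) c"
| gen: "x \<in> borel_alg \<Longrightarrow> borel_char l (iota x) (wt_eval l x)"
| add: "\<lbrakk>borel_char l v a; borel_char l w b\<rbrakk> \<Longrightarrow> borel_char l (v + w) (a + b)"
| mult: "\<lbrakk>borel_char l v a; borel_char l w b\<rbrakk> \<Longrightarrow> borel_char l (v * w) (a * b)"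

text \<open>The tensor product of the right \<open>U(b)\<close>-module \<open>U(g)\<close> with the left \<open>U(b)\<close>-module \<open>C\<^sub>l\<close>:
  the free abelian group on the pairs modulo the additivity and balancing relations.\<close>

abbreviation pair_group :: "(uea \<times> complex \<Rightarrow>\<^sub>0 int) monoid" where
  "pair_group \<equiv> free_Abelian_group UNIV"

definition verma_gens :: "weight \<Rightarrow> (uea \<times> complex \<Rightarrow>\<^sub>0 int) set" where
  "verma_gens l =
     {frag_of (u + v, c) - frag_of (u, c) - frag_of (v, c) | u v c. True}
   \<union> {frag_of (u, c + d) - frag_of (u, c) - frag_of (u, d) | u c d. True}
   \<union> {frag_of (u * w, c) - frag_of (u, a * c) | u w a c. borel_char l w a}"

definition verma_rels :: "weight \<Rightarrow> (uea \<times> complex \<Rightarrow>\<^sub>0 int) set" where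
  "verma_rels l = generate pair_group (verma_gens l)"

definition verma :: "weight \<Rightarrow> (uea \<times> complex \<Rightarrow>\<^sub>0 int) set monoid" where
  "verma l = pair_group Mod verma_rels l"

definition pair_act :: "uea \<Rightarrow> (uea \<times> complex \<Rightarrow>\<^sub>0 int) \<Rightarrow> (uea \<times> complex \<Rightarrow>\<^sub>0 int)" where
  "pair_act v = frag_extend (\<lambda>(u, c). frag_of (v * u, c))"

definition verma_act ::
    "weight \<Rightarrow> gl22 \<Rightarrow> (uea \<times> complex \<Rightarrow>\<^sub>0 int) set \<Rightarrow> (uea \<times> complex \<Rightarrow>\<^sub>0 int) set" where
  "verma_act l x C = (\<Union>f\<in>C. verma_rels l #>\<^bsub>pair_group\<^esub> pair_act (iota x) f)"

lemma pair_act_simps: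
  "pair_act v 0 = 0"
  "pair_act v (frag_of (u, c)) = frag_of (v * u, c)"
  "pair_act v (- f) = - pair_act v f"
  "pair_act v (f + g) = pair_act v f + pair_act v g"
  "pair_act v (f - g) = pair_act v f - pair_act v g"
  by (simp_all add: pair_act_def frag_extend_minus frag_extend_add frag_extend_diff)

lemma pair_act_verma_gens:
  assumes "h \<in> verma_gens l"
  shows "pair_act v h \<in> verma_gens l"
proof -
  consider
      (a) u u' c where "h = frag_of (u + u', c) - frag_of (u, c) - frag_of (u', c)"
    | (b) u c d where "h = frag_of (u, c + d) - frag_of (u, c) - frag_of (u, d)"
    | (c) u w a c where "h = frag_of (u * w, c) - frag_of (u, a * c)" "borel_char l w a"
    using assms unfolding verma_gens_def by blast
  then show ?thesis
  proof cases
    case a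
    then have "pair_act v h = frag_of (v * u + v * u', c) - frag_of (v * u, c) - frag_of (v * u', c)"
      by (simp only: pair_act_simps distrib_left)
    then show ?thesis unfolding verma_gens_def by blast
  next
    case b
    then have "pair_act v h = frag_of (v * u, c + d) - frag_of (v * u, c) - frag_of (v * u, d)"
      by (simp only: pair_act_simps)
    then show ?thesis unfolding verma_gens_def by blast
  next
    case c
    then have "pair_act v h = frag_of (v * u * w, c) - frag_of (v * u, a * c)"
      by (simp only: pair_act_simps mult.assoc)
    with c(2) show ?thesis unfolding verma_gens_def by blast
  qed
qed

lemma pair_act_verma_rels:
  assumes "f \<in> verma_rels l"
  shows "pair_act v f \<in> verma_rels l"
  using assms unfolding verma_rels_def
proof (induction rule: generate.induct)
  case one
  show ?case
    using generate.one[of pair_group "verma_gens l"] by (simp add: pair_act_simps)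
next
  case (incl h)
  then show ?case by (intro generate.incl pair_act_verma_gens)
next
  case (inv h)
  then show ?case
    using generate.inv[OF pair_act_verma_gens, of h l pair_group v] by (simp add: pair_act_simps)
next
  case (eng h1 h2)
  then show ?case
    using generate.eng[of _ pair_group "verma_gens l"] by (simp add: pair_act_simps)
qed

lemma subgroup_verma_rels: "subgroup (verma_rels l) pair_group"
  unfolding verma_rels_def by (rule group.generate_is_subgroup) auto

lemma verma_act_coset:
  "verma_act l x (verma_rels l #>\<^bsub>pair_group\<^esub> f)
     = verma_rels l #>\<^bsub>pair_group\<^esub> pair_act (iota x) f"
proof -
  interpret subgroup "verma_rels l" "pair_group" by (rule subgroup_verma_rels)
  have "verma_rels l #>\<^bsub>pair_group\<^esub> pair_act (iota x) (n + f)
      = verma_rels l #>\<^bsub>pair_group\<^esub> pair_act (iota x) f" if "n \<in> verma_rels l" for n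
  proof -
    have "verma_rels l #>\<^bsub>pair_group\<^esub> (pair_act (iota x) n \<otimes>\<^bsub>pair_group\<^esub> pair_act (iota x) f)
        = (verma_rels l #>\<^bsub>pair_group\<^esub> pair_act (iota x) n) #>\<^bsub>pair_group\<^esub> pair_act (iota x) f"
      by (rule group.coset_mult_assoc[symmetric]) auto
    also have "verma_rels l #>\<^bsub>pair_group\<^esub> pair_act (iota x) n = verma_rels l"
      using pair_act_verma_rels[OF that] subgroup_verma_rels
      by (intro group.coset_join2) auto
    finally show ?thesis by (simp add: pair_act_simps)
  qed
  moreover have "verma_rels l #>\<^bsub>pair_group\<^esub> f = (\<lambda>n. n + f) ` verma_rels l"
    by (auto simp: r_coset_def)
  moreover have "verma_rels l \<noteq> {}"
    using one_closed by blast
  ultimately show ?thesis by (auto simp: verma_act_def)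
qed


section \<open>Associated varieties\<close>

definition X_cone :: "gl22 set" where
  "X_cone = {x \<in> grade 1. sbracket x x = 0}"

text \<open>\<open>X\<^sub>M\<close> for a module given by its additive group (in the multiplicative notation of
  \<open>monoid\<close> records) and the action of the Lie superalgebra.\<close>

definition X_mod :: "('m, 'b) monoid_scheme \<Rightarrow> (gl22 \<Rightarrow> 'm \<Rightarrow> 'm) \<Rightarrow> gl22 set" where
  "X_mod M act = {x \<in> X_cone. act x ` carrier M \<noteq> kernel M M (act x)}"

definition S_sets :: "weight set set" where
  "S_sets = {S. S \<subseteq> {a \<in> odd_roots. wform a a = 0} \<and> mut_orth S \<and> vec.independent S}"

text \<open>The Borel subgroup of \<open>GL(2) \<times> GL(2)\<close>, acting by conjugation.\<close>

definition borel_group :: "gl22 set" where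
  "borel_group = {g \<in> borel_alg \<inter> grade 0. invertible g}"

text \<open>The orbit does not depend on the choice of the root vectors \<open>x a\<close>, so that the union over
  all choices taken here is a single orbit.\<close>

definition Phi :: "weight set \<Rightarrow> gl22 set" where
  "Phi S = {g ** (\<Sum>a\<in>S. x a) ** matrix_inv g | g x.
     g \<in> borel_group \<and> (\<forall>a\<in>S. x a \<in> root_space a \<and> x a \<noteq> 0)}"

definition S_of :: "weight \<Rightarrow> weight set set" where
  "S_of l = {S \<in> S_sets. Phi S \<subseteq> X_mod (verma l) (verma_act l)}"

end

theory Submission
  imports Defs "HOL-Library.Function_Algebras"
begin

text \<open>The Verma module is identified with an explicit model
  \<open>\<Lambda>(g\<^sub>-\<^sub>1) \<otimes> C[E\<^sub>2\<^sub>1, E\<^sub>4\<^sub>3]\<close>, on which the odd raising operators become differentials and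
  \<open>x \<in> X\<^sub>M\<close> means that \<open>x\<close> is not exact.  The Borel group acts on \<open>g\<close> by automorphisms preserving
  the Borel subalgebra and its character, which turns the condition on the orbit \<open>\<Phi>(S)\<close> into a
  condition on a single sum of root vectors.  Negative odd root vectors act freely.  For a positive
  odd root vector \<open>x\<close>, the complex is the Chevalley-Eilenberg complex of the Lie algebra
  \<open>[x, g\<^sub>-\<^sub>1]\<close> with coefficients in the Verma module of the even part: it is exact when a Koszul
  argument leaves a single homology class, on which some \<open>[x, f]\<close> acts by a nonzero scalar, and
  otherwise an explicit cycle is separated from the boundaries by a linear functional.  A sum of two
  root vectors is exact as soon as its component of lowest degree for a suitable grading is.\<close>

section \<open>A model of the Verma module\<close>

text \<open>The Verma module is given by generators and relations, so an element can be proved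
  nonzero only by mapping it to a known module; the model serves as that module and so supplies the
  linear independence in the Poincare-Birkhoff-Witt theorem. For a positive odd root \<eta> with
  root vector \<open>x\<close>, the brackets of \<open>x\<close> with the four odd lowering
  generators always follow one pattern: one is diagonal, two are root vectors of the even part, one
  is zero. The zero bracket gives the part divided out, the two even root vectors give the Koszul
  complex, and the diagonal bracket gives the scalar. The homology sits at the highest weight vector
  for \<alpha>, but at \<open>y_\<alpha>\<close> applied to it for \<beta> and \<gamma>; hence the
  constants l2 + l3, l1 + l3 + 1 and l2 + l4 - 1, which are the numbers (\<lambda> + \<rho>,
  \<eta>). For \<beta> and \<gamma> the computation uses surjectivity of E12 or E34, which is where
  the position of the weight enters. For \<delta> both even root vectors are raising; there
  exactness comes from non-integrality, which makes the diagonal bracket invertible.\<close>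

type_synonym fvec = "nat \<times> nat \<Rightarrow>\<^sub>0 complex"

lift_definition dg :: "(nat \<times> nat \<Rightarrow> complex) \<Rightarrow> fvec \<Rightarrow> fvec" is "\<lambda>c n k. c k * n k"
  by (simp add: finite_Collect_conjI)

lift_definition up1 :: "fvec \<Rightarrow> fvec" is "\<lambda>n (i, j). case i of 0 \<Rightarrow> 0 | Suc k \<Rightarrow> n (k, j)"
proof -
  fix n :: "nat \<times> nat \<Rightarrow> complex"
  assume f: "finite {k. n k \<noteq> 0}"
  have "{x. (case x of (i, j) \<Rightarrow> case i of 0 \<Rightarrow> 0 | Suc k \<Rightarrow> n (k, j)) \<noteq> 0}
    \<subseteq> (\<lambda>(i, j). (Suc i, j)) ` {k. n k \<noteq> 0}"
    by (auto split: nat.splits simp: image_iff)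
  then show "finite {x. (case x of (i, j) \<Rightarrow> case i of 0 \<Rightarrow> 0 | Suc k \<Rightarrow> n (k, j)) \<noteq> 0}"
    using f finite_subset by blast
qed

lift_definition up2 :: "fvec \<Rightarrow> fvec" is "\<lambda>n (i, j). case j of 0 \<Rightarrow> 0 | Suc k \<Rightarrow> n (i, k)"
proof -
  fix n :: "nat \<times> nat \<Rightarrow> complex"
  assume f: "finite {k. n k \<noteq> 0}"
  have "{x. (case x of (i, j) \<Rightarrow> case j of 0 \<Rightarrow> 0 | Suc k \<Rightarrow> n (i, k)) \<noteq> 0}
    \<subseteq> (\<lambda>(i, j). (i, Suc j)) ` {k. n k \<noteq> 0}"
    by (auto split: nat.splits simp: image_iff)
  then show "finite {x. (case x of (i, j) \<Rightarrow> case j of 0 \<Rightarrow> 0 | Suc k \<Rightarrow> n (i, k)) \<noteq> 0}"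
    using f finite_subset by blast
qed

lift_definition dn1 :: "fvec \<Rightarrow> fvec" is "\<lambda>n (i, j). n (Suc i, j)"
proof -
  fix n :: "nat \<times> nat \<Rightarrow> complex"
  assume "finite {k. n k \<noteq> 0}"
  then have "finite ((\<lambda>(i, j). (Suc i, j)) -` {k. n k \<noteq> 0})"
    by (rule finite_vimageI) (auto simp: inj_on_def)
  then show "finite {x. (case x of (i, j) \<Rightarrow> n (Suc i, j)) \<noteq> 0}"
    by (simp add: vimage_def case_prod_beta)
qed

lift_definition dn2 :: "fvec \<Rightarrow> fvec" is "\<lambda>n (i, j). n (i, Suc j)"
proof -
  fix n :: "nat \<times> nat \<Rightarrow> complex"
  assume "finite {k. n k \<noteq> 0}"
  then have "finite ((\<lambda>(i, j). (i, Suc j)) -` {k. n k \<noteq> 0})"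
    by (rule finite_vimageI) (auto simp: inj_on_def)
  then show "finite {x. (case x of (i, j) \<Rightarrow> n (i, Suc j)) \<noteq> 0}"
    by (simp add: vimage_def case_prod_beta)
qed

abbreviation lk :: "fvec \<Rightarrow> nat \<Rightarrow> nat \<Rightarrow> complex" where
  "lk n i j \<equiv> Poly_Mapping.lookup n (i, j)"

lemma lookup_shifts [simp]:
  "Poly_Mapping.lookup (dg c n) k = c k * Poly_Mapping.lookup n k"
  "lk (up1 n) i j = (case i of 0 \<Rightarrow> 0 | Suc k \<Rightarrow> lk n k j)"
  "lk (up2 n) i j = (case j of 0 \<Rightarrow> 0 | Suc k \<Rightarrow> lk n i k)"
  "lk (dn1 n) i j = lk n (Suc i) j"
  "lk (dn2 n) i j = lk n i (Suc j)"
  by (transfer; simp)+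

lemma fvec_eqI: "(\<And>i j. lk m i j = lk n i j) \<Longrightarrow> m = n"
  by (rule poly_mapping_eqI) auto

abbreviation (input) i1 :: "2 + 2" where "i1 \<equiv> Inl 1"
abbreviation (input) i2 :: "2 + 2" where "i2 \<equiv> Inl 2"
abbreviation (input) i3 :: "2 + 2" where "i3 \<equiv> Inr 1"
abbreviation (input) i4 :: "2 + 2" where "i4 \<equiv> Inr 2"

section \<open>The even Verma module, with the sl(2) formulas on each factor\<close>

definition nH1 :: "weight \<Rightarrow> fvec \<Rightarrow> fvec" where "nH1 l = dg (\<lambda>(i, j). l $ i1 - of_nat i)"
definition nH2 :: "weight \<Rightarrow> fvec \<Rightarrow> fvec" where "nH2 l = dg (\<lambda>(i, j). l $ i2 + of_nat i)"
definition nH3 :: "weight \<Rightarrow> fvec \<Rightarrow> fvec" where "nH3 l = dg (\<lambda>(i, j). l $ i3 - of_nat j)"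
definition nH4 :: "weight \<Rightarrow> fvec \<Rightarrow> fvec" where "nH4 l = dg (\<lambda>(i, j). l $ i4 + of_nat j)"
text \<open>The factor is the sl(2) identity E12 E21^i v = i (l1 - l2 - i + 1) E21^(i-1) v;
  multiplying before the shift evaluates it at the source index.\<close>

definition nE1 :: "weight \<Rightarrow> fvec \<Rightarrow> fvec" where
  "nE1 l n = dn1 (dg (\<lambda>(i, j). of_nat i * (l $ i1 - l $ i2 - of_nat i + 1)) n)"
definition nE2 :: "weight \<Rightarrow> fvec \<Rightarrow> fvec" where
  "nE2 l n = dn2 (dg (\<lambda>(i, j). of_nat j * (l $ i3 - l $ i4 - of_nat j + 1)) n)"

lemmas n_defs = nH1_def nH2_def nH3_def nH4_def nE1_def nE2_def

definition scN :: "complex \<Rightarrow> fvec \<Rightarrow> fvec" where "scN c = dg (\<lambda>_. c)"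

lemma n_linear [simp]:
  "dg c 0 = 0" "dg c (- n) = - dg c n" "dg c (m + n) = dg c m + dg c n" "dg c (m - n) = dg c m - dg c n"
  "up1 0 = 0" "up1 (- n) = - up1 n" "up1 (m + n) = up1 m + up1 n" "up1 (m - n) = up1 m - up1 n"
  "up2 0 = 0" "up2 (- n) = - up2 n" "up2 (m + n) = up2 m + up2 n" "up2 (m - n) = up2 m - up2 n"
  "dn1 0 = 0" "dn1 (- n) = - dn1 n" "dn1 (m + n) = dn1 m + dn1 n" "dn1 (m - n) = dn1 m - dn1 n"
  "dn2 0 = 0" "dn2 (- n) = - dn2 n" "dn2 (m + n) = dn2 m + dn2 n" "dn2 (m - n) = dn2 m - dn2 n"
  by (rule fvec_eqI; simp add: lookup_add lookup_minus algebra_simps split: nat.split)+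

lemma nops_linear [simp]:
  "nH1 l 0 = 0" "nH1 l (- n) = - nH1 l n" "nH1 l (m + n) = nH1 l m + nH1 l n" "nH1 l (m - n) = nH1 l m - nH1 l n"
  "nH2 l 0 = 0" "nH2 l (- n) = - nH2 l n" "nH2 l (m + n) = nH2 l m + nH2 l n" "nH2 l (m - n) = nH2 l m - nH2 l n"
  "nH3 l 0 = 0" "nH3 l (- n) = - nH3 l n" "nH3 l (m + n) = nH3 l m + nH3 l n" "nH3 l (m - n) = nH3 l m - nH3 l n"
  "nH4 l 0 = 0" "nH4 l (- n) = - nH4 l n" "nH4 l (m + n) = nH4 l m + nH4 l n" "nH4 l (m - n) = nH4 l m - nH4 l n"
  "nE1 l 0 = 0" "nE1 l (- n) = - nE1 l n" "nE1 l (m + n) = nE1 l m + nE1 l n" "nE1 l (m - n) = nE1 l m - nE1 l n"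
  "nE2 l 0 = 0" "nE2 l (- n) = - nE2 l n" "nE2 l (m + n) = nE2 l m + nE2 l n" "nE2 l (m - n) = nE2 l m - nE2 l n"
  "scN c 0 = 0" "scN c (- n) = - scN c n" "scN c (m + n) = scN c m + scN c n" "scN c (m - n) = scN c m - scN c n"
  by (simp_all add: n_defs scN_def)

lemma n_comm:
  "up2 (up1 n) = up1 (up2 n)"
  "nH1 l (up1 n) = up1 (nH1 l n) - up1 n" "nH1 l (up2 n) = up2 (nH1 l n)"
  "nH2 l (up1 n) = up1 (nH2 l n) + up1 n" "nH2 l (up2 n) = up2 (nH2 l n)"
  "nH3 l (up2 n) = up2 (nH3 l n) - up2 n" "nH3 l (up1 n) = up1 (nH3 l n)"
  "nH4 l (up2 n) = up2 (nH4 l n) + up2 n" "nH4 l (up1 n) = up1 (nH4 l n)"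
  "nE1 l (up1 n) = up1 (nE1 l n) + nH1 l n - nH2 l n" "nE1 l (up2 n) = up2 (nE1 l n)"
  "nE2 l (up2 n) = up2 (nE2 l n) + nH3 l n - nH4 l n" "nE2 l (up1 n) = up1 (nE2 l n)"
  "nH2 l (nH1 l n) = nH1 l (nH2 l n)" "nH3 l (nH1 l n) = nH1 l (nH3 l n)" "nH4 l (nH1 l n) = nH1 l (nH4 l n)"
  "nH3 l (nH2 l n) = nH2 l (nH3 l n)" "nH4 l (nH2 l n) = nH2 l (nH4 l n)" "nH4 l (nH3 l n) = nH3 l (nH4 l n)"
  "nE1 l (nH1 l n) = nH1 l (nE1 l n) - nE1 l n" "nE1 l (nH2 l n) = nH2 l (nE1 l n) + nE1 l n"
  "nE1 l (nH3 l n) = nH3 l (nE1 l n)" "nE1 l (nH4 l n) = nH4 l (nE1 l n)"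
  "nE2 l (nH3 l n) = nH3 l (nE2 l n) - nE2 l n" "nE2 l (nH4 l n) = nH4 l (nE2 l n) + nE2 l n"
  "nE2 l (nH1 l n) = nH1 l (nE2 l n)" "nE2 l (nH2 l n) = nH2 l (nE2 l n)"
  "nE2 l (nE1 l n) = nE1 l (nE2 l n)"
  by (rule fvec_eqI; simp add: n_defs lookup_add lookup_minus algebra_simps split: nat.split)+

lemma n_scN [simp]:
  "up1 (scN c n) = scN c (up1 n)" "up2 (scN c n) = scN c (up2 n)"
  "nH1 l (scN c n) = scN c (nH1 l n)" "nH2 l (scN c n) = scN c (nH2 l n)"
  "nH3 l (scN c n) = scN c (nH3 l n)" "nH4 l (scN c n) = scN c (nH4 l n)"
  "nE1 l (scN c n) = scN c (nE1 l n)" "nE2 l (scN c n) = scN c (nE2 l n)"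
  by (rule fvec_eqI; simp add: n_defs scN_def algebra_simps split: nat.split)+

section \<open>The exterior algebra on the odd lowering generators\<close>

type_synonym vrm = "bool \<Rightarrow> bool \<Rightarrow> bool \<Rightarrow> bool \<Rightarrow> fvec"

text \<open>The Koszul sign: the odd operators use one factor for each generator that they
  pass.\<close>

definition sg :: "bool \<Rightarrow> fvec \<Rightarrow> fvec" where "sg a n = (if a then - n else n)"

lemma sg_simps [simp]: "sg True n = - n" "sg False n = n"
  by (simp_all add: sg_def)

text \<open>A vector \<open>w\<close> stands for the sum of \<open>y\<^sub>\<alpha>\<^sup>a y\<^sub>\<beta>\<^sup>b y\<^sub>\<gamma>\<^sup>c y\<^sub>\<delta>\<^sup>d (w a b c d)\<close>, where the odd generators
  \<open>y\<^sub>\<eta>\<close> have weight \<open>-\<eta>\<close> and \<open>w a b c d\<close> lies in the Verma module of the even part, with \<open>(i, j)\<close>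
  standing for \<open>E\<^sub>2\<^sub>1\<^sup>i E\<^sub>4\<^sub>3\<^sup>j\<close> applied to the highest weight vector.  \<open>yA\<close>, ..., \<open>yD\<close> multiply
  by the odd generators and \<open>dA\<close>, ..., \<open>dD\<close> are the corresponding odd derivations.\<close>

definition yA :: "vrm \<Rightarrow> vrm" where "yA w = (\<lambda>a b c d. if a then w False b c d else 0)"
definition yB :: "vrm \<Rightarrow> vrm" where "yB w = (\<lambda>a b c d. if b then sg a (w a False c d) else 0)"
definition yC :: "vrm \<Rightarrow> vrm" where "yC w = (\<lambda>a b c d. if c then sg a (sg b (w a b False d)) else 0)"
definition yD :: "vrm \<Rightarrow> vrm" where
  "yD w = (\<lambda>a b c d. if d then sg a (sg b (sg c (w a b c False))) else 0)"
definition dA :: "vrm \<Rightarrow> vrm" where "dA w = (\<lambda>a b c d. if a then 0 else w True b c d)"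
definition dB :: "vrm \<Rightarrow> vrm" where "dB w = (\<lambda>a b c d. if b then 0 else sg a (w a True c d))"
definition dC :: "vrm \<Rightarrow> vrm" where "dC w = (\<lambda>a b c d. if c then 0 else sg a (sg b (w a b True d)))"
definition dD :: "vrm \<Rightarrow> vrm" where
  "dD w = (\<lambda>a b c d. if d then 0 else sg a (sg b (sg c (w a b c True))))"

definition lft :: "(fvec \<Rightarrow> fvec) \<Rightarrow> vrm \<Rightarrow> vrm" where "lft T w = (\<lambda>a b c d. T (w a b c d))"

definition E11 :: "weight \<Rightarrow> vrm \<Rightarrow> vrm" where "E11 l w = lft (nH1 l) w - yB (dB w) - yD (dD w)"
definition E12 :: "weight \<Rightarrow> vrm \<Rightarrow> vrm" where "E12 l w = lft (nE1 l) w - yA (dB w) - yC (dD w)"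
definition E21 :: "weight \<Rightarrow> vrm \<Rightarrow> vrm" where "E21 l w = lft up1 w - yB (dA w) - yD (dC w)"
definition E22 :: "weight \<Rightarrow> vrm \<Rightarrow> vrm" where "E22 l w = lft (nH2 l) w - yA (dA w) - yC (dC w)"
definition E33 :: "weight \<Rightarrow> vrm \<Rightarrow> vrm" where "E33 l w = lft (nH3 l) w + yA (dA w) + yB (dB w)"
definition E34 :: "weight \<Rightarrow> vrm \<Rightarrow> vrm" where "E34 l w = lft (nE2 l) w + yA (dC w) + yB (dD w)"
definition E43 :: "weight \<Rightarrow> vrm \<Rightarrow> vrm" where "E43 l w = lft up2 w + yC (dA w) + yD (dB w)"
definition E44 :: "weight \<Rightarrow> vrm \<Rightarrow> vrm" where "E44 l w = lft (nH4 l) w + yC (dC w) + yD (dD w)"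

text \<open>The odd raising operators are determined by their commutators with the odd generators and by
  killing the degree zero part; this forces the cubic terms.\<close>

definition E13 :: "weight \<Rightarrow> vrm \<Rightarrow> vrm" where
  "E13 l w = dB (lft (nH3 l) w) + dD (lft up2 w) + lft (nH1 l) (dB w) + lft (nE1 l) (dA w)
     - yB (dB (dB w)) - yA (dB (dA w)) - yD (dD (dB w)) - yC (dD (dA w))"
definition E14 :: "weight \<Rightarrow> vrm \<Rightarrow> vrm" where
  "E14 l w = dB (lft (nE2 l) w) + dD (lft (nH4 l) w) + lft (nH1 l) (dD w) + lft (nE1 l) (dC w)
     - yB (dB (dD w)) - yA (dB (dC w)) - yD (dD (dD w)) - yC (dD (dC w))"
definition E23 :: "weight \<Rightarrow> vrm \<Rightarrow> vrm" where
  "E23 l w = dA (lft (nH3 l) w) + dC (lft up2 w) + lft up1 (dB w) + lft (nH2 l) (dA w)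
     - yB (dA (dB w)) - yA (dA (dA w)) - yD (dC (dB w)) - yC (dC (dA w))"
definition E24 :: "weight \<Rightarrow> vrm \<Rightarrow> vrm" where
  "E24 l w = dA (lft (nE2 l) w) + dC (lft (nH4 l) w) + lft up1 (dD w) + lft (nH2 l) (dC w)
     - yB (dA (dD w)) - yA (dA (dC w)) - yD (dC (dD w)) - yC (dC (dC w))"

lemmas E_defs = E11_def E12_def E13_def E14_def E21_def E22_def E23_def E24_def
  E33_def E34_def E43_def E44_def
lemmas yd_defs = yA_def yB_def yC_def yD_def dA_def dB_def dC_def dD_def lft_def

lemma vrm_eq_iff: "(v :: vrm) = w \<longleftrightarrow> (\<forall>a b c d. v a b c d = w a b c d)"
  by (metis ext)

lemma vrm_apply [simp]:
  fixes v w :: vrm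
  shows "(v + w) a b c d = v a b c d + w a b c d" "(v - w) a b c d = v a b c d - w a b c d"
    "(- w) a b c d = - w a b c d" "(0 :: vrm) a b c d = 0"
  by simp_all

lemma nops_double [simp]:
  "nH1 l (2 * n) = 2 * nH1 l n" "nH2 l (2 * n) = 2 * nH2 l n" "nH3 l (2 * n) = 2 * nH3 l n"
  "nH4 l (2 * n) = 2 * nH4 l n" "nE1 l (2 * n) = 2 * nE1 l n" "nE2 l (2 * n) = 2 * nE2 l n"
  "up1 (2 * n) = 2 * up1 n" "up2 (2 * n) = 2 * up2 n"
  by (simp_all only: mult_2 nops_linear n_linear)

lemma UNIV_22: "(UNIV :: (2 + 2) set) = {i1, i2, i3, i4}"
  unfolding UNIV_sum UNIV_2 by auto

lemma all_22: "(\<forall>p :: 2 + 2. P p) \<longleftrightarrow> P i1 \<and> P i2 \<and> P i3 \<and> P i4"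
  by (metis (no_types) UNIV_22 UNIV_I empty_iff insert_iff)

lemma one_neq_two [simp]: "(1 :: 2) \<noteq> 2" "(2 :: 2) \<noteq> 1"
  by simp_all

lemma sum_22: "(\<Sum>p \<in> (UNIV :: (2 + 2) set). f p) = f i1 + f i2 + f i3 + (f i4 :: 'a :: comm_monoid_add)"
  unfolding UNIV_22 by (simp add: add.assoc)

section \<open>Action of the matrix units and their super commutators\<close>

definition Eop :: "weight \<Rightarrow> 2 + 2 \<Rightarrow> 2 + 2 \<Rightarrow> vrm \<Rightarrow> vrm" where
  "Eop l p q =
    (if p = i1 then (if q = i1 then E11 l else if q = i2 then E12 l else if q = i3 then E13 l else E14 l)
     else if p = i2 then (if q = i1 then E21 l else if q = i2 then E22 l else if q = i3 then E23 l else E24 l)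
     else if p = i3 then (if q = i1 then yB else if q = i2 then yA else if q = i3 then E33 l else E34 l)
     else (if q = i1 then yD else if q = i2 then yC else if q = i3 then E43 l else E44 l))"

lemma Eop_simps [simp]:
  "Eop l i1 i1 = E11 l" "Eop l i1 i2 = E12 l" "Eop l i1 i3 = E13 l" "Eop l i1 i4 = E14 l"
  "Eop l i2 i1 = E21 l" "Eop l i2 i2 = E22 l" "Eop l i2 i3 = E23 l" "Eop l i2 i4 = E24 l"
  "Eop l i3 i1 = yB" "Eop l i3 i2 = yA" "Eop l i3 i3 = E33 l" "Eop l i3 i4 = E34 l"
  "Eop l i4 i1 = yD" "Eop l i4 i2 = yC" "Eop l i4 i3 = E43 l" "Eop l i4 i4 = E44 l"
  by (simp_all add: Eop_def)

text \<open>The relations of gl(2|2), solved for one of the two orders. Expanding each of the 256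
  choices of indices over the sixteen odd monomials reduces them to the even identities in
  \<open>n_comm\<close>.\<close>

lemma Eop_comm:
  "Eop l p q (Eop l r s w) =
    (if par p \<noteq> par q \<and> par r \<noteq> par s
     then - Eop l r s (Eop l p q w) + (if q = r then Eop l p s w else 0) + (if p = s then Eop l r q w else 0)
     else Eop l r s (Eop l p q w) + (if q = r then Eop l p s w else 0) - (if p = s then Eop l r q w else 0))"
proof -
  have "\<forall>p q r s. Eop l p q (Eop l r s w) =
    (if par p \<noteq> par q \<and> par r \<noteq> par s
     then - Eop l r s (Eop l p q w) + (if q = r then Eop l p s w else 0) + (if p = s then Eop l r q w else 0)
     else Eop l r s (Eop l p q w) + (if q = r then Eop l p s w else 0) - (if p = s then Eop l r q w else 0))"
    apply (simp only: all_22)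
    apply (intro conjI)
    apply (simp_all only: Eop_simps par.simps if_True if_False simp_thms sum.inject sum.distinct one_neq_two
        zero_neq_one one_neq_zero)
    apply (simp_all add: vrm_eq_iff all_bool_eq E_defs yd_defs n_comm)
    done
  then show ?thesis by blast
qed

definition scV :: "complex \<Rightarrow> vrm \<Rightarrow> vrm" where "scV c = lft (scN c)"

lemma scV_apply [simp]: "scV c w a b c' d = scN c (w a b c' d)"
  by (simp add: scV_def lft_def)

lemma lookup_scN [simp]: "Poly_Mapping.lookup (scN c n) k = c * Poly_Mapping.lookup n k"
  by (simp add: scN_def)

lemma vrm_eqI: "(\<And>a b c d i j. lk (v a b c d) i j = lk (w a b c d) i j) \<Longrightarrow> (v :: vrm) = w"
  by (intro ext fvec_eqI)

interpretation V: vector_space scV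
  by unfold_locales (rule vrm_eqI; simp add: lookup_add algebra_simps)+

lemma scN_sg [simp]: "scN c (sg a n) = sg a (scN c n)"
  by (simp add: sg_def)

lemma scN_double [simp]: "scN c (2 * n) = 2 * scN c n"
  by (simp only: mult_2 nops_linear)

lemma Eop_linear [simp]:
  "Eop l p q (v + w) = Eop l p q v + Eop l p q w"
  "Eop l p q (scV c w) = scV c (Eop l p q w)"
proof -
  have "\<forall>p q. Eop l p q (v + w) = Eop l p q v + Eop l p q w"
    by (simp add: all_22 vrm_eq_iff all_bool_eq E_defs yd_defs)
  then show "Eop l p q (v + w) = Eop l p q v + Eop l p q w" by blast
  have "\<forall>p q. Eop l p q (scV c w) = scV c (Eop l p q w)"
    by (simp add: all_22 vrm_eq_iff all_bool_eq E_defs yd_defs)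
  then show "Eop l p q (scV c w) = scV c (Eop l p q w)" by blast
qed

lemma Eop_additive: "Modules.additive (Eop l p q)"
  by unfold_locales simp

lemmas Eop_sum = Modules.additive.sum[OF Eop_additive]
lemmas Eop_zero [simp] = Modules.additive.zero[OF Eop_additive]
lemmas Eop_diff = Modules.additive.diff[OF Eop_additive]

section \<open>From matrix units to a module over gl(2|2)\<close>

definition rep :: "weight \<Rightarrow> gl22 \<Rightarrow> vrm \<Rightarrow> vrm" where
  "rep l x w = (\<Sum>p\<in>UNIV. \<Sum>q\<in>UNIV. scV (x $ p $ q) (Eop l p q w))"

text \<open>Stated abstractly because it has three uses: for the model, for the enveloping algebra
  under left multiplication, and for the model twisted by an automorphism.\<close>

locale gl_module = vector_space sc for sc :: "complex \<Rightarrow> 'v :: ab_group_add \<Rightarrow> 'v" +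
  fixes act :: "gl22 \<Rightarrow> 'v \<Rightarrow> 'v"
  assumes act_add: "act x (v + w) = act x v + act x w"
    and act_sc: "act x (sc c v) = sc c (act x v)"
    and act_lin: "act (cscale a x + cscale b y) v = sc a (act x v) + sc b (act y v)"
    and act_comm: "\<lbrakk>p < 2; q < 2; x \<in> grade p; y \<in> grade q\<rbrakk> \<Longrightarrow>
      act x (act y v) - sc ((- 1) ^ (p * q)) (act y (act x v)) = act (sbracket x y) v"

lemma grade_entry:
  assumes "x \<in> grade p" "x $ i $ j \<noteq> 0"
  shows "(par i + par j) mod 2 = p"
proof -
  have "x $ i $ j = proj p x $ i $ j" using assms by (simp add: grade_def)
  then show ?thesis using assms by (simp add: proj_def split: if_splits)
qed

lemma proj_grade:
  assumes "x \<in> grade p"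
  shows "proj q x = (if q = p then x else 0)"
proof -
  have "proj q x $ i $ j = (if q = p then x else 0) $ i $ j" for i j
    using grade_entry[OF assms, of i j] by (cases "x $ i $ j = 0") (simp_all add: proj_def)
  then show ?thesis by (simp add: vec_eq_iff)
qed

lemma sbracket_grade:
  assumes "p < 2" "q < 2" "x \<in> grade p" "y \<in> grade q"
  shows "sbracket x y = x ** y - (- 1) ^ (p * q) *\<^sub>R (y ** x)"
proof -
  have "p = 0 \<or> p = 1" "q = 0 \<or> q = 1" using assms by auto
  then show ?thesis
    unfolding sbracket_def numeral_2_eq_2 lessThan_Suc
    using assms by (elim disjE) (simp_all add: proj_grade)
qed

lemma par_cases: "par i = 0 \<or> par i = 1"
  by (cases i) auto

lemma Eop_supercomm:
  assumes "(par i + par j) mod 2 = p" "(par k + par m) mod 2 = q"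
  shows "Eop l i j (Eop l k m w) - scV ((- 1) ^ (p * q)) (Eop l k m (Eop l i j w)) =
    (if j = k then Eop l i m w else 0) - scV ((- 1) ^ (p * q)) (if i = m then Eop l k j w else 0)"
proof -
  have *: "scV (- 1) v = - v" for v using V.scale_minus_left[of 1 v] by simp
  have odd: "p = (if par i = par j then 0 else 1)" "q = (if par k = par m then 0 else 1)"
    using assms par_cases[of i] par_cases[of j] par_cases[of k] par_cases[of m] by auto
  show ?thesis
    unfolding Eop_comm[of l i j k m w] odd by (simp add: *)
qed

lemma rep_rep:
  "rep l x (rep l y w) = (\<Sum>i\<in>UNIV. \<Sum>j\<in>UNIV. \<Sum>k\<in>UNIV. \<Sum>m\<in>UNIV.
    scV (x $ i $ j * y $ k $ m) (Eop l i j (Eop l k m w)))"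
  unfolding rep_def by (simp add: Eop_sum V.scale_sum_right)

lemma sum_swap3:
  "(\<Sum>m\<in>B. \<Sum>i\<in>C. \<Sum>j\<in>D. f m i j) = (\<Sum>i\<in>C. \<Sum>j\<in>D. \<Sum>m\<in>B. f m i j :: 'a :: comm_monoid_add)"
proof -
  have "(\<Sum>m\<in>B. \<Sum>i\<in>C. \<Sum>j\<in>D. f m i j) = (\<Sum>i\<in>C. \<Sum>m\<in>B. \<Sum>j\<in>D. f m i j)"
    by (rule sum.swap)
  also have "\<dots> = (\<Sum>i\<in>C. \<Sum>j\<in>D. \<Sum>m\<in>B. f m i j)"
    by (intro sum.cong refl) (rule sum.swap)
  finally show ?thesis .
qed

lemma sum_swap4:
  "(\<Sum>k\<in>A. \<Sum>m\<in>B. \<Sum>i\<in>C. \<Sum>j\<in>D. f k m i j) =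
    (\<Sum>i\<in>C. \<Sum>j\<in>D. \<Sum>k\<in>A. \<Sum>m\<in>B. f k m i j :: 'a :: comm_monoid_add)"
  unfolding sum_swap3[of _ D C B] sum_swap3[of _ D C A] by (rule refl)

lemma rep_rep':
  "rep l y (rep l x w) = (\<Sum>i\<in>UNIV. \<Sum>j\<in>UNIV. \<Sum>k\<in>UNIV. \<Sum>m\<in>UNIV.
    scV (x $ i $ j * y $ k $ m) (Eop l k m (Eop l i j w)))"
  unfolding rep_rep by (subst sum_swap4) (simp add: mult.commute)

lemma rep_mult:
  "(\<Sum>i\<in>UNIV. \<Sum>j\<in>UNIV. \<Sum>k\<in>UNIV. \<Sum>m\<in>UNIV.
    scV (x $ i $ j * y $ k $ m) (if j = k then Eop l i m w else 0)) = rep l (x ** y) w"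
proof -
  have "(\<Sum>i\<in>UNIV. \<Sum>j\<in>UNIV. \<Sum>k\<in>UNIV. \<Sum>m\<in>UNIV.
      scV (x $ i $ j * y $ k $ m) (if j = k then Eop l i m w else 0)) =
    (\<Sum>i\<in>UNIV. \<Sum>j\<in>UNIV. \<Sum>m\<in>UNIV. scV (x $ i $ j * y $ j $ m) (Eop l i m w))"
  proof (intro sum.cong refl)
    fix i j
    have "(\<Sum>k\<in>UNIV. \<Sum>m\<in>UNIV. scV (x $ i $ j * y $ k $ m) (if j = k then Eop l i m w else 0)) =
      (\<Sum>k\<in>UNIV. if j = k then (\<Sum>m\<in>UNIV. scV (x $ i $ j * y $ k $ m) (Eop l i m w)) else 0)"
      by (intro sum.cong) auto
    then show "(\<Sum>k\<in>UNIV. \<Sum>m\<in>UNIV. scV (x $ i $ j * y $ k $ m) (if j = k then Eop l i m w else 0)) =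
      (\<Sum>m\<in>UNIV. scV (x $ i $ j * y $ j $ m) (Eop l i m w))" by simp
  qed
  also have "\<dots> = (\<Sum>i\<in>UNIV. \<Sum>m\<in>UNIV. \<Sum>j\<in>UNIV. scV (x $ i $ j * y $ j $ m) (Eop l i m w))"
    by (intro sum.cong refl) (rule sum.swap)
  also have "\<dots> = rep l (x ** y) w"
    unfolding rep_def matrix_matrix_mult_def by (simp add: V.scale_sum_left)
  finally show ?thesis .
qed

lemma rep_mult':
  "(\<Sum>i\<in>UNIV. \<Sum>j\<in>UNIV. \<Sum>k\<in>UNIV. \<Sum>m\<in>UNIV.
    scV (x $ i $ j * y $ k $ m) (if i = m then Eop l k j w else 0)) = rep l (y ** x) w"
proof -
  have "(\<Sum>i\<in>UNIV. \<Sum>j\<in>UNIV. \<Sum>k\<in>UNIV. \<Sum>m\<in>UNIV.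
      scV (x $ i $ j * y $ k $ m) (if i = m then Eop l k j w else 0)) =
    (\<Sum>k\<in>UNIV. \<Sum>m\<in>UNIV. \<Sum>i\<in>UNIV. \<Sum>j\<in>UNIV.
      scV (x $ i $ j * y $ k $ m) (if i = m then Eop l k j w else 0))"
  by (rule sum_swap4)
  also have "\<dots> = rep l (y ** x) w"
    unfolding rep_mult[symmetric] by (intro sum.cong refl) (simp add: mult.commute)
  finally show ?thesis .
qed

lemma rep_lin: "rep l (cscale a x + cscale b y) v = scV a (rep l x v) + scV b (rep l y v)"
  by (simp add: rep_def cscale_def V.scale_left_distrib sum.distrib V.scale_sum_right)

lemma rep_diff: "rep l (x - y) v = rep l x v - rep l y v"
  by (simp add: rep_def V.scale_left_diff_distrib sum_subtractf)

lemma rep_scaleR: "rep l (r *\<^sub>R x) v = scV (of_real r) (rep l x v)"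
  by (simp add: rep_def V.scale_sum_right scaleR_conv_of_real[where 'a = complex])

text \<open>By bilinearity the relation is checked on matrix units. Homogeneity fixes their parities
  wherever both entries are nonzero, and the Kronecker terms add up to the two matrix
  products.\<close>

lemma rep_supercomm:
  assumes "p < 2" "q < 2" "x \<in> grade p" "y \<in> grade q"
  shows "rep l x (rep l y v) - scV ((- 1) ^ (p * q)) (rep l y (rep l x v)) = rep l (sbracket x y) v"
proof -
  let ?s = "(- 1) ^ (p * q) :: complex"
  have "rep l x (rep l y v) - scV ?s (rep l y (rep l x v)) =
    (\<Sum>i\<in>UNIV. \<Sum>j\<in>UNIV. \<Sum>k\<in>UNIV. \<Sum>m\<in>UNIV. scV (x $ i $ j * y $ k $ m)
      (Eop l i j (Eop l k m v) - scV ?s (Eop l k m (Eop l i j v))))"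
    unfolding rep_rep[of l x y v] rep_rep'[of l y x v]
    by (simp add: V.scale_sum_right sum_subtractf V.scale_right_diff_distrib mult.commute)
  also have "\<dots> = (\<Sum>i\<in>UNIV. \<Sum>j\<in>UNIV. \<Sum>k\<in>UNIV. \<Sum>m\<in>UNIV. scV (x $ i $ j * y $ k $ m)
      ((if j = k then Eop l i m v else 0) - scV ?s (if i = m then Eop l k j v else 0)))"
  proof (intro sum.cong refl)
    fix i j k m
    show "scV (x $ i $ j * y $ k $ m)
        (Eop l i j (Eop l k m v) - scV ?s (Eop l k m (Eop l i j v))) =
      scV (x $ i $ j * y $ k $ m)
        ((if j = k then Eop l i m v else 0) - scV ?s (if i = m then Eop l k j v else 0))"
    proof (cases "x $ i $ j = 0 \<or> y $ k $ m = 0")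
      case False
      then show ?thesis
        using Eop_supercomm[of i j p k m q l v] grade_entry[OF assms(3)] grade_entry[OF assms(4)] by auto
    qed auto
  qed
  also have "\<dots> = rep l (x ** y) v - scV ?s (rep l (y ** x) v)"
    unfolding rep_mult[of x y l v, symmetric] rep_mult'[of x y l v, symmetric]
    by (simp add: V.scale_sum_right sum_subtractf V.scale_right_diff_distrib mult.commute)
  also have "\<dots> = rep l (sbracket x y) v"
    unfolding sbracket_grade[OF assms] by (simp add: rep_diff rep_scaleR)
  finally show ?thesis .
qed

interpretation V: gl_module scV "rep l" for l
proof
  show "rep l x (v + w) = rep l x v + rep l x w" for x v w
    by (simp add: rep_def V.scale_right_distrib sum.distrib)
  show "rep l x (scV c v) = scV c (rep l x v)" for x c v
    by (simp add: rep_def V.scale_sum_right mult.commute)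
qed (simp_all add: rep_lin rep_supercomm)

definition fone :: fvec where "fone = Poly_Mapping.single (0, 0) 1"

definition vac :: "fvec \<Rightarrow> vrm" where
  "vac n = (\<lambda>a b c d. if a \<or> b \<or> c \<or> d then 0 else n)"

lemma lk_fone [simp]: "lk fone i j = (if i = 0 \<and> j = 0 then 1 else 0)"
  by (simp add: fone_def lookup_single when_def)

lemma nops_fone [simp]:
  "nH1 l fone = scN (l $ i1) fone" "nH2 l fone = scN (l $ i2) fone"
  "nH3 l fone = scN (l $ i3) fone" "nH4 l fone = scN (l $ i4) fone"
  "nE1 l fone = 0" "nE2 l fone = 0"
  by (rule fvec_eqI; simp add: n_defs)+

lemma vac_apply [simp]: "vac n False False False False = n" "a \<or> b \<or> c \<or> d \<Longrightarrow> vac n a b c d = 0"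
  by (auto simp: vac_def)

text \<open>For lowering units the right-hand side repeats the left. The content is that raising
  units kill the highest weight vector and diagonal ones scale it, and this form allows a single
  check over all index pairs.\<close>

lemma Eop_vac:
  "Eop l p q (vac fone) = (if pos q < pos p then Eop l p q (vac fone)
     else if p = q then scV (l $ p) (vac fone) else 0)"
proof -
  have "\<forall>p q. Eop l p q (vac fone) = (if pos q < pos p then Eop l p q (vac fone)
     else if p = q then scV (l $ p) (vac fone) else 0)"
    by (simp add: all_22 pos_def vrm_eq_iff all_bool_eq E_defs yd_defs vac_def)
  then show ?thesis by blast
qed

lemma rep_vac:
  assumes "x \<in> borel_alg"
  shows "rep l x (vac fone) = scV (wt_eval l x) (vac fone)"
proof -
  have "scV (x $ p $ q) (Eop l p q (vac fone)) = (if p = q then scV (l $ p * x $ p $ p) (vac fone) else 0)"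
    for p q
  proof (cases "pos q < pos p")
    case True
    then show ?thesis using assms by (auto simp: borel_alg_def)
  next
    case False
    then show ?thesis by (subst Eop_vac) (simp add: mult.commute)
  qed
  then show ?thesis
    by (simp add: rep_def wt_eval_def V.scale_sum_left)
qed

section \<open>The universal enveloping algebra acting on a module\<close>

lemma poly_mapping_sum_single: "f = (\<Sum>k\<in>Poly_Mapping.keys f. Poly_Mapping.single k (Poly_Mapping.lookup f k))"
proof (rule poly_mapping_eqI)
  fix k
  have "Poly_Mapping.lookup (\<Sum>k\<in>Poly_Mapping.keys f. Poly_Mapping.single k (Poly_Mapping.lookup f k)) k =
    (\<Sum>k'\<in>Poly_Mapping.keys f. if k = k' then Poly_Mapping.lookup f k' else 0)"
    unfolding lookup_sum by (intro sum.cong) (auto simp: lookup_single when_def)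
  then show "Poly_Mapping.lookup f k =
    Poly_Mapping.lookup (\<Sum>k\<in>Poly_Mapping.keys f. Poly_Mapping.single k (Poly_Mapping.lookup f k)) k"
    by (simp add: in_keys_iff)
qed

lemma poly_mapping_add_induct [case_names single add]:
  assumes "\<And>k a. P (Poly_Mapping.single k a)" "\<And>f g. P f \<Longrightarrow> P g \<Longrightarrow> P (f + g)"
  shows "P (f :: 'a \<Rightarrow>\<^sub>0 'b :: comm_monoid_add)"
proof -
  have "P (\<Sum>k\<in>A. Poly_Mapping.single k (Poly_Mapping.lookup f k))" if "finite A" for A
    using that
  proof induction
    case empty
    then show ?case using assms(1)[of undefined 0] by simp
  qed (simp add: assms)
  then show ?thesis by (subst poly_mapping_sum_single) simp
qed

text \<open>\<open>F\<close> receives the coefficient as an argument, so that one extension serves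
  the complex coefficients of the free algebra and of polynomials as well as the integer
  coefficients of formal pairs.\<close>

definition lext :: "('k \<Rightarrow> 'b \<Rightarrow> 'v :: comm_monoid_add) \<Rightarrow> ('k \<Rightarrow>\<^sub>0 'b :: zero) \<Rightarrow> 'v" where
  "lext F f = (\<Sum>k\<in>Poly_Mapping.keys f. F k (Poly_Mapping.lookup f k))"

lemma lext_superset:
  assumes "\<And>k. F k 0 = 0" "finite A" "Poly_Mapping.keys f \<subseteq> A"
  shows "lext F f = (\<Sum>k\<in>A. F k (Poly_Mapping.lookup f k))"
  unfolding lext_def by (rule sum.mono_neutral_left) (use assms in \<open>auto simp: in_keys_iff\<close>)

lemma lext_add:
  fixes f g :: "'k \<Rightarrow>\<^sub>0 'b :: comm_monoid_add"
  assumes "\<And>k. F k 0 = 0" "\<And>k a b. F k (a + b) = F k a + F k b"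
  shows "lext F (f + g) = lext F f + lext F g"
proof -
  let ?A = "Poly_Mapping.keys f \<union> Poly_Mapping.keys g"
  have "lext F h = (\<Sum>k\<in>?A. F k (Poly_Mapping.lookup h k))" if "h \<in> {f, g, f + g}" for h
    using that keys_add[of f g] by (intro lext_superset) (auto simp: assms)
  then show ?thesis by (simp add: lookup_add assms sum.distrib)
qed

lemma lext_single: "(\<And>k. F k 0 = 0) \<Longrightarrow> lext F (Poly_Mapping.single k a) = F k a"
  by (simp add: lext_def)

context gl_module
begin

definition wact :: "gword \<Rightarrow> 'v \<Rightarrow> 'v" where
  "wact u v = (case u of GWord xs \<Rightarrow> foldr act xs v)"

definition falg :: "free_alg \<Rightarrow> 'v \<Rightarrow> 'v" where
  "falg f v = lext (\<lambda>u a. sc a (wact u v)) f"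

lemma wact_plus: "wact (u + w) v = wact u (wact w v)"
  by (cases u; cases w) (simp add: wact_def)

lemma wact_add: "wact u (v + w) = wact u v + wact u w"
proof (cases u)
  case (GWord xs)
  have "foldr act xs (v + w) = foldr act xs v + foldr act xs w"
    by (induction xs) (simp_all add: act_add)
  then show ?thesis by (simp add: wact_def GWord)
qed

lemma wact_sc: "wact u (sc c v) = sc c (wact u v)"
proof (cases u)
  case (GWord xs)
  have "foldr act xs (sc c v) = sc c (foldr act xs v)"
    by (induction xs) (simp_all add: act_sc)
  then show ?thesis by (simp add: wact_def GWord)
qed

lemma falg_single: "falg (Poly_Mapping.single u a) v = sc a (wact u v)"
  unfolding falg_def by (rule lext_single) simp

lemma falg_plus: "falg (f + g) v = falg f v + falg g v"
  unfolding falg_def by (rule lext_add) (simp_all add: scale_left_distrib)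

lemma falg_diff: "falg (f - g) v = falg f v - falg g v"
  using falg_plus[of "f - g" g v] by simp

lemma falg_add: "falg f (v + w) = falg f v + falg f w"
  by (simp add: falg_def lext_def wact_add scale_right_distrib sum.distrib)

lemma falg_sc: "falg f (sc c v) = sc c (falg f v)"
  by (simp add: falg_def lext_def wact_sc scale_sum_right mult.commute)

lemma falg_times: "falg (f * g) v = falg f (falg g v)"
proof (induction f rule: poly_mapping_add_induct)
  case (single k a)
  show ?case
    by (induction g rule: poly_mapping_add_induct)
       (simp_all add: mult_single falg_single wact_plus wact_sc distrib_left falg_plus falg_add)
qed (simp add: distrib_right falg_plus)

lemma falg_fgen [simp]: "falg (fgen x) v = act x v"
  by (simp add: fgen_def falg_single wact_def)

lemma falg_fconst [simp]: "falg (fconst c) v = sc c v"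
  by (simp add: fconst_def falg_single wact_def zero_gword_def)

text \<open>The module axioms make the generating relations act by zero. The vector is kept
  arbitrary because in a two-sided multiple the right factor moves it first.\<close>

lemma falg_ideal: "f \<in> uea_ideal \<Longrightarrow> falg f v = 0"
proof (induction arbitrary: v rule: uea_ideal.induct)
  case (lin a x b y)
  then show ?case by (simp add: falg_diff falg_plus falg_times act_lin)
next
  case (comm p q x y)
  have "(- 1) ^ (p * q) = fconst ((- 1) ^ (p * q))"
  proof -
    have "fconst (- 1) = - 1" "fconst 1 = 1"
      by (simp_all add: fconst_def single_uminus)
    then show ?thesis by (cases "even (p * q)") simp_all
  qed
  with comm show ?case by (simp add: falg_diff falg_times act_comm[symmetric])
next
  case zero
  then show ?case by (simp add: falg_def lext_def)
next
  case (mult f u w)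
  then show ?case using falg_sc[of u 0 0] by (simp add: falg_times)
qed (simp add: falg_diff)

text \<open>Defined through a chosen representative; \<open>uact_abs\<close> removes the choice,
  since representatives differ by the ideal, which acts by zero.\<close>

definition uact :: "uea \<Rightarrow> 'v \<Rightarrow> 'v" where "uact u v = falg (rep_uea u) v"

lemma uact_abs: "uact (abs_uea f) v = falg f v"
proof -
  have "uea_rel (rep_uea (abs_uea f)) f"
    using Quotient3_rep_abs[OF Quotient3_uea] equivp_reflp[OF equivp_uea_rel] by blast
  then have "rep_uea (abs_uea f) - f \<in> uea_ideal" by (simp add: uea_rel_def)
  then have "falg (rep_uea (abs_uea f) - f) v = 0" by (rule falg_ideal)
  then show ?thesis by (simp add: uact_def falg_diff)
qed

lemma uact_plus: "uact (u + w) v = uact u v + uact w v"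
  by (induction u rule: uea.abs_induct; induction w rule: uea.abs_induct)
     (simp add: plus_uea.abs_eq uact_abs falg_plus)

lemma uact_diff: "uact (u - w) v = uact u v - uact w v"
  using uact_plus[of "u - w" w v] by simp

lemma uact_times: "uact (u * w) v = uact u (uact w v)"
  by (induction u rule: uea.abs_induct; induction w rule: uea.abs_induct)
     (simp add: times_uea.abs_eq uact_abs falg_times)

lemma uact_sc: "uact u (sc c v) = sc c (uact u v)"
  by (simp add: uact_def falg_sc)

lemma uact_iota [simp]: "uact (iota x) v = act x v"
  by (simp add: iota.abs_eq uact_abs)

lemma uact_uconst [simp]: "uact (uconst c) v = sc c v"
  by (simp add: uconst.abs_eq uact_abs)

end

lemma fconst_plus: "fconst (a + b) = fconst a + fconst b"
  by (simp add: fconst_def single_add)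

lemma fconst_times: "fconst (a * b) = fconst a * fconst b"
  by (simp add: fconst_def mult_single)

lemma fconst_central: "fconst c * f = f * fconst c"
  by (induction f rule: poly_mapping_add_induct)
     (simp_all add: fconst_def mult_single mult.commute distrib_left distrib_right)

lemma fconst_one: "fconst 1 = 1" and fconst_minus_one: "fconst (- 1) = - 1" and fconst_zero: "fconst 0 = 0"
  by (simp_all add: fconst_def single_uminus)

lemma uea_rel_refl: "f = g \<Longrightarrow> uea_rel f g"
  by (simp add: uea_rel_def uea_ideal.zero)

lemma uconst_plus: "uconst (a + b) = uconst a + uconst b"
  by transfer (simp add: uea_rel_refl fconst_plus)

lemma uconst_times: "uconst (a * b) = uconst a * uconst b"
  by transfer (simp add: uea_rel_refl fconst_times)

lemma uconst_central: "uconst c * u = u * uconst c"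
  by transfer (rule uea_rel_refl, rule fconst_central)

lemma uconst_one [simp]: "uconst 1 = 1"
  by transfer (simp add: uea_rel_refl fconst_one)

lemma uconst_zero [simp]: "uconst 0 = 0"
  by transfer (simp add: uea_rel_refl fconst_zero)

lemma iota_lin: "iota (cscale a x + cscale b y) = uconst a * iota x + uconst b * iota y"
  by transfer (simp add: uea_rel_def uea_ideal.lin)

lemma iota_comm:
  assumes "p < 2" "q < 2" "x \<in> grade p" "y \<in> grade q"
  shows "iota x * iota y - uconst ((- 1) ^ (p * q)) * (iota y * iota x) = iota (sbracket x y)"
proof -
  have "(- 1) ^ (p * q) = fconst ((- 1) ^ (p * q))"
    by (cases "even (p * q)") (simp_all add: fconst_one fconst_minus_one)
  then have "uea_rel (fgen x * fgen y - fconst ((- 1) ^ (p * q)) * (fgen y * fgen x)) (fgen (sbracket x y))"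
    using uea_ideal.comm[OF assms] by (simp add: uea_rel_def)
  then show ?thesis by transfer
qed

interpretation U: gl_module "\<lambda>c u. uconst c * u" "\<lambda>x u. iota x * u"
proof
  show "iota x * (uconst c * u) = uconst c * (iota x * u)" for x c u
    by (metis mult.assoc uconst_central)
  show "iota x * (iota y * u) - uconst ((- 1) ^ (p * q)) * (iota y * (iota x * u)) = iota (sbracket x y) * u"
    if "p < 2" "q < 2" "x \<in> grade p" "y \<in> grade q" for p q x y u
    unfolding iota_comm[OF that, symmetric] by (simp add: left_diff_distrib mult.assoc)
qed (simp_all add: distrib_left distrib_right uconst_plus uconst_times mult.assoc iota_lin)

lemma single_word: "Poly_Mapping.single (GWord xs) a = fconst a * foldr (\<lambda>x f. fgen x * f) xs 1"
proof -
  have "Poly_Mapping.single (GWord xs) 1 = foldr (\<lambda>x f. fgen x * f) xs 1"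
  proof (induction xs)
    case Nil
    then show ?case by (simp add: fconst_one[symmetric] fconst_def zero_gword_def)
  next
    case (Cons x xs)
    have "Poly_Mapping.single (GWord (x # xs)) 1 = fgen x * Poly_Mapping.single (GWord xs) 1"
      by (simp add: fgen_def mult_single)
    then show ?case by (simp add: Cons)
  qed
  moreover have "Poly_Mapping.single (GWord xs) a = fconst a * Poly_Mapping.single (GWord xs) 1"
    by (simp add: fconst_def mult_single zero_gword_def)
  ultimately show ?thesis by simp
qed

lemma uea_induct [case_names one iota const add]:
  assumes "P 1" "\<And>x u. P u \<Longrightarrow> P (iota x * u)" "\<And>c u. P u \<Longrightarrow> P (uconst c * u)"
    "\<And>u v. P u \<Longrightarrow> P v \<Longrightarrow> P (u + v)"
  shows "P u"
proof (induction u rule: uea.abs_induct)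
  case (1 f)
  show ?case
  proof (induction f rule: poly_mapping_add_induct)
    case (single k a)
    obtain xs where k: "k = GWord xs" by (cases k)
    have "Poly_Mapping.single k a = fconst a * foldr (\<lambda>x f. fgen x * f) xs 1"
      unfolding k by (rule single_word)
    moreover have "P (abs_uea (foldr (\<lambda>x f. fgen x * f) xs 1))"
    proof (induction xs)
      case Nil
      then show ?case using assms(1) by (simp add: one_uea.abs_eq)
    next
      case (Cons x xs)
      then show ?case using assms(2)[of "abs_uea (foldr (\<lambda>x f. fgen x * f) xs 1)" x]
        by (simp add: iota.abs_eq times_uea.abs_eq)
    qed
    ultimately show ?case
      using assms(3)[of "abs_uea (foldr (\<lambda>x f. fgen x * f) xs 1)" a]
      by (simp add: uconst.abs_eq times_uea.abs_eq)
  next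
    case (add f g)
    then show ?case using assms(4) by (simp add: plus_uea.abs_eq[symmetric])
  qed
qed

section \<open>The Verma module\<close>

lemma verma_rels_closed:
  "0 \<in> verma_rels l" "f \<in> verma_rels l \<Longrightarrow> g \<in> verma_rels l \<Longrightarrow> f + g \<in> verma_rels l"
  "f \<in> verma_rels l \<Longrightarrow> - f \<in> verma_rels l" "f \<in> verma_rels l \<Longrightarrow> g \<in> verma_rels l \<Longrightarrow> f - g \<in> verma_rels l"
proof -
  interpret subgroup "verma_rels l" "pair_group" by (rule subgroup_verma_rels)
  show "0 \<in> verma_rels l" using one_closed by simp
  show p: "f \<in> verma_rels l \<Longrightarrow> g \<in> verma_rels l \<Longrightarrow> f + g \<in> verma_rels l" for f g
    using m_closed[of f g] by simp
  show m: "f \<in> verma_rels l \<Longrightarrow> - f \<in> verma_rels l" for f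
    using m_inv_closed[of f] by simp
  show "f \<in> verma_rels l \<Longrightarrow> g \<in> verma_rels l \<Longrightarrow> f - g \<in> verma_rels l"
    using p[OF _ m, of f g] by simp
qed

lemma verma_rels_gens:
  "frag_of (u + v, c) - frag_of (u, c) - frag_of (v, c) \<in> verma_rels l"
  "frag_of (u, c + d) - frag_of (u, c) - frag_of (u, d) \<in> verma_rels l"
  "borel_char l w a \<Longrightarrow> frag_of (u * w, c) - frag_of (u, a * c) \<in> verma_rels l"
proof -
  have *: "h \<in> verma_gens l \<Longrightarrow> h \<in> verma_rels l" for h
    unfolding verma_rels_def by (rule generate.incl)
  show "frag_of (u + v, c) - frag_of (u, c) - frag_of (v, c) \<in> verma_rels l"
    "frag_of (u, c + d) - frag_of (u, c) - frag_of (u, d) \<in> verma_rels l"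
    "borel_char l w a \<Longrightarrow> frag_of (u * w, c) - frag_of (u, a * c) \<in> verma_rels l"
    by (rule *; unfold verma_gens_def; blast)+
qed

text \<open>The left ideal of all \<open>u\<close> with u \<otimes> 1 = 0. As every tensor can be
  written u \<otimes> 1 (\<open>verma_normal_form\<close>), the Verma module is the enveloping
  algebra modulo this ideal.\<close>

definition hw_ann :: "weight \<Rightarrow> uea set" where
  "hw_ann l = {u. frag_of (u, 1) \<in> verma_rels l}"

lemma frag_diff_rel: "frag_of (u - v, c) - (frag_of (u, c) - frag_of (v, c)) \<in> verma_rels l"
  using verma_rels_closed(3)[OF verma_rels_gens(1)[of "u - v" v c l]] by (simp add: algebra_simps)

lemma frag_diff_ann: "frag_of (u, 1) - frag_of (v, 1) \<in> verma_rels l \<longleftrightarrow> u - v \<in> hw_ann l"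
  using verma_rels_closed(2)[OF frag_diff_rel[of u v 1 l], of "frag_of (u, 1) - frag_of (v, 1)"]
    verma_rels_closed(4)[OF _ frag_diff_rel[of u v 1 l], of "frag_of (u - v, 1)"]
  by (auto simp: hw_ann_def)

lemma hw_ann_zero [simp]: "0 \<in> hw_ann l"
  using frag_diff_ann[of 0 0 l] verma_rels_closed(1) by simp

lemma hw_ann_diff: "u \<in> hw_ann l \<Longrightarrow> v \<in> hw_ann l \<Longrightarrow> u - v \<in> hw_ann l"
  using verma_rels_closed(4)[of "frag_of (u, 1)" l "frag_of (v, 1)"] frag_diff_ann[of u v l]
  by (simp add: hw_ann_def)

lemma hw_ann_minus: "u \<in> hw_ann l \<Longrightarrow> - u \<in> hw_ann l"
  using hw_ann_diff[of 0 l u] by simp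

lemma hw_ann_add: "u \<in> hw_ann l \<Longrightarrow> v \<in> hw_ann l \<Longrightarrow> u + v \<in> hw_ann l"
  using hw_ann_diff[of u l "- v"] hw_ann_minus[of v l] by simp

lemma hw_ann_left: "u \<in> hw_ann l \<Longrightarrow> w * u \<in> hw_ann l"
  using pair_act_verma_rels[of "frag_of (u, 1)" l w] by (simp add: hw_ann_def pair_act_simps)

lemma hw_ann_char:
  assumes "borel_char l w a"
  shows "w - uconst a \<in> hw_ann l"
proof -
  \<comment> \<open>\<open>w\<close> and the constant \<open>a\<close> act on the one-dimensional
    module by the same number, so their balancing relations share the second term, which
    cancels.\<close>
  have "frag_of (1 * w, 1) - frag_of (1, a * 1) - (frag_of (1 * uconst a, 1) - frag_of (1, a * 1)) \<in> verma_rels l"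
    by (intro verma_rels_closed(4) verma_rels_gens(3) assms borel_char.const)
  then show ?thesis by (simp add: frag_diff_ann)
qed

text \<open>A scalar crosses the tensor sign as \<open>uconst c\<close>, which belongs to U(b);
  differences are absorbed by additivity in the first component.\<close>

lemma verma_normal_form: "\<exists>u. f - frag_of (u, 1) \<in> verma_rels l"
proof (rule frag_induction[where S = UNIV and c = f])
  show "\<exists>u. 0 - frag_of (u, 1) \<in> verma_rels l"
    using verma_rels_closed(3)[of "frag_of (0, 1)" l] hw_ann_zero[of l] by (auto simp: hw_ann_def)
next
  fix x :: "uea \<times> complex"
  obtain u c where x: "x = (u, c)" by (cases x)
  have "frag_of (u * uconst c, 1) - frag_of (u, c * 1) \<in> verma_rels l"
    by (intro verma_rels_gens(3) borel_char.const)
  from verma_rels_closed(3)[OF this] show "\<exists>u. frag_of x - frag_of (u, 1) \<in> verma_rels l"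
    unfolding x by auto
next
  fix a b
  assume "\<exists>u. a - frag_of (u, 1) \<in> verma_rels l" "\<exists>u. b - frag_of (u, 1) \<in> verma_rels l"
  then obtain u v where uv: "a - frag_of (u, 1) \<in> verma_rels l" "b - frag_of (v, 1) \<in> verma_rels l"
    by blast
  from verma_rels_closed(4)[OF verma_rels_closed(4)[OF uv] frag_diff_rel[of u v 1]]
  show "\<exists>u. a - b - frag_of (u, 1) \<in> verma_rels l"
    by (intro exI[of _ "u - v"]) (simp add: algebra_simps)
qed auto

text \<open>The targets of the universal property of the Verma module.\<close>

locale hw_module = gl_module sc act for sc :: "complex \<Rightarrow> 'v :: ab_group_add \<Rightarrow> 'v" and act +
  fixes l :: weight and v0 :: 'v
  assumes hw: "b \<in> borel_alg \<Longrightarrow> act b v0 = sc (wt_eval l b) v0"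
begin

lemma uact_char: "borel_char l w a \<Longrightarrow> uact w v0 = sc a v0"
  by (induction rule: borel_char.induct)
     (simp_all add: hw uact_plus uact_times uact_sc scale_left_distrib mult.commute)

text \<open>The homomorphism sending u \<otimes> c to c u v0, on the free abelian group before the
  relations are divided out; integer multiplicities become scalars.\<close>

definition pair_map :: "(uea \<times> complex \<Rightarrow>\<^sub>0 int) \<Rightarrow> 'v" where
  "pair_map = lext (\<lambda>(u, c) k. sc (of_int k * c) (uact u v0))"

lemma pair_map_add: "pair_map (f + g) = pair_map f + pair_map g"
  unfolding pair_map_def by (rule lext_add) (auto simp: scale_left_distrib distrib_right)

lemma pair_map_zero: "pair_map 0 = 0"
  by (simp add: pair_map_def lext_def)

lemma pair_map_minus: "pair_map (- f) = - pair_map f"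
  using pair_map_add[of f "- f"] by (simp add: pair_map_zero eq_neg_iff_add_eq_0 add.commute)

lemma pair_map_diff: "pair_map (f - g) = pair_map f - pair_map g"
  using pair_map_add[of f "- g"] by (simp add: pair_map_minus)

lemma pair_map_frag: "pair_map (frag_of (u, c)) = sc c (uact u v0)"
  unfolding pair_map_def by (subst lext_single) auto

lemma pair_map_gens: "h \<in> verma_gens l \<Longrightarrow> pair_map h = 0"
  by (auto simp: verma_gens_def pair_map_diff pair_map_frag uact_plus scale_right_distrib
      scale_left_distrib uact_times uact_char uact_sc mult.commute)

lemma pair_map_rels: "f \<in> verma_rels l \<Longrightarrow> pair_map f = 0"
  unfolding verma_rels_def
  by (induction rule: generate.induct) (simp_all add: pair_map_zero pair_map_gens pair_map_minus pair_map_add)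

lemma hw_ann_uact: "u \<in> hw_ann l \<Longrightarrow> uact u v0 = 0"
  using pair_map_rels[of "frag_of (u, 1)"] by (simp add: hw_ann_def pair_map_frag)

end

section \<open>Matrix units inside the enveloping algebra\<close>

definition munit :: "2 + 2 \<Rightarrow> 2 + 2 \<Rightarrow> gl22" where
  "munit p q = (\<chi> i j. if i = p \<and> j = q then 1 else 0)"

lemma munit_entry [simp]: "munit p q $ i $ j = (if i = p \<and> j = q then 1 else 0)"
  by (simp add: munit_def)

lemma rep_munit [simp]: "rep l (munit p q) w = Eop l p q w"
proof -
  have "scV (munit p q $ i $ j) (Eop l i j w) = (if j = q then if i = p then Eop l p q w else 0 else 0)" for i j
    by simp
  then show ?thesis by (simp add: rep_def)
qed

lemma munit_grade: "munit p q \<in> grade ((par p + par q) mod 2)"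
  by (auto simp: grade_def proj_def vec_eq_iff)

lemma munit_mult: "munit p q ** munit r s = (if q = r then munit p s else 0)"
  by (auto simp: matrix_matrix_mult_def vec_eq_iff if_distrib[of "\<lambda>x. x * _"] cong: if_cong)

lemma gl22_decomp: "x = (\<Sum>p\<in>UNIV. \<Sum>q\<in>UNIV. cscale (x $ p $ q) (munit p q))"
proof -
  have "cscale (x $ p $ q) (munit p q) $ i $ j = (if q = j then if p = i then x $ p $ q else 0 else 0)" for p q i j
    by (simp add: cscale_def)
  then show ?thesis by (simp add: vec_eq_iff)
qed

definition eu :: "2 + 2 \<Rightarrow> 2 + 2 \<Rightarrow> uea" where "eu p q = iota (munit p q)"

lemma iota_add: "iota (x + y) = iota x + iota y"
  using iota_lin[of 1 x 1 y] by (simp add: cscale_def)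

lemma iota_cscale: "iota (cscale c x) = uconst c * iota x"
proof -
  have "cscale c x + cscale 0 0 = cscale c x" by (simp add: cscale_def vec_eq_iff)
  then show ?thesis using iota_lin[of c x 0 0] by simp
qed

lemma uconst_minus_one: "uconst (- 1) = - 1"
  using uconst_plus[of 1 "- 1"] by (simp add: eq_neg_iff_add_eq_0 add.commute)

lemma iota_additive: "Modules.additive iota"
  by unfold_locales (rule iota_add)

lemmas iota_zero = Modules.additive.zero[OF iota_additive]
lemmas iota_diff = Modules.additive.diff[OF iota_additive]
lemmas iota_minus = Modules.additive.minus[OF iota_additive]
lemmas iota_sum = Modules.additive.sum[OF iota_additive]

lemma iota_decomp: "iota x = (\<Sum>p\<in>UNIV. \<Sum>q\<in>UNIV. uconst (x $ p $ q) * eu p q)"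
  by (subst gl22_decomp) (simp add: iota_sum iota_cscale eu_def)

text \<open>Kept in the shape of \<open>Eop_comm\<close>, with an arbitrary right factor, so that
  the enveloping algebra and the model can be compared term by term.\<close>

lemma eu_comm:
  "eu p q * (eu r s * u) =
    (if par p \<noteq> par q \<and> par r \<noteq> par s
     then - (eu r s * (eu p q * u)) + (if q = r then eu p s * u else 0) + (if p = s then eu r q * u else 0)
     else eu r s * (eu p q * u) + (if q = r then eu p s * u else 0) - (if p = s then eu r q * u else 0))"
proof -
  let ?p = "(par p + par q) mod 2" and ?q = "(par r + par s) mod 2"
  have 1: "?p < 2" "?q < 2" by simp_all
  have br: "sbracket (munit p q) (munit r s) = (if q = r then munit p s else 0)
      - (- 1) ^ (?p * ?q) *\<^sub>R (if s = p then munit r q else 0)"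
    unfolding sbracket_grade[OF 1 munit_grade munit_grade] munit_mult ..
  have odd: "?p = (if par p = par q then 0 else 1)" "?q = (if par r = par s then 0 else 1)"
    using par_cases[of p] par_cases[of q] par_cases[of r] par_cases[of s] by auto
  show ?thesis
    using U.act_comm[OF 1 munit_grade munit_grade, of u] unfolding br unfolding eu_def odd
    by (auto simp: uconst_minus_one iota_diff iota_add iota_minus iota_zero algebra_simps)
qed

section \<open>The Poincare-Birkhoff-Witt basis of the Verma module\<close>

lemma vac_ops:
  "vac (up1 n) = E21 l (vac n)" "vac (up2 n) = E43 l (vac n)" "vac (scN c n) = scV c (vac n)"
  "vac (m + n) = vac m + vac n"
  by (simp_all add: vrm_eq_iff all_bool_eq E_defs yd_defs vac_def)

lemma vrm_odd_induct [case_names vac add yA yB yC yD]: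
  assumes vac: "\<And>n. P (vac n)" and add: "\<And>v w. P v \<Longrightarrow> P w \<Longrightarrow> P (v + w)"
    and y: "\<And>w. P w \<Longrightarrow> P (yA w)" "\<And>w. P w \<Longrightarrow> P (yB w)" "\<And>w. P w \<Longrightarrow> P (yC w)" "\<And>w. P w \<Longrightarrow> P (yD w)"
  shows "P w"
proof -
  define pw where "pw = (\<lambda>(f :: vrm \<Rightarrow> vrm) a w. if a then f w else w)"
  let ?t = "\<lambda>a b c d. pw yA a (pw yB b (pw yC c (pw yD d (vac (w a b c d)))))"
  have "w = (\<Sum>a\<in>UNIV. \<Sum>b\<in>UNIV. \<Sum>c\<in>UNIV. \<Sum>d\<in>UNIV. ?t a b c d)"
    unfolding vrm_eq_iff all_bool_eq by (simp add: UNIV_bool yd_defs vac_def pw_def)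
  moreover have "P (?t a b c d)" for a b c d
    by (auto simp: pw_def vac y)
  then have "P (\<Sum>a\<in>UNIV. \<Sum>b\<in>UNIV. \<Sum>c\<in>UNIV. \<Sum>d\<in>UNIV. ?t a b c d)"
    unfolding UNIV_bool by (simp only: sum.insert finite.intros finite_insert sum.empty
        insert_iff empty_iff simp_thms if_True if_False add_0_right) (intro add)
  ultimately show ?thesis by simp
qed

text \<open>The lowering operators generate the model from the highest weight vector: powers of E43,
  then of E21, then the odd generators. Hence a map commuting with the action is determined by its
  value there.\<close>

lemma vrm_lower_induct [case_names hw scale add lower]:
  assumes hw: "P (vac fone)" and scale: "\<And>c w. P w \<Longrightarrow> P (scV c w)"
    and add: "\<And>v w. P v \<Longrightarrow> P w \<Longrightarrow> P (v + w)"
    and lower: "\<And>r s w. pos s < pos r \<Longrightarrow> P w \<Longrightarrow> P (Eop l r s w)"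
  shows "P w"
proof (induction w rule: vrm_odd_induct)
  case (vac n)
  have up: "P (vac n) \<Longrightarrow> P (vac (up1 n))" "P (vac n) \<Longrightarrow> P (vac (up2 n))" for n
    using lower[of i1 i2 "vac n"] lower[of i3 i4 "vac n"] by (simp_all add: vac_ops(1,2)[of _ l] pos_def)
  show ?case
  proof (induction n rule: poly_mapping_add_induct)
    case (single k a)
    have "P (vac (Poly_Mapping.single (0, 0) a))"
    proof -
      have "Poly_Mapping.single (0, 0) a = scN a fone"
        by (rule fvec_eqI) (simp add: lookup_single when_def)
      then show ?thesis using scale[OF hw] by (simp add: vac_ops)
    qed
    moreover have "P (vac (Poly_Mapping.single (0, Suc j) a))" if "P (vac (Poly_Mapping.single (0, j) a))" for j
    proof -
      have "Poly_Mapping.single (0, Suc j) a = up2 (Poly_Mapping.single (0, j) a)"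
        by (rule fvec_eqI) (auto simp: lookup_single when_def split: nat.split)
      then show ?thesis using up(2)[OF that] by simp
    qed
    ultimately have "P (vac (Poly_Mapping.single (0, j) a))" for j
      by (induction j) simp_all
    moreover have "P (vac (Poly_Mapping.single (Suc i, j) a))" if "P (vac (Poly_Mapping.single (i, j) a))" for i j
    proof -
      have "Poly_Mapping.single (Suc i, j) a = up1 (Poly_Mapping.single (i, j) a)"
        by (rule fvec_eqI) (auto simp: lookup_single when_def split: nat.split)
      then show ?thesis using up(1)[OF that] by simp
    qed
    ultimately have "P (vac (Poly_Mapping.single (i, j) a))" for i j
      by (induction i) simp_all
    then show ?case by (cases k) simp
  next
    case (add m n)
    then show ?case unfolding vac_ops(4) by (rule assms(3))
  qed
next
  case (yA w) then show ?case using lower[of i2 i3 w] by (simp add: pos_def)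
next
  case (yB w) then show ?case using lower[of i1 i3 w] by (simp add: pos_def)
next
  case (yC w) then show ?case using lower[of i2 i4 w] by (simp add: pos_def)
next
  case (yD w) then show ?case using lower[of i1 i4 w] by (simp add: pos_def)
qed (rule add)

lemma uconst_left_commute: "u * (uconst c * v) = uconst c * (u * v)"
  by (simp only: mult.assoc[symmetric] uconst_central[of c u])

section \<open>Ordered monomials as elements of the enveloping algebra\<close>

definition Theta :: "fvec \<Rightarrow> uea" where
  "Theta = lext (\<lambda>(i, j) c. uconst c * (eu i2 i1 ^ i * eu i4 i3 ^ j))"

lemma Theta_add: "Theta (m + n) = Theta m + Theta n"
  unfolding Theta_def by (rule lext_add) (auto simp: uconst_plus distrib_right)

lemma Theta_additive: "Modules.additive Theta"
  by unfold_locales (rule Theta_add)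

lemma Theta_single: "Theta (Poly_Mapping.single (i, j) c) = uconst c * (eu i2 i1 ^ i * eu i4 i3 ^ j)"
  unfolding Theta_def by (subst lext_single) auto

lemma Theta_scN: "Theta (scN c n) = uconst c * Theta n"
proof (induction n rule: poly_mapping_add_induct)
  case (single k a)
  obtain i j where k: "k = (i, j)" by (cases k)
  have s: "scN c (Poly_Mapping.single (i, j) a) = Poly_Mapping.single (i, j) (c * a)"
    by (rule fvec_eqI) (simp add: lookup_single when_def)
  show ?case unfolding k s Theta_single uconst_times mult.assoc ..
qed (simp add: Theta_add distrib_left)

lemma Theta_up1: "eu i2 i1 * Theta n = Theta (up1 n)"
proof (induction n rule: poly_mapping_add_induct)
  case (single k a)
  obtain i j where k: "k = (i, j)" by (cases k)
  have s: "up1 (Poly_Mapping.single (i, j) a) = Poly_Mapping.single (Suc i, j) a"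
    by (rule fvec_eqI) (auto simp: lookup_single when_def split: nat.split)
  show ?case unfolding k s Theta_single uconst_left_commute by (simp add: mult.assoc)
qed (simp add: Theta_add distrib_left)

lemma Theta_up2: "eu i4 i3 * Theta n = Theta (up2 n)"
proof (induction n rule: poly_mapping_add_induct)
  case (single k a)
  obtain i j where k: "k = (i, j)" by (cases k)
  have u: "up2 (Poly_Mapping.single (i, j) a) = Poly_Mapping.single (i, Suc j) a"
    by (rule fvec_eqI) (auto simp: lookup_single when_def split: nat.split)
  have "eu i4 i3 * (eu i2 i1 ^ i * u) = eu i2 i1 ^ i * (eu i4 i3 * u)" for u
    by (induction i) (simp_all add: mult.assoc eu_comm[of i4 i3 i2 i1])
  then show ?case unfolding k u Theta_single uconst_left_commute by (simp add: mult.assoc)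
qed (simp add: Theta_add distrib_left)

text \<open>A linear lift of the model to the enveloping algebra, sending a basis vector to the
  ordered monomial that it stands for. Modulo \<open>hw_ann\<close> it inverts the action on the
  highest weight vector.\<close>

definition pbw :: "vrm \<Rightarrow> uea" where
  "pbw w = (\<Sum>a\<in>UNIV. \<Sum>b\<in>UNIV. \<Sum>c\<in>UNIV. \<Sum>d\<in>UNIV.
    (if a then eu i3 i2 else 1) * ((if b then eu i3 i1 else 1) * ((if c then eu i4 i2 else 1) *
      ((if d then eu i4 i1 else 1) * Theta (w a b c d)))))"

lemma uea_double_zero:
  assumes "u + u = 0"
  shows "u = (0 :: uea)"
proof -
  have "u = uconst (1 / 2 + 1 / 2) * u" by simp
  also have "\<dots> = uconst (1 / 2) * (u + u)" unfolding uconst_plus distrib_left distrib_right ..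
  finally show ?thesis using assms by simp
qed

lemma eu_odd_square:
  assumes "par p \<noteq> par q" shows "eu p q * (eu p q * u) = 0"
proof -
  have "p \<noteq> q" using assms by auto
  then have "eu p q * (eu p q * u) = - (eu p q * (eu p q * u))"
    using eu_comm[of p q p q u] assms by auto
  then show ?thesis unfolding eq_neg_iff_add_eq_0 by (rule uea_double_zero)
qed

lemma eu_odd_anticomm:
  assumes "par p \<noteq> par q" "par r \<noteq> par s" "q \<noteq> r" "p \<noteq> s"
  shows "eu p q * (eu r s * u) = - (eu r s * (eu p q * u))"
  unfolding eu_comm[of p q r s u] using assms by simp

lemma eu_odd_comms:
  "eu i3 i1 * (eu i3 i2 * u) = - (eu i3 i2 * (eu i3 i1 * u))"
  "eu i4 i2 * (eu i3 i2 * u) = - (eu i3 i2 * (eu i4 i2 * u))"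
  "eu i4 i1 * (eu i3 i2 * u) = - (eu i3 i2 * (eu i4 i1 * u))"
  "eu i4 i2 * (eu i3 i1 * u) = - (eu i3 i1 * (eu i4 i2 * u))"
  "eu i4 i1 * (eu i3 i1 * u) = - (eu i3 i1 * (eu i4 i1 * u))"
  "eu i4 i1 * (eu i4 i2 * u) = - (eu i4 i2 * (eu i4 i1 * u))"
  "eu i3 i2 * (eu i3 i2 * u) = 0" "eu i3 i1 * (eu i3 i1 * u) = 0"
  "eu i4 i2 * (eu i4 i2 * u) = 0" "eu i4 i1 * (eu i4 i1 * u) = 0"
  by (rule eu_odd_anticomm eu_odd_square; simp)+

lemma pbw_odd:
  "eu i3 i2 * pbw w = pbw (yA w)" "eu i3 i1 * pbw w = pbw (yB w)"
  "eu i4 i2 * pbw w = pbw (yC w)" "eu i4 i1 * pbw w = pbw (yD w)"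
  by (simp_all add: pbw_def UNIV_bool yd_defs distrib_left eu_odd_comms
      Modules.additive.zero[OF Theta_additive] Modules.additive.minus[OF Theta_additive])

lemma pbw_add: "pbw (v + w) = pbw v + pbw w"
  by (simp add: pbw_def Theta_add distrib_left sum.distrib)

lemma pbw_additive: "Modules.additive pbw"
  by unfold_locales (rule pbw_add)

lemmas pbw_diff = Modules.additive.diff[OF pbw_additive]
lemmas pbw_minus = Modules.additive.minus[OF pbw_additive]
lemmas pbw_zero = Modules.additive.zero[OF pbw_additive]

lemma pbw_scV: "pbw (scV c w) = uconst c * pbw w"
  by (simp add: pbw_def Theta_scN uconst_left_commute sum_distrib_left)

lemma pbw_vac: "pbw (vac n) = Theta n"
  by (simp add: pbw_def UNIV_bool vac_def Modules.additive.zero[OF Theta_additive])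

text \<open>On the even part E21 is multiplication by a variable, and moving it past an odd
  generator leaves the same commutator on both sides.\<close>

lemma pbw_E21: "eu i2 i1 * pbw w = pbw (E21 l w)"
proof (induction w rule: vrm_odd_induct)
  case (vac n)
  show ?case by (simp add: pbw_vac Theta_up1 vac_ops[symmetric])
next
  case (add v w)
  then show ?case using Eop_linear(1)[of l i2 i1 v w] by (simp only: Eop_simps pbw_add distrib_left)
next
  case (yA w)
  have e: "E21 l (yA w) = yA (E21 l w) - yB w"
    using Eop_comm[of l i2 i1 i3 i2 w] by simp
  show ?case
    unfolding e pbw_add pbw_diff pbw_odd[symmetric] eu_comm[of i2 i1 i3 i2 "pbw w"] yA[symmetric] by simp
next
  case (yB w)
  have e: "E21 l (yB w) = yB (E21 l w)"
    using Eop_comm[of l i2 i1 i3 i1 w] by simp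
  show ?case
    unfolding e pbw_add pbw_diff pbw_odd[symmetric] eu_comm[of i2 i1 i3 i1 "pbw w"] yB[symmetric] by simp
next
  case (yC w)
  have e: "E21 l (yC w) = yC (E21 l w) - yD w"
    using Eop_comm[of l i2 i1 i4 i2 w] by simp
  show ?case
    unfolding e pbw_add pbw_diff pbw_odd[symmetric] eu_comm[of i2 i1 i4 i2 "pbw w"] yC[symmetric] by simp
next
  case (yD w)
  have e: "E21 l (yD w) = yD (E21 l w)"
    using Eop_comm[of l i2 i1 i4 i1 w] by simp
  show ?case
    unfolding e pbw_add pbw_diff pbw_odd[symmetric] eu_comm[of i2 i1 i4 i1 "pbw w"] yD[symmetric] by simp
qed

lemma pbw_E43: "eu i4 i3 * pbw w = pbw (E43 l w)"
proof (induction w rule: vrm_odd_induct)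
  case (vac n)
  show ?case by (simp add: pbw_vac Theta_up2 vac_ops[symmetric])
next
  case (add v w)
  then show ?case using Eop_linear(1)[of l i4 i3 v w] by (simp only: Eop_simps pbw_add distrib_left)
next
  case (yA w)
  have e: "E43 l (yA w) = yA (E43 l w) + yC w"
    using Eop_comm[of l i4 i3 i3 i2 w] by simp
  show ?case
    unfolding e pbw_add pbw_diff pbw_odd[symmetric] eu_comm[of i4 i3 i3 i2 "pbw w"] yA[symmetric] by simp
next
  case (yB w)
  have e: "E43 l (yB w) = yB (E43 l w) + yD w"
    using Eop_comm[of l i4 i3 i3 i1 w] by simp
  show ?case
    unfolding e pbw_add pbw_diff pbw_odd[symmetric] eu_comm[of i4 i3 i3 i1 "pbw w"] yB[symmetric] by simp
next
  case (yC w)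
  have e: "E43 l (yC w) = yC (E43 l w)"
    using Eop_comm[of l i4 i3 i4 i2 w] by simp
  show ?case
    unfolding e pbw_add pbw_diff pbw_odd[symmetric] eu_comm[of i4 i3 i4 i2 "pbw w"] yC[symmetric] by simp
next
  case (yD w)
  have e: "E43 l (yD w) = yD (E43 l w)"
    using Eop_comm[of l i4 i3 i4 i1 w] by simp
  show ?case
    unfolding e pbw_add pbw_diff pbw_odd[symmetric] eu_comm[of i4 i3 i4 i1 "pbw w"] yD[symmetric] by simp
qed

lemma pbw_lower:
  assumes "pos s < pos r" shows "eu r s * pbw w = pbw (Eop l r s w)"
proof -
  have "\<forall>r s. pos s < pos r \<longrightarrow> eu r s * pbw w = pbw (Eop l r s w)"
    by (simp add: all_22 pos_def pbw_odd pbw_E21[of w l] pbw_E43[of w l])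
  then show ?thesis using assms by blast
qed

text \<open>The set of \<open>w\<close> satisfying the claim contains the highest weight vector and is closed under
  the lowering operators, since for these \<open>pbw_lower\<close> holds without the error term.\<close>

lemma pbw_Eop: "eu p q * pbw w - pbw (Eop l p q w) \<in> hw_ann l"
proof (induction w arbitrary: p q rule: vrm_lower_induct[of _ l])
  case hw
  show ?case
  proof (cases "pos q < pos p")
    case True
    then show ?thesis using pbw_lower[OF True, of "vac fone" l] by simp
  next
    case False
    then have "munit p q \<in> borel_alg" by (auto simp: borel_alg_def)
    then have *: "eu p q - uconst (wt_eval l (munit p q)) \<in> hw_ann l"
      unfolding eu_def by (intro hw_ann_char borel_char.gen)
    have "wt_eval l (munit p q) = (if p = q then l $ p else 0)"
    proof -
      have "l $ i * munit p q $ i $ i = (if i = p then if p = q then l $ p else 0 else 0)" for i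
        by auto
      then show ?thesis by (simp add: wt_eval_def)
    qed
    moreover have "Eop l p q (vac fone) = (if p = q then scV (l $ p) (vac fone) else 0)"
      using Eop_vac[of l p q] False by simp
    moreover have "pbw (vac fone) = 1"
      by (simp add: pbw_vac fone_def Theta_single)
    ultimately show ?thesis using * by (auto simp: pbw_scV pbw_zero)
  qed
next
  case (scale c w)
  show ?case using hw_ann_left[OF scale[of p q], of "uconst c"]
    by (simp only: Eop_linear pbw_scV right_diff_distrib uconst_left_commute)
next
  case (add v w)
  show ?case using hw_ann_add[OF add(1)[of p q] add(2)[of p q]]
    by (simp only: Eop_linear pbw_add distrib_left add_diff_add)
next
  case (lower r s w)
  let ?e = "eu p q * pbw w - pbw (Eop l p q w)"
  have 1: "eu r s * ?e \<in> hw_ann l" by (rule hw_ann_left) (rule lower)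
  have 2: "(if q = r then eu p s * pbw w else 0) - pbw (if q = r then Eop l p s w else 0) \<in> hw_ann l"
    using lower by (simp add: pbw_zero)
  have 3: "(if p = s then eu r q * pbw w else 0) - pbw (if p = s then Eop l r q w else 0) \<in> hw_ann l"
    using lower by (simp add: pbw_zero)
  have 4: "eu r s * pbw v = pbw (Eop l r s v)" for v by (rule pbw_lower) (rule lower)
  \<comment> \<open>The commutation formula has one shape in the enveloping algebra and in the
    model. Subtracting the two writes the error for \<open>Eop l r s w\<close> as a combination of a
    left multiple of the error for \<open>w\<close> and of the errors for the units in the
    bracket.\<close>
  have diff1: "a = - x + X + Y \<Longrightarrow> b = - y + X' + Y' \<Longrightarrow> a - b = (X - X') - (x - y) + (Y - Y')"
    and diff2: "a = x + X - Y \<Longrightarrow> b = y + X' - Y' \<Longrightarrow> a - b = (X - X') + (x - y) - (Y - Y')"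
    for a b x y X Y X' Y' :: uea
    by simp_all
  let ?X = "if q = r then eu p s * pbw w else 0" and ?Y = "if p = s then eu r q * pbw w else 0"
  let ?X' = "pbw (if q = r then Eop l p s w else 0)" and ?Y' = "pbw (if p = s then Eop l r q w else 0)"
  show ?case
  proof (cases "par p \<noteq> par q \<and> par r \<noteq> par s")
    case True
    have "eu p q * pbw (Eop l r s w) = - (eu r s * (eu p q * pbw w)) + ?X + ?Y"
      unfolding 4[symmetric] eu_comm[of p q r s] if_P[OF True] ..
    moreover have "pbw (Eop l p q (Eop l r s w)) = - (eu r s * pbw (Eop l p q w)) + ?X' + ?Y'"
      unfolding Eop_comm[of l p q r s] if_P[OF True] pbw_add pbw_minus 4 ..
    ultimately have "eu p q * pbw (Eop l r s w) - pbw (Eop l p q (Eop l r s w)) =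
        (?X - ?X') - eu r s * ?e + (?Y - ?Y')"
      unfolding right_diff_distrib by (rule diff1)
    then show ?thesis using hw_ann_add[OF hw_ann_diff[OF 2 1] 3] by (simp only:)
  next
    case False
    have "eu p q * pbw (Eop l r s w) = eu r s * (eu p q * pbw w) + ?X - ?Y"
      unfolding 4[symmetric] eu_comm[of p q r s] if_not_P[OF False] ..
    moreover have "pbw (Eop l p q (Eop l r s w)) = eu r s * pbw (Eop l p q w) + ?X' - ?Y'"
      unfolding Eop_comm[of l p q r s] if_not_P[OF False] pbw_add pbw_diff 4 ..
    ultimately have "eu p q * pbw (Eop l r s w) - pbw (Eop l p q (Eop l r s w)) =
        (?X - ?X') + eu r s * ?e - (?Y - ?Y')"
      unfolding right_diff_distrib by (rule diff2)
    then show ?thesis using hw_ann_diff[OF hw_ann_add[OF 2 1] 3] by (simp only:)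
  qed
qed

lemma pbw_rep: "iota x * pbw w - pbw (rep l x w) \<in> hw_ann l"
proof -
  have sum: "(\<And>p. f p \<in> hw_ann l) \<Longrightarrow> sum f A \<in> hw_ann l" for f :: "2 + 2 \<Rightarrow> uea" and A
    by (induction A rule: infinite_finite_induct) (simp_all add: hw_ann_add)
  have "iota x * pbw w - pbw (rep l x w) =
    (\<Sum>p\<in>UNIV. \<Sum>q\<in>UNIV. uconst (x $ p $ q) * (eu p q * pbw w - pbw (Eop l p q w)))"
    by (subst iota_decomp)
       (simp only: rep_def Modules.additive.sum[OF pbw_additive] pbw_scV sum_distrib_right mult.assoc
          right_diff_distrib sum_subtractf)
  also have "\<dots> \<in> hw_ann l"
    by (intro sum hw_ann_left pbw_Eop)
  finally show ?thesis .
qed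

interpretation V: hw_module scV "rep l" l "vac fone" for l
  by unfold_locales (rule rep_vac)

abbreviation vact :: "weight \<Rightarrow> uea \<Rightarrow> vrm \<Rightarrow> vrm" where
  "vact l \<equiv> gl_module.uact scV (rep l)"

text \<open>The spanning half of the Poincare-Birkhoff-Witt theorem modulo \<open>hw_ann\<close>:
  one more generator multiplies the old error from the left and adds the one from
  \<open>pbw_rep\<close>.\<close>

lemma uact_normal_form: "u - pbw (vact l u (vac fone)) \<in> hw_ann l"
proof (induction u rule: uea_induct)
  case one
  have "vact l 1 (vac fone) = vac fone"
    using V.uact_uconst[of l 1] by simp
  moreover have "pbw (vac fone) = 1"
    by (simp add: pbw_vac fone_def Theta_single)
  ultimately show ?case by (simp only: diff_self hw_ann_zero)
next
  case (iota x u)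
  show ?case
    using hw_ann_add[OF hw_ann_left[OF iota, of "iota x"] pbw_rep[of x "vact l u (vac fone)" l]]
    by (simp only: V.uact_times V.uact_iota right_diff_distrib diff_add_cancel add_diff_eq)
next
  case (const c u)
  show ?case using hw_ann_left[OF const, of "uconst c"]
    by (simp only: V.uact_times V.uact_uconst pbw_scV right_diff_distrib)
next
  case (add u v)
  show ?case using hw_ann_add[OF add]
    by (simp only: V.uact_plus pbw_add add_diff_add)
qed

text \<open>One direction is the universal property, the other the normal form. Together with
  \<open>vact_surj\<close> this identifies the Verma module with the model.\<close>

lemma hw_ann_iff: "u \<in> hw_ann l \<longleftrightarrow> vact l u (vac fone) = 0"
  using uact_normal_form[of u l] V.hw_ann_uact[of u l] by (metis pbw_zero diff_zero)

lemma vact_surj: "\<exists>u. w = vact l u (vac fone)"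
proof (induction w rule: vrm_lower_induct[of _ l])
  case hw
  show ?case by (intro exI[of _ "uconst 1"]) (simp only: V.uact_uconst V.scale_one)
next
  case (scale c w)
  then obtain u where u: "w = vact l u (vac fone)" by blast
  show ?case unfolding u by (intro exI[of _ "uconst c * u"]) (simp only: V.uact_times V.uact_uconst)
next
  case (add v w)
  then obtain u u' where u: "v = vact l u (vac fone)" "w = vact l u' (vac fone)" by blast
  show ?case unfolding u by (intro exI[of _ "u + u'"]) (simp only: V.uact_plus)
next
  case (lower r s w)
  then obtain u where u: "w = vact l u (vac fone)" by blast
  show ?case unfolding u
    by (intro exI[of _ "iota (munit r s) * u"]) (simp only: V.uact_times V.uact_iota rep_munit)
qed

section \<open>Reduction to exactness in the model\<close>

definition exact_at :: "weight \<Rightarrow> gl22 \<Rightarrow> bool" where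
  "exact_at l x \<longleftrightarrow> (\<forall>w. rep l x w = 0 \<longrightarrow> (\<exists>v. w = rep l x v))"

lemma verma_coset_eq:
  "verma_rels l #>\<^bsub>pair_group\<^esub> f = verma_rels l #>\<^bsub>pair_group\<^esub> g \<longleftrightarrow> f - g \<in> verma_rels l"
proof -
  have c: "verma_rels l #>\<^bsub>pair_group\<^esub> f = {h. h - f \<in> verma_rels l}" for f
  proof -
    have "h \<in> verma_rels l #>\<^bsub>pair_group\<^esub> f \<longleftrightarrow> (\<exists>n\<in>verma_rels l. h = n + f)" for h
      by (auto simp: r_coset_def)
    moreover have "(\<exists>n\<in>verma_rels l. h = n + f) \<longleftrightarrow> h - f \<in> verma_rels l" for h
      by (auto intro: bexI[of _ "h - f"])
    ultimately show ?thesis by blast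
  qed
  show ?thesis
  proof
    assume "verma_rels l #>\<^bsub>pair_group\<^esub> f = verma_rels l #>\<^bsub>pair_group\<^esub> g"
    moreover have "f \<in> verma_rels l #>\<^bsub>pair_group\<^esub> f"
      using verma_rels_closed(1) by (simp add: c)
    ultimately show "f - g \<in> verma_rels l" by (simp add: c)
  next
    assume fg: "f - g \<in> verma_rels l"
    have "h - f \<in> verma_rels l \<longleftrightarrow> h - g \<in> verma_rels l" for h
      using verma_rels_closed(2)[OF _ fg, of "h - f"] verma_rels_closed(4)[OF _ fg, of "h - g"] by auto
    then show "verma_rels l #>\<^bsub>pair_group\<^esub> f = verma_rels l #>\<^bsub>pair_group\<^esub> g"
      by (simp add: c)
  qed
qed

definition verma_elt :: "weight \<Rightarrow> uea \<Rightarrow> (uea \<times> complex \<Rightarrow>\<^sub>0 int) set" where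
  "verma_elt l u = verma_rels l #>\<^bsub>pair_group\<^esub> frag_of (u, 1)"

lemma verma_elt_eq: "verma_elt l u = verma_elt l v \<longleftrightarrow> vact l u (vac fone) = vact l v (vac fone)"
  unfolding verma_elt_def verma_coset_eq frag_diff_ann hw_ann_iff V.uact_diff by (rule right_minus_eq)

lemma carrier_verma: "carrier (verma l) = range (verma_elt l)"
proof -
  have "verma_rels l #>\<^bsub>pair_group\<^esub> f \<in> range (verma_elt l)" for f
    using verma_normal_form[of f l] unfolding verma_elt_def verma_coset_eq[symmetric] by blast
  then show ?thesis
    by (auto simp: verma_def FactGroup_def RCOSETS_def verma_elt_def)
qed

lemma one_verma: "\<one>\<^bsub>verma l\<^esub> = verma_elt l 0"
proof -
  have "verma_rels l = verma_rels l #>\<^bsub>pair_group\<^esub> 0"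
    by (auto simp: r_coset_def)
  also have "\<dots> = verma_elt l 0"
    unfolding verma_elt_def verma_coset_eq using verma_rels_closed(3) hw_ann_zero[of l]
    by (auto simp: hw_ann_def)
  finally show ?thesis by (simp add: verma_def FactGroup_def)
qed

lemma verma_act_elt: "verma_act l x (verma_elt l u) = verma_elt l (iota x * u)"
  unfolding verma_elt_def verma_act_coset pair_act_simps ..

lemma rep_square:
  assumes "x \<in> X_cone"
  shows "rep l x (rep l x w) = 0"
proof -
  have x: "x \<in> grade 1" "sbracket x x = 0" using assms by (auto simp: X_cone_def)
  have "rep l x (rep l x w) - scV ((- 1) ^ (1 * 1)) (rep l x (rep l x w)) = rep l 0 w"
    using V.act_comm[of 1 1 x x l w] x by simp
  moreover have "rep l 0 w = 0" by (simp add: rep_def)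
  ultimately have "scV 2 (rep l x (rep l x w)) = 0"
    using V.scale_left_diff_distrib[of 1 "- 1" "rep l x (rep l x w)"]
    by (simp only: V.scale_one power_one_right mult_1 diff_minus_eq_add one_add_one)
  then show ?thesis using V.scale_eq_0_iff[of 2] by (metis zero_neq_numeral)
qed

text \<open>Since \<open>x\<close> acts with square zero, its image lies in its kernel, so the two
  differ exactly when some cycle is not a boundary. The statement is carried over by identifying
  \<open>verma_elt l u\<close> with \<open>vact l u (vac fone)\<close>.\<close>

lemma X_mod_verma:
  "x \<in> X_mod (verma l) (verma_act l) \<longleftrightarrow> x \<in> X_cone \<and> \<not> exact_at l x"
proof (cases "x \<in> X_cone")
  case True
  note sq = rep_square[OF True]
  have im: "verma_act l x ` carrier (verma l) = range (\<lambda>u. verma_elt l (iota x * u))"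
    unfolding carrier_verma by (simp only: image_image verma_act_elt)
  have ke: "kernel (verma l) (verma l) (verma_act l x) =
      verma_elt l ` {u. rep l x (vact l u (vac fone)) = 0}"
  proof -
    have z: "vact l 0 (vac fone) = 0" using V.uact_diff[of l 0 0] by (simp only: diff_self)
    have "verma_act l x (verma_elt l u) = verma_elt l 0 \<longleftrightarrow> rep l x (vact l u (vac fone)) = 0" for u
      unfolding verma_act_elt verma_elt_eq V.uact_times V.uact_iota z ..
    then show ?thesis unfolding kernel_def carrier_verma one_verma by blast
  qed
  have "verma_act l x ` carrier (verma l) = kernel (verma l) (verma l) (verma_act l x) \<longleftrightarrow> exact_at l x"
  proof
    assume eq: "verma_act l x ` carrier (verma l) = kernel (verma l) (verma l) (verma_act l x)"
    show "exact_at l x"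
      unfolding exact_at_def
    proof (intro allI impI)
      fix w assume w: "rep l x w = 0"
      obtain u where u: "w = vact l u (vac fone)" using vact_surj[of w l] by (elim exE)
      have "verma_elt l u \<in> range (\<lambda>u. verma_elt l (iota x * u))"
        using eq w unfolding im ke u by blast
      then obtain u' where "verma_elt l u = verma_elt l (iota x * u')" by blast
      then have "w = rep l x (vact l u' (vac fone))"
        unfolding verma_elt_eq V.uact_times V.uact_iota u .
      then show "\<exists>v. w = rep l x v" by blast
    qed
  next
    assume ex: "exact_at l x"
    show "verma_act l x ` carrier (verma l) = kernel (verma l) (verma l) (verma_act l x)"
      unfolding im ke
    proof (intro equalityI subsetI)
      fix C assume "C \<in> range (\<lambda>u. verma_elt l (iota x * u))"
      then show "C \<in> verma_elt l ` {u. rep l x (vact l u (vac fone)) = 0}"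
        by (auto simp only: V.uact_times V.uact_iota sq mem_Collect_eq intro!: imageI)
    next
      fix C assume "C \<in> verma_elt l ` {u. rep l x (vact l u (vac fone)) = 0}"
      then obtain u where C: "C = verma_elt l u" and u: "rep l x (vact l u (vac fone)) = 0" by blast
      obtain v where v: "vact l u (vac fone) = rep l x v" using ex u unfolding exact_at_def by blast
      obtain u' where u': "v = vact l u' (vac fone)" using vact_surj[of v l] by (elim exE)
      have "C = verma_elt l (iota x * u')"
        unfolding C verma_elt_eq V.uact_times V.uact_iota v u' ..
      then show "C \<in> range (\<lambda>u. verma_elt l (iota x * u))" by blast
    qed
  qed
  then show ?thesis using True by (simp add: X_mod_def)
qed (simp add: X_mod_def)

text \<open>The universal property for the twisted module, which by assumption has the same highest
  weight vector and weight. \<open>pbw\<close> chooses a preimage of \<open>w\<close>; preimages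
  differ by \<open>hw_ann l\<close>, which kills the vector in the twisted module as well.\<close>

lemma twist_intertwiner:
  assumes "hw_module scV (\<lambda>x. rep l (\<theta> x)) l (vac fone)"
  shows "\<exists>P. P (vac fone) = vac fone \<and> (\<forall>x w. P (rep l x w) = rep l (\<theta> x) (P w)) \<and>
    (\<forall>v w. P (v + w) = P v + P w) \<and> (\<forall>c w. P (scV c w) = scV c (P w))"
proof -
  interpret T: hw_module scV "\<lambda>x. rep l (\<theta> x)" l "vac fone" by (rule assms)
  let ?P = "\<lambda>w. T.uact (pbw w) (vac fone)"
  have P: "?P (vact l u (vac fone)) = T.uact u (vac fone)" for u
    using T.hw_ann_uact[OF uact_normal_form[of u l]] unfolding T.uact_diff by (simp only: right_minus_eq)
  have 1: "?P (vac fone) = vac fone"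
    using P[of "uconst 1"] by (simp only: V.uact_uconst T.uact_uconst V.scale_one)
  have 2: "?P (rep l x w) = rep l (\<theta> x) (?P w)" for x w
  proof -
    obtain u where u: "w = vact l u (vac fone)" using vact_surj[of w l] by (elim exE)
    have "?P (rep l x w) = ?P (vact l (iota x * u) (vac fone))"
      unfolding u V.uact_times V.uact_iota ..
    also have "\<dots> = T.uact (iota x * u) (vac fone)" by (rule P)
    also have "\<dots> = rep l (\<theta> x) (T.uact u (vac fone))"
      unfolding T.uact_times T.uact_iota ..
    also have "T.uact u (vac fone) = ?P w" unfolding u P ..
    finally show ?thesis .
  qed
  have 3: "?P (v + w) = ?P v + ?P w" for v w
    by (simp only: pbw_add T.uact_plus)
  have 4: "?P (scV c w) = scV c (?P w)" for c w
    by (simp only: pbw_scV T.uact_times T.uact_uconst)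
  show ?thesis by (intro exI[of _ ?P] conjI allI 1 2 3 4)
qed

lemma exact_at_twist:
  assumes 1: "hw_module scV (\<lambda>x. rep l (\<theta> x)) l (vac fone)"
    and 2: "hw_module scV (\<lambda>x. rep l (\<theta>' x)) l (vac fone)"
    and inv: "\<And>x. \<theta> (\<theta>' x) = x" "\<And>x. \<theta>' (\<theta> x) = x"
    and ex: "exact_at l x"
  shows "exact_at l (\<theta> x)"
proof -
  obtain P where P_all: "P (vac fone) = vac fone" "\<forall>x w. P (rep l x w) = rep l (\<theta> x) (P w)"
    "\<forall>v w. P (v + w) = P v + P w" "\<forall>c w. P (scV c w) = scV c (P w)"
    using twist_intertwiner[OF 1] by (elim exE conjE) (rule that)
  note P = P_all[rule_format]
  obtain P' where Q_all: "P' (vac fone) = vac fone" "\<forall>x w. P' (rep l x w) = rep l (\<theta>' x) (P' w)"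
    "\<forall>v w. P' (v + w) = P' v + P' w" "\<forall>c w. P' (scV c w) = scV c (P' w)"
    using twist_intertwiner[OF 2] by (elim exE conjE) (rule that)
  note P' = Q_all[rule_format]
  \<comment> \<open>The composite fixes the highest weight vector and commutes with the lowering
    operators, because the two twists cancel.\<close>
  have PP': "P (P' w) = w" for w
  proof (induction w rule: vrm_lower_induct[of _ l])
    case (lower r s w)
    have "P (P' (rep l (munit r s) w)) = rep l (munit r s) w"
      by (simp only: P' P inv lower)
    then show ?case by (simp only: rep_munit)
  qed (simp_all only: P P')
  show ?thesis unfolding exact_at_def
  proof (intro allI impI)
    fix w assume "rep l (\<theta> x) w = 0"
    then have "rep l x (P' w) = P' 0"
      using P'(2)[of "\<theta> x" w] by (simp only: inv)
    also have "P' 0 = 0"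
      using P'(4)[of 0 0] by (simp only: V.scale_zero_left)
    finally obtain v where v: "P' w = rep l x v" using ex unfolding exact_at_def by blast
    have "w = rep l (\<theta> x) (P v)" using PP'[of w] unfolding v P ..
    then show "\<exists>v. w = rep l (\<theta> x) v" by blast
  qed
qed

section \<open>The adjoint action of the Borel group\<close>

lemma grade_iff: "x \<in> grade p \<longleftrightarrow> (\<forall>i j. (par i + par j) mod 2 \<noteq> p \<longrightarrow> x $ i $ j = 0)"
  unfolding grade_def proj_def vec_eq_iff by auto

lemma borel_iff: "x \<in> borel_alg \<longleftrightarrow> x $ i2 $ i1 = 0 \<and> x $ i3 $ i1 = 0 \<and> x $ i3 $ i2 = 0 \<and>
    x $ i4 $ i1 = 0 \<and> x $ i4 $ i2 = 0 \<and> x $ i4 $ i3 = 0"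
  by (auto simp: borel_alg_def all_22 pos_def)

lemma grade_mult:
  assumes "g \<in> grade 0" "x \<in> grade p"
  shows "g ** x \<in> grade p" "x ** g \<in> grade p"
proof -
  have e: "g $ i $ k = 0" if "par i \<noteq> par k" for i k
    using assms(1) that par_cases[of i] par_cases[of k] unfolding grade_iff
    by (metis add.left_neutral add.right_neutral mod_less one_less_numeral_iff one_neq_zero
        semiring_norm(76))
  have "g $ i $ k * x $ k $ j = 0" "x $ j $ k * g $ k $ i = 0"
    if "(par i + par j) mod 2 \<noteq> p" for i j k
    using that e[of i k] e[of k i] assms(2) unfolding grade_iff
    by (cases "par i = par k"; force simp: add.commute)+
  then show "g ** x \<in> grade p" "x ** g \<in> grade p"
    unfolding grade_iff matrix_matrix_mult_def by (auto simp: add.commute intro!: sum.neutral)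
qed

lemma borel_mult:
  assumes "x \<in> borel_alg" "y \<in> borel_alg"
  shows "x ** y \<in> borel_alg" "(x ** y) $ i $ i = x $ i $ i * y $ i $ i"
proof -
  show "x ** y \<in> borel_alg"
    using assms by (simp add: borel_iff matrix_matrix_mult_def sum_22)
  have "\<forall>i. (x ** y) $ i $ i = x $ i $ i * y $ i $ i"
    using assms unfolding all_22 by (simp add: borel_iff matrix_matrix_mult_def sum_22)
  then show "(x ** y) $ i $ i = x $ i $ i * y $ i $ i" by blast
qed

text \<open>Closure under inverses is back substitution in g h = 1: the rows of \<open>g\<close>
  with index 2 and 4 consist of a diagonal entry only, which yields these rows of the inverse; the
  rows 1 and 3 follow.\<close>

lemma borel_group_inv:
  assumes "g \<in> borel_group"
  shows "matrix_inv g \<in> borel_group" "matrix_inv g ** g = mat 1" "g ** matrix_inv g = mat 1"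
proof -
  have inv: "invertible g" and g: "g \<in> borel_alg" "g \<in> grade 0" using assms by (auto simp: borel_group_def)
  have "g ** matrix_inv g = mat 1 \<and> matrix_inv g ** g = mat 1"
    unfolding matrix_inv_def by (rule someI_ex) (use inv in \<open>simp add: invertible_def\<close>)
  then show 1: "matrix_inv g ** g = mat 1" and 2: "g ** matrix_inv g = mat 1" by auto
  define h where "h = matrix_inv g"
  have z: "g $ i1 $ i3 = 0" "g $ i1 $ i4 = 0" "g $ i2 $ i3 = 0" "g $ i2 $ i4 = 0"
    using g(2) by (simp_all add: grade_iff)
  have e: "(g ** h) $ i $ j = (if i = j then 1 else 0)" for i j
    unfolding h_def 2 by (simp add: mat_def)
  have r2: "g $ i2 $ i2 * h $ i2 $ j = (if i2 = j then 1 else 0)" for j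
    using e[of i2 j] g(1) z by (simp add: borel_iff matrix_matrix_mult_def sum_22)
  have r4: "g $ i4 $ i4 * h $ i4 $ j = (if i4 = j then 1 else 0)" for j
    using e[of i4 j] g(1) z by (simp add: borel_iff matrix_matrix_mult_def sum_22)
  have n2: "g $ i2 $ i2 \<noteq> 0" and n4: "g $ i4 $ i4 \<noteq> 0" using r2[of i2] r4[of i4] by auto
  have h2: "h $ i2 $ j = 0" if "j \<noteq> i2" for j using r2[of j] n2 that by auto
  have h4: "h $ i4 $ j = 0" if "j \<noteq> i4" for j using r4[of j] n4 that by auto
  have r1: "g $ i1 $ i1 * h $ i1 $ j + g $ i1 $ i2 * h $ i2 $ j = (if i1 = j then 1 else 0)" for j
    using e[of i1 j] g(1) z by (simp add: borel_iff matrix_matrix_mult_def sum_22)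
  have r3: "g $ i3 $ i3 * h $ i3 $ j + g $ i3 $ i4 * h $ i4 $ j = (if i3 = j then 1 else 0)" for j
    using e[of i3 j] g(1) z by (simp add: borel_iff matrix_matrix_mult_def sum_22)
  have n1: "g $ i1 $ i1 \<noteq> 0" and n3: "g $ i3 $ i3 \<noteq> 0"
    using r1[of i1] h2[of i1] r3[of i3] h4[of i3] by auto
  have h1: "h $ i1 $ j = 0" if "j \<noteq> i1" "j \<noteq> i2" for j using r1[of j] h2[of j] n1 that by auto
  have h3: "h $ i3 $ j = 0" if "j \<noteq> i3" "j \<noteq> i4" for j using r3[of j] h4[of j] n3 that by auto
  have "h \<in> borel_alg" by (simp add: borel_iff h2 h3 h4)
  moreover have "h \<in> grade 0" by (simp add: grade_iff all_22 h1 h2 h3 h4)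
  moreover have "invertible h" unfolding invertible_def h_def using 1 2 by blast
  ultimately show "matrix_inv g \<in> borel_group" by (simp add: borel_group_def h_def)
qed

definition Ad :: "gl22 \<Rightarrow> gl22 \<Rightarrow> gl22" where "Ad g x = g ** x ** matrix_inv g"

lemma matrix_mult_cscale: "x ** cscale c y = cscale c (x ** y)" "cscale c x ** y = cscale c (x ** y)"
  by (simp_all add: matrix_matrix_mult_def cscale_def vec_eq_iff sum_distrib_left mult_ac)

lemma matrix_mult_scaleR:
  fixes x y :: gl22
  shows "x ** (r *\<^sub>R y) = r *\<^sub>R (x ** y)" "(r *\<^sub>R x) ** y = r *\<^sub>R (x ** y)"
  by (simp_all add: matrix_matrix_mult_def vec_eq_iff scaleR_sum_right)

lemma matrix_add_diff:
  fixes x y z :: gl22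
  shows "x ** (y + z) = x ** y + x ** z" "(x + y) ** z = x ** z + y ** z"
    "x ** (y - z) = x ** y - x ** z" "(x - y) ** z = x ** z - y ** z"
  by (simp_all add: matrix_matrix_mult_def vec_eq_iff left_diff_distrib right_diff_distrib
      distrib_left distrib_right sum_subtractf sum.distrib)

lemma Ad_mult:
  assumes "g \<in> borel_group"
  shows "Ad g x ** Ad g y = Ad g (x ** y)"
proof -
  have "Ad g x ** Ad g y = g ** x ** (matrix_inv g ** g) ** y ** matrix_inv g"
    unfolding Ad_def by (simp only: matrix_mul_assoc)
  also have "\<dots> = Ad g (x ** y)"
    unfolding borel_group_inv(2)[OF assms] matrix_mul_rid Ad_def by (simp only: matrix_mul_assoc)
  finally show ?thesis .
qed

lemma Ad_grade:
  assumes "g \<in> borel_group" "x \<in> grade p" shows "Ad g x \<in> grade p"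
proof -
  have "g \<in> grade 0" "matrix_inv g \<in> grade 0"
    using borel_group_inv(1)[OF assms(1)] assms(1) by (auto simp: borel_group_def)
  then show ?thesis unfolding Ad_def by (intro grade_mult(2) grade_mult(1) assms(2))
qed

lemma Ad_sbracket:
  assumes g: "g \<in> borel_group" and "p < 2" "q < 2" "x \<in> grade p" "y \<in> grade q"
  shows "sbracket (Ad g x) (Ad g y) = Ad g (sbracket x y)"
  unfolding sbracket_grade[OF assms(2-5)] sbracket_grade[OF assms(2,3) Ad_grade[OF g assms(4)] Ad_grade[OF g assms(5)]]
    Ad_mult[OF g]
  by (simp only: Ad_def matrix_add_diff matrix_mult_scaleR)

lemma Ad_hw_module:
  assumes g: "g \<in> borel_group"
  shows "hw_module scV (\<lambda>x. rep l (Ad g x)) l (vac fone)"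
proof
  show "rep l (Ad g x) (v + w) = rep l (Ad g x) v + rep l (Ad g x) w" for x v w by (rule V.act_add)
  show "rep l (Ad g x) (scV c v) = scV c (rep l (Ad g x) v)" for x c v by (rule V.act_sc)
  have "Ad g (cscale a x + cscale b y) = cscale a (Ad g x) + cscale b (Ad g y)" for a x b y
    unfolding Ad_def matrix_add_diff matrix_mult_cscale ..
  then show "rep l (Ad g (cscale a x + cscale b y)) v = scV a (rep l (Ad g x) v) + scV b (rep l (Ad g y) v)"
    for a x b y v by (simp only: rep_lin)
  show "rep l (Ad g x) (rep l (Ad g y) v) - scV ((- 1) ^ (p * q)) (rep l (Ad g y) (rep l (Ad g x) v)) =
      rep l (Ad g (sbracket x y)) v" if "p < 2" "q < 2" "x \<in> grade p" "y \<in> grade q" for p q x y v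
    unfolding Ad_sbracket[OF g that, symmetric]
    by (rule V.act_comm) (use that Ad_grade[OF g] in auto)
  show "rep l (Ad g b) (vac fone) = scV (wt_eval l b) (vac fone)" if b: "b \<in> borel_alg" for b
  proof -
    have gb: "g \<in> borel_alg" "matrix_inv g \<in> borel_alg"
      using borel_group_inv(1)[OF g] g by (auto simp: borel_group_def)
    have "Ad g b \<in> borel_alg" unfolding Ad_def by (intro borel_mult(1) gb b)
    \<comment> \<open>Diagonal entries are multiplicative on triangular matrices, so those of
      \<open>g\<close> and of its inverse cancel.\<close>
    moreover have "Ad g b $ i $ i = b $ i $ i" for i
    proof -
      have "g $ i $ i * matrix_inv g $ i $ i = 1"
        unfolding borel_mult(2)[OF gb, symmetric] borel_group_inv(3)[OF g] by (simp add: mat_def)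
      then show ?thesis
        unfolding Ad_def borel_mult(2)[OF borel_mult(1)[OF gb(1) b] gb(2)] borel_mult(2)[OF gb(1) b]
        by (simp add: mult_ac)
    qed
    then have "wt_eval l (Ad g b) = wt_eval l b" by (simp add: wt_eval_def)
    ultimately show ?thesis using rep_vac[of "Ad g b" l] by simp
  qed
qed

lemma Ad_Ad:
  assumes "h ** k = mat 1" "matrix_inv k ** matrix_inv h = mat 1"
  shows "Ad h (Ad k x) = x"
proof -
  have "Ad h (Ad k x) = (h ** k) ** x ** (matrix_inv k ** matrix_inv h)"
    unfolding Ad_def by (simp only: matrix_mul_assoc)
  also have "\<dots> = x" unfolding assms matrix_mul_lid matrix_mul_rid ..
  finally show ?thesis .
qed

lemma Ad_inv:
  assumes "g \<in> borel_group"
  shows "Ad g (Ad (matrix_inv g) x) = x" "Ad (matrix_inv g) (Ad g x) = x"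
  using borel_group_inv[OF assms] borel_group_inv[OF borel_group_inv(1)[OF assms]] by (auto intro: Ad_Ad)

lemma Ad_exact_at:
  assumes g: "g \<in> borel_group" and ex: "exact_at l x"
  shows "exact_at l (Ad g x)"
  by (rule exact_at_twist[OF Ad_hw_module[OF g] Ad_hw_module[OF borel_group_inv(1)[OF g]]
        Ad_inv[OF g] ex])

lemma X_mod_Ad:
  assumes g: "g \<in> borel_group" and x: "x \<in> X_mod (verma l) (verma_act l)"
  shows "Ad g x \<in> X_mod (verma l) (verma_act l)"
proof -
  have xc: "x \<in> grade 1" "sbracket x x = 0" and ne: "\<not> exact_at l x"
    using x by (auto simp: X_mod_verma X_cone_def)
  have "Ad g x \<in> X_cone"
    using Ad_grade[OF g xc(1)] Ad_sbracket[OF g, of 1 1 x x] xc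
    by (simp add: X_cone_def) (simp add: Ad_def matrix_matrix_mult_def vec_eq_iff)
  moreover have "\<not> exact_at l (Ad g x)"
    using Ad_exact_at[OF borel_group_inv(1)[OF g], of l "Ad g x"] ne unfolding Ad_inv(2)[OF g] by blast
  ultimately show ?thesis by (simp add: X_mod_verma)
qed

section \<open>Exactness\<close>

text \<open>The operator \<open>x\<close> is exact if it is so modulo the image of \<open>y\<close>.  Modulo that image the space is
  \<open>R + f R\<close>, the cohomology of \<open>R\<close> is spanned by the class of \<open>u\<close>, and \<open>h = [x, f]\<close>, which acts on
  this class by a nonzero scalar, maps the cohomology of \<open>f R\<close> isomorphically onto that of \<open>R\<close>.\<close>

lemma (in vector_space) koszul_exact:
  fixes x y f h :: "'b \<Rightarrow> 'b" and R :: "'b set"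
  assumes lin: "\<And>v w. x (v + w) = x v + x w" "\<And>c w. x (scale c w) = scale c (x w)"
      "\<And>v w. y (v + w) = y v + y w" "\<And>c w. y (scale c w) = scale c (y w)"
      "\<And>v w. f (v + w) = f v + f w" "\<And>c w. f (scale c w) = scale c (f w)"
    and yex: "\<And>w. y w = 0 \<Longrightarrow> \<exists>v. w = y v" and yy: "\<And>w. y (y w) = 0"
    and xx: "\<And>w. x (x w) = 0" and xy: "\<And>w. x (y w) = - y (x w)" and fy: "\<And>w. f (y w) = - y (f w)"
    and xf: "\<And>w. x (f w) = h w - f (x w)"
    and R: "\<And>v w. v \<in> R \<Longrightarrow> w \<in> R \<Longrightarrow> v + w \<in> R" "\<And>c w. w \<in> R \<Longrightarrow> scale c w \<in> R"
      "\<And>w. w \<in> R \<Longrightarrow> h w \<in> R"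
    and decomp: "\<And>w. \<exists>r\<in>R. \<exists>s\<in>R. \<exists>t. w = r + f s + y t"
    and uniq: "\<And>r s t. r \<in> R \<Longrightarrow> s \<in> R \<Longrightarrow> r + f s = y t \<Longrightarrow> s = 0"
    and D: "\<And>r. r \<in> R \<Longrightarrow> \<exists>r'\<in>R. \<exists>t. x r = r' + y t"
    and u: "h u = scale \<kappa> u" "\<kappa> \<noteq> 0" "\<exists>t. x u = y t"
    and hom: "\<And>r t. r \<in> R \<Longrightarrow> x r = y t \<Longrightarrow> \<exists>c. \<exists>r'\<in>R. \<exists>t'. r = scale c u + x r' + y t'"
    and q: "x q = 0"
  shows "\<exists>p. q = x p"
proof -
  have minus: "x (- w) = - x w" "y (- w) = - y w" "f (- w) = - f w" for w
    using lin(2)[of "- 1" w] lin(4)[of "- 1" w] lin(6)[of "- 1" w] by simp_all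
  have diff: "x (v - w) = x v - x w" "y (v - w) = y v - y w" "f (v - w) = f v - f w" for v w
    using lin(1)[of v "- w"] lin(3)[of v "- w"] lin(5)[of v "- w"] by (simp_all add: minus)
  have Rm: "- w \<in> R" if "w \<in> R" for w using R(2)[OF that, of "- 1"] by simp
  obtain tu where tu: "x u = y tu" using u(3) by blast
  have xfu: "x (f u) = scale \<kappa> u + y (f tu)"
    by (simp add: xf u(1) tu fy)
  \<comment> \<open>The nonzero scalar makes \<open>u\<close> a boundary of the whole space modulo
    the image of \<open>y\<close>, although it need not be one inside \<open>R\<close>.\<close>
  have uim: "scale c u = x (scale (c / \<kappa>) (f u)) + y (scale (- c / \<kappa>) (f tu))" for c
    using u(2) by (simp add: lin xfu scale_right_distrib minus)
  \<comment> \<open>Exactness modulo the image of \<open>y\<close>, assumed only of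
    \<open>x q\<close> lying in that image, because it is applied twice at the end.\<close>
  have mod_y: "\<exists>p t'. q = x p + y t'" if xq: "x q = y t" for q t
  proof -
    obtain r s t0 where q: "r \<in> R" "s \<in> R" "q = r + f s + y t0" using decomp by blast
    obtain r1 t1 where r1: "r1 \<in> R" "x r = r1 + y t1" using D q by blast
    obtain s1 t2 where s1: "s1 \<in> R" "x s = s1 + y t2" using D q by blast
    have "x q = (r1 + h s) + f (- s1) + y (t1 + f t2 - x t0)"
      unfolding q(3) by (simp add: lin xf xy r1 s1 fy diff minus)
    then have "(r1 + h s) + f (- s1) = y (t - (t1 + f t2 - x t0))"
      using xq by (simp only: diff) (simp add: algebra_simps)
    from uniq[OF _ _ this] have "s1 = 0" using R Rm r1 s1 q by auto
    then have xs: "x s = y t2" using s1 by simp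
    obtain c s' t' where s': "s' \<in> R" "s = scale c u + x s' + y t'" using hom[OF q(2) xs] by blast
    \<comment> \<open>The component \<open>s\<close> is a cycle modulo \<open>y\<close>, hence c
      times \<open>u\<close> plus a boundary. If \<open>u\<close> is not a boundary within
      \<open>R\<close>, applying \<open>x\<close> to \<open>q\<close> makes
      \<open>c * \<kappa>\<close> times \<open>u\<close> one modulo \<open>y\<close>, which forces c
      = 0.\<close>
    have "\<exists>s'\<in>R. \<exists>t'. s = x s' + y t'"
    proof (cases "\<exists>r\<in>R. \<exists>t. u = x r + y t")
      case True
      then obtain r0 t0 where 0: "r0 \<in> R" "u = x r0 + y t0" by blast
      then have "s = x (scale c r0 + s') + y (scale c t0 + t')" "scale c r0 + s' \<in> R"
        using s' R by (simp_all add: lin scale_right_distrib)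
      then show ?thesis by blast
    next
      case False
      have "q + x (f s') = (r + h s') + scale c (f u) + y (t0 - f t')"
        unfolding q(3) s'(2) by (simp add: lin xf fy diff)
      then have "x q + x (x (f s')) = x (r + h s') + scale c (x (f u)) + x (y (t0 - f t'))"
        by (metis lin(1,2))
      then have "y t = x (r + h s') + scale (c * \<kappa>) u + y (scale c (f tu) - x (t0 - f t'))"
        by (simp add: xq xx xfu xy lin diff scale_right_distrib)
      then have *: "scale (c * \<kappa>) u = x (- (r + h s')) + y (t - (scale c (f tu) - x (t0 - f t')))"
        by (simp only: diff minus) (simp add: algebra_simps)
      have "c = 0"
      proof (rule ccontr)
        assume "c \<noteq> 0"
        then have "u = scale (1 / (c * \<kappa>)) (scale (c * \<kappa>) u)" using u(2) by simp
        also have "\<dots> = x (scale (1 / (c * \<kappa>)) (- (r + h s'))) +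
            y (scale (1 / (c * \<kappa>)) (t - (scale c (f tu) - x (t0 - f t'))))"
          unfolding * scale_right_distrib lin ..
        finally show False using False R Rm q(1) s'(1) by blast
      qed
      then show ?thesis using s' by auto
    qed
    then obtain s' t' where s': "s' \<in> R" "s = x s' + y t'" by blast
    \<comment> \<open>Adding a boundary removes the \<open>f\<close>-component and leaves a cycle in
      \<open>R\<close>, to which \<open>hom\<close> and then \<open>uim\<close> apply.\<close>
    have eq: "q + x (f s') = (r + h s') + y (t0 - f t')"
      unfolding q(3) s'(2) by (simp add: lin xf fy diff)
    then have "x q + x (x (f s')) = x (r + h s') + x (y (t0 - f t'))"
      by (metis lin(1))
    then have "x (r + h s') = y (t + x (t0 - f t'))"
      by (simp add: xq xx xy lin algebra_simps)
    from hom[OF _ this] obtain c r3 t3 where "r + h s' = scale c u + x r3 + y t3"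
      using R q s' by blast
    with eq uim[of c] have "q = x (scale (c / \<kappa>) (f u) + r3 - f s') +
        y (scale (- c / \<kappa>) (f tu) + t3 + (t0 - f t'))"
      by (simp only: lin(1,3) diff) (simp add: algebra_simps)
    then show ?thesis by blast
  qed
  have "x q = y 0" using q lin(4)[of 0 0] by simp
  from mod_y[OF this] obtain p r where p: "q = x p + y r" by blast
  \<comment> \<open>Exactness of \<open>y\<close> puts \<open>x r\<close> into the image of
    \<open>y\<close>, so \<open>r\<close> is a boundary modulo \<open>y\<close>, and the correction
    \<open>y r\<close> equals \<open>- x (y p')\<close>.\<close>
  have "y (x r) = 0" using q by (simp add: p lin xx xy)
  then obtain t where "x r = y t" using yex by blast
  from mod_y[OF this] obtain p' t' where "r = x p' + y t'" by blast
  then have "q = x (p - y p')" by (simp add: p lin yy xy diff)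
  then show ?thesis by blast
qed

section \<open>Koszul complexes of two commuting operators on the even Verma module\<close>

lemma up_inj: "up1 n = 0 \<Longrightarrow> n = 0" "up2 n = 0 \<Longrightarrow> n = 0"
proof -
  assume "up1 n = 0"
  then have "lk (up1 n) (Suc i) j = 0" for i j by simp
  then show "n = 0" by (intro fvec_eqI) simp
next
  assume "up2 n = 0"
  then have "lk (up2 n) i (Suc j) = 0" for i j by simp
  then show "n = 0" by (intro fvec_eqI) simp
qed

text \<open>Middle exactness of the Koszul complex of two variables: at i = 0 the first term has no
  coefficient, so \<open>n\<close> is divisible by the first variable, with quotient
  \<open>dn1 n\<close>.\<close>

lemma koszul_up:
  assumes "up1 m + up2 n = 0"
  shows "\<exists>k. m = - up2 k \<and> n = up1 k"
proof -
  have e: "lk (up1 m) i j + lk (up2 n) i j = 0" for i j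
    using assms by (metis lookup_add lookup_zero)
  have "m = - up2 (dn1 n)"
  proof (rule fvec_eqI)
    fix i j show "lk m i j = lk (- up2 (dn1 n)) i j"
      using e[of "Suc i" j] by (auto split: nat.splits simp: eq_neg_iff_add_eq_0)
  qed
  moreover have "n = up1 (dn1 n)"
  proof (rule fvec_eqI)
    fix i j show "lk n i j = lk (up1 (dn1 n)) i j"
      using e[of 0 "Suc j"] by (auto split: nat.splits)
  qed
  ultimately show ?thesis by blast
qed

lemma fvec_up_decomp: "\<exists>c m k. n = scN c fone + up1 m + up2 k"
proof -
  have "n = scN (lk n 0 0) fone + up1 (dn1 n) + up2 (dn2 (dg (\<lambda>(i, j). if i = 0 then 1 else 0) n))"
    by (rule fvec_eqI) (auto simp: lookup_add split: nat.splits)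
  then show ?thesis by blast
qed

text \<open>None of the factors (i + 1) (l1 - l2 - i) vanishes, so a preimage is found by shifting
  up and dividing. The division by zero at index 0 is harmless: \<open>up1 n\<close> has no
  coefficient there.\<close>

lemma nE1_surj:
  assumes "\<And>k :: nat. l $ i1 - l $ i2 \<noteq> of_nat k"
  shows "\<exists>m. nE1 l m = n"
proof -
  have "nE1 l (dg (\<lambda>(i, j). 1 / (of_nat i * (l $ i1 - l $ i2 - of_nat i + 1))) (up1 n)) = n"
  proof (rule fvec_eqI)
    fix i j
    have "(1 + of_nat i :: complex) \<noteq> 0" using of_nat_neq_0[of i] by simp
    moreover have "l $ i1 + (- l $ i2 - of_nat i) \<noteq> 0"
      using assms[of i] by (auto simp: algebra_simps)
    ultimately show "lk (nE1 l (dg (\<lambda>(i, j). 1 / (of_nat i * (l $ i1 - l $ i2 - of_nat i + 1))) (up1 n))) i j =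
      lk n i j" by (simp add: nE1_def)
  qed
  then show ?thesis by blast
qed

lemma nE2_surj:
  assumes "\<And>k :: nat. l $ i3 - l $ i4 \<noteq> of_nat k"
  shows "\<exists>m. nE2 l m = n"
proof -
  have "nE2 l (dg (\<lambda>(i, j). 1 / (of_nat j * (l $ i3 - l $ i4 - of_nat j + 1))) (up2 n)) = n"
  proof (rule fvec_eqI)
    fix i j
    have "(1 + of_nat j :: complex) \<noteq> 0" using of_nat_neq_0[of j] by simp
    moreover have "l $ i3 + (- l $ i4 - of_nat j) \<noteq> 0"
      using assms[of j] by (auto simp: algebra_simps)
    ultimately show "lk (nE2 l (dg (\<lambda>(i, j). 1 / (of_nat j * (l $ i3 - l $ i4 - of_nat j + 1))) (up2 n))) i j =
      lk n i j" by (simp add: nE2_def)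
  qed
  then show ?thesis by blast
qed

text \<open>With E12 in place of a variable the homology moves: E12 is surjective and its kernel
  consists of the polynomials in E43 alone, on which multiplication by E43 has the constants as
  cokernel. These are the multiples of \<open>fone\<close>.\<close>

lemma koszul_nE1:
  assumes l: "\<And>k :: nat. l $ i1 - l $ i2 \<noteq> of_nat k" and e: "nE1 l m + up2 n = 0"
  shows "\<exists>c k. m = scN c fone - up2 k \<and> n = nE1 l k"
proof -
  obtain n' where n': "nE1 l n' = n" using nE1_surj[OF l] by blast
  define k0 where "k0 = m + up2 n'"
  have "nE1 l k0 = 0" using e by (simp add: k0_def n_comm n')
  moreover have "lk (nE1 l k0) i j = of_nat (Suc i) * (l $ i1 - l $ i2 - of_nat i) * lk k0 (Suc i) j" for i j
    by (simp add: nE1_def algebra_simps)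
  ultimately have "of_nat (Suc i) * (l $ i1 - l $ i2 - of_nat i) * lk k0 (Suc i) j = 0" for i j
    by (metis lookup_zero)
  then have z: "lk k0 (Suc i) j = 0" for i j
    using l[of i] by (metis mult_eq_0_iff of_nat_neq_0 right_minus_eq)
  have k0: "k0 = scN (lk k0 0 0) fone + up2 (dn2 k0)"
  proof (rule fvec_eqI)
    fix i j show "lk k0 i j = lk (scN (lk k0 0 0) fone + up2 (dn2 k0)) i j"
      by (cases i; cases j) (simp_all add: lookup_add z)
  qed
  have "nE1 l (dn2 k0) = 0"
    by (rule fvec_eqI) (simp add: nE1_def z)
  then have "n = nE1 l (n' - dn2 k0)" by (simp add: n')
  moreover have "m = scN (lk k0 0 0) fone - up2 (n' - dn2 k0)"
  proof -
    have "m = k0 - up2 n'" by (simp add: k0_def)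
    also have "\<dots> = scN (lk k0 0 0) fone + up2 (dn2 k0) - up2 n'" using k0 by metis
    finally show ?thesis by simp
  qed
  ultimately show ?thesis by blast
qed

lemma koszul_nE2:
  assumes l: "\<And>k :: nat. l $ i3 - l $ i4 \<noteq> of_nat k" and e: "nE2 l m + up1 n = 0"
  shows "\<exists>c k. m = scN c fone - up1 k \<and> n = nE2 l k"
proof -
  obtain n' where n': "nE2 l n' = n" using nE2_surj[OF l] by blast
  define k0 where "k0 = m + up1 n'"
  have "nE2 l k0 = 0" using e by (simp add: k0_def n_comm n')
  moreover have "lk (nE2 l k0) i j = of_nat (Suc j) * (l $ i3 - l $ i4 - of_nat j) * lk k0 i (Suc j)" for i j
    by (simp add: nE2_def algebra_simps)
  ultimately have "of_nat (Suc j) * (l $ i3 - l $ i4 - of_nat j) * lk k0 i (Suc j) = 0" for i j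
    by (metis lookup_zero)
  then have z: "lk k0 i (Suc j) = 0" for i j
    using l[of j] by (metis mult_eq_0_iff of_nat_neq_0 right_minus_eq)
  have k0: "k0 = scN (lk k0 0 0) fone + up1 (dn1 k0)"
  proof (rule fvec_eqI)
    fix i j show "lk k0 i j = lk (scN (lk k0 0 0) fone + up1 (dn1 k0)) i j"
      by (cases i; cases j) (simp_all add: lookup_add z)
  qed
  have "nE2 l (dn1 k0) = 0"
    by (rule fvec_eqI) (simp add: nE2_def z)
  then have "n = nE2 l (n' - dn1 k0)" by (simp add: n')
  moreover have "m = scN (lk k0 0 0) fone - up1 (n' - dn1 k0)"
  proof -
    have "m = k0 - up1 n'" by (simp add: k0_def)
    also have "\<dots> = scN (lk k0 0 0) fone + up1 (dn1 k0) - up1 n'" using k0 by metis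
    finally show ?thesis by simp
  qed
  ultimately show ?thesis by blast
qed

section \<open>Exactness for a single root vector\<close>

definition ex_op :: "(vrm \<Rightarrow> vrm) \<Rightarrow> bool" where
  "ex_op T \<longleftrightarrow> (\<forall>w. T w = 0 \<longrightarrow> (\<exists>v. w = T v))"

lemma y_ker_im:
  "yA w = 0 \<Longrightarrow> w = yA (dA w)" "yB w = 0 \<Longrightarrow> w = yB (dB w)"
  "yC w = 0 \<Longrightarrow> w = yC (dC w)" "yD w = 0 \<Longrightarrow> w = yD (dD w)"
  by (simp_all add: vrm_eq_iff all_bool_eq yd_defs)

lemma ex_y: "ex_op yA" "ex_op yB" "ex_op yC" "ex_op yD"
  unfolding ex_op_def using y_ker_im by blast+

lemma yy_zero: "yA (yA w) = 0" "yB (yB w) = 0" "yC (yC w) = 0" "yD (yD w) = 0"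
  by (simp_all add: vrm_eq_iff all_bool_eq yd_defs)

lemma EE_zero: "E23 l (E23 l w) = 0" "E13 l (E13 l w) = 0" "E24 l (E24 l w) = 0" "E14 l (E14 l w) = 0"
proof -
  have *: "v = 0" if "v = - v" for v :: vrm
  proof -
    have "scV 2 v = 0"
      using that V.scale_left_distrib[of 1 1 v] by (metis V.scale_one add.right_inverse one_add_one)
    then show ?thesis using V.scale_eq_0_iff[of 2 v] by (metis zero_neq_numeral)
  qed
  show "E23 l (E23 l w) = 0" "E13 l (E13 l w) = 0" "E24 l (E24 l w) = 0" "E14 l (E14 l w) = 0"
    using Eop_comm[of l i2 i3 i2 i3 w] Eop_comm[of l i1 i3 i1 i3 w] Eop_comm[of l i2 i4 i2 i4 w]
      Eop_comm[of l i1 i4 i1 i4 w] by (auto intro: *)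
qed

lemma sg_zero [simp]: "sg a 0 = 0"
  by (simp add: sg_def)

text \<open>The brackets of E23 with the generators of \<alpha>, \<beta>, \<gamma>, \<delta> are E22
  + E33, E21, E43 and 0. So \<alpha> supplies \<open>f\<close>, \<delta> supplies \<open>y\<close>,
  and \<open>R\<close> carries the Koszul complex of the two variables, whose homology is spanned by
  the highest weight vector.\<close>

lemma E23_exact:
  assumes "l $ i2 + l $ i3 \<noteq> 0"
  shows "ex_op (E23 l)"
  unfolding ex_op_def
proof (intro allI impI)
  fix q assume "E23 l q = 0"
  define R :: "vrm set" where "R = {w. \<forall>a b c d. a \<or> d \<longrightarrow> w a b c d = 0}"
  define pr :: "vrm \<Rightarrow> vrm" where "pr w = (\<lambda>a b c d. if a \<or> d then 0 else w a b c d)" for w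
  have pr: "pr w \<in> R" for w by (simp add: R_def pr_def)
  show "\<exists>p. q = E23 l p"
  proof (rule V.koszul_exact[where x = "E23 l" and y = yD and f = yA and h = "\<lambda>w. E22 l w + E33 l w" and
        R = R and \<kappa> = "l $ i2 + l $ i3" and u = "vac fone"])
    show "E23 l (yD w) = - yD (E23 l w)" for w using Eop_comm[of l i2 i3 i4 i1 w] by simp
    show "E23 l (yA w) = E22 l w + E33 l w - yA (E23 l w)" for w
      using Eop_comm[of l i2 i3 i3 i2 w] by (simp add: algebra_simps)
    show "yA (yD w) = - yD (yA w)" for w using Eop_comm[of l i3 i2 i4 i1 w] by simp
    show "\<exists>v. w = yD v" if "yD w = 0" for w using y_ker_im that by blast
    show "v + w \<in> R" if "v \<in> R" "w \<in> R" for v w using that by (simp add: R_def)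
    show "scV c w \<in> R" if "w \<in> R" for c w using that by (simp add: R_def)
    show "E22 l w + E33 l w \<in> R" if "w \<in> R" for w using that by (simp add: R_def E_defs yd_defs)
    show "\<exists>r\<in>R. \<exists>s\<in>R. \<exists>t. w = r + yA s + yD t" for w
    proof (intro bexI exI)
      show "w = pr w + yA (pr (dA w)) + yD (dD w)"
        by (simp add: vrm_eq_iff all_bool_eq yd_defs pr_def)
    qed (rule pr)+
    show "s = 0" if "r \<in> R" "s \<in> R" "r + yA s = yD t" for r s t
      using that unfolding vrm_eq_iff all_bool_eq R_def by (simp add: yd_defs all_bool_eq)
    show "\<exists>r'\<in>R. \<exists>t. E23 l r = r' + yD t" if "r \<in> R" for r
    proof (intro bexI exI)
      show "E23 l r = pr (E23 l r) + yD (dD (E23 l r))"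
        using that unfolding vrm_eq_iff all_bool_eq R_def
        by (simp add: yd_defs pr_def E_defs all_bool_eq)
    qed (rule pr)
    show "E22 l (vac fone) + E33 l (vac fone) = scV (l $ i2 + l $ i3) (vac fone)"
      using Eop_vac[of l i2 i2] Eop_vac[of l i3 i3] by (simp add: V.scale_left_distrib)
    show "\<exists>t. E23 l (vac fone) = yD t"
    proof
      show "E23 l (vac fone) = yD 0" by (simp add: vrm_eq_iff all_bool_eq E_defs yd_defs vac_def)
    qed
    show "\<exists>c. \<exists>r'\<in>R. \<exists>t'. r = scV c (vac fone) + E23 l r' + yD t'" if r: "r \<in> R" and e: "E23 l r = yD t" for r t
    proof -
      define n where "n b c = r False b c False" for b c
      have rn: "r = (\<lambda>a b c d. if a \<or> d then 0 else n b c)"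
        using r by (auto simp: R_def n_def fun_eq_iff)
      have "\<forall>b c. E23 l r False b c False = 0" unfolding e by (simp add: yd_defs)
      then have n: "up1 (n True False) + up2 (n False True) = 0" "up1 (n True True) = 0"
        unfolding rn by (simp_all add: all_bool_eq E_defs yd_defs algebra_simps)
      obtain k where k: "n True False = - up2 k" "n False True = up1 k" using koszul_up[OF n(1)] by blast
      have k': "n True True = 0" using up_inj n(2) by blast
      obtain c m1 m2 where m: "n False False = scN c fone + up1 m1 + up2 m2" using fvec_up_decomp by blast
      define r' :: vrm where "r' = (\<lambda>a b c d. if a \<or> d then 0 else if b then if c then k else m1 else if c then m2 else 0)"
      have "r = scV c (vac fone) + E23 l r' + yD (dD (r - E23 l r'))"
        unfolding rn by (simp add: vrm_eq_iff all_bool_eq r'_def k k' m E_defs yd_defs vac_def)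
      moreover have "r' \<in> R" by (simp add: R_def r'_def)
      ultimately show ?thesis by blast
    qed
  qed (use assms Eop_linear[of l i2 i3] Eop_linear[of l i3 i2] Eop_linear[of l i4 i1] in
      \<open>simp_all add: yy_zero EE_zero \<open>E23 l q = 0\<close>\<close>)
qed

text \<open>The brackets are E12 for \<alpha>, E11 + E33 for \<beta>, 0 for \<gamma> and E43 for
  \<delta>. As E12 replaces a variable, the homology is spanned by the generator of \<alpha> applied
  to the highest weight vector; that generator raises the eigenvalue of E33 by one, whence the
  constant.\<close>

lemma E13_exact:
  assumes l: "l $ i1 + l $ i3 + 1 \<noteq> 0" and surj: "\<And>k :: nat. l $ i1 - l $ i2 \<noteq> of_nat k"
  shows "ex_op (E13 l)"
  unfolding ex_op_def
proof (intro allI impI)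
  fix q assume "E13 l q = 0"
  define R :: "vrm set" where "R = {w. \<forall>a b c d. b \<or> c \<longrightarrow> w a b c d = 0}"
  define pr :: "vrm \<Rightarrow> vrm" where "pr w = (\<lambda>a b c d. if b \<or> c then 0 else w a b c d)" for w
  have pr: "pr w \<in> R" for w by (simp add: R_def pr_def)
  show "\<exists>p. q = E13 l p"
  proof (rule V.koszul_exact[where x = "E13 l" and y = yC and f = yB and h = "\<lambda>w. E11 l w + E33 l w" and
        R = R and \<kappa> = "l $ i1 + l $ i3 + 1" and u = "yA (vac fone)"])
    show "E13 l (yC w) = - yC (E13 l w)" for w using Eop_comm[of l i1 i3 i4 i2 w] by simp
    show "E13 l (yB w) = E11 l w + E33 l w - yB (E13 l w)" for w
      using Eop_comm[of l i1 i3 i3 i1 w] by (simp add: algebra_simps)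
    show "yB (yC w) = - yC (yB w)" for w using Eop_comm[of l i3 i1 i4 i2 w] by simp
    show "\<exists>v. w = yC v" if "yC w = 0" for w using y_ker_im that by blast
    show "v + w \<in> R" if "v \<in> R" "w \<in> R" for v w using that by (simp add: R_def)
    show "scV c w \<in> R" if "w \<in> R" for c w using that by (simp add: R_def)
    show "E11 l w + E33 l w \<in> R" if "w \<in> R" for w using that by (simp add: R_def E_defs yd_defs)
    show "\<exists>r\<in>R. \<exists>s\<in>R. \<exists>t. w = r + yB s + yC t" for w
    proof (intro bexI exI)
      show "w = pr w + yB (pr (dB w)) + yC (dC w)"
        by (simp add: vrm_eq_iff all_bool_eq yd_defs pr_def)
    qed (rule pr)+
    show "s = 0" if "r \<in> R" "s \<in> R" "r + yB s = yC t" for r s t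
      using that unfolding vrm_eq_iff all_bool_eq R_def by (simp add: yd_defs all_bool_eq)
    show "\<exists>r'\<in>R. \<exists>t. E13 l r = r' + yC t" if "r \<in> R" for r
    proof (intro bexI exI)
      show "E13 l r = pr (E13 l r) + yC (dC (E13 l r))"
        using that unfolding vrm_eq_iff all_bool_eq R_def
        by (simp add: yd_defs pr_def E_defs all_bool_eq)
    qed (rule pr)
    show "E11 l (yA (vac fone)) + E33 l (yA (vac fone)) = scV (l $ i1 + l $ i3 + 1) (yA (vac fone))"
      by (rule vrm_eqI) (simp add: E_defs yd_defs vac_def lookup_add lookup_minus algebra_simps)
    show "\<exists>t. E13 l (yA (vac fone)) = yC t"
    proof
      show "E13 l (yA (vac fone)) = yC 0" by (simp add: vrm_eq_iff all_bool_eq E_defs yd_defs vac_def)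
    qed
    show "\<exists>c. \<exists>r'\<in>R. \<exists>t'. r = scV c (yA (vac fone)) + E13 l r' + yC t'"
      if r: "r \<in> R" and e: "E13 l r = yC t" for r t
    proof -
      define n where "n a d = r a False False d" for a d
      have rn: "r = (\<lambda>a b c d. if b \<or> c then 0 else n a d)"
        using r by (auto simp: R_def n_def fun_eq_iff)
      have "\<forall>a d. E13 l r a False False d = 0" unfolding e by (simp add: yd_defs)
      then have n: "nE1 l (n True False) + up2 (n False True) = 0" "up2 (n True True) = 0"
        unfolding rn by (simp_all add: all_bool_eq E_defs yd_defs algebra_simps)
      obtain c k where k: "n True False = scN c fone - up2 k" "n False True = nE1 l k"
        using koszul_nE1[OF surj n(1)] by blast
      have k': "n True True = 0" using up_inj n(2) by blast
      obtain m where m: "nE1 l m = n False False" using nE1_surj[OF surj] by blast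
      define r' :: vrm where "r' = (\<lambda>a b c d. if b \<or> c then 0 else if a then if d then k else m else 0)"
      have "r = scV c (yA (vac fone)) + E13 l r' + yC (dC (r - E13 l r'))"
        unfolding rn by (simp add: vrm_eq_iff all_bool_eq r'_def k k' m E_defs yd_defs vac_def)
      moreover have "r' \<in> R" by (simp add: R_def r'_def)
      ultimately show ?thesis by blast
    qed
  qed (use l Eop_linear[of l i1 i3] Eop_linear[of l i3 i1] Eop_linear[of l i4 i2] in
      \<open>simp_all add: yy_zero EE_zero \<open>E13 l q = 0\<close>\<close>)
qed

text \<open>The mirror image of E13: the brackets are E34 for \<alpha>, 0 for \<beta>, E22 + E44 for
  \<gamma> and E21 for \<delta>, and the generator of \<alpha> lowers the eigenvalue of E22 by
  one.\<close>

lemma E24_exact: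
  assumes l: "l $ i2 + l $ i4 - 1 \<noteq> 0" and surj: "\<And>k :: nat. l $ i3 - l $ i4 \<noteq> of_nat k"
  shows "ex_op (E24 l)"
  unfolding ex_op_def
proof (intro allI impI)
  fix q assume "E24 l q = 0"
  define R :: "vrm set" where "R = {w. \<forall>a b c d. b \<or> c \<longrightarrow> w a b c d = 0}"
  define pr :: "vrm \<Rightarrow> vrm" where "pr w = (\<lambda>a b c d. if b \<or> c then 0 else w a b c d)" for w
  have pr: "pr w \<in> R" for w by (simp add: R_def pr_def)
  show "\<exists>p. q = E24 l p"
  proof (rule V.koszul_exact[where x = "E24 l" and y = yB and f = yC and h = "\<lambda>w. E22 l w + E44 l w" and
        R = R and \<kappa> = "l $ i2 + l $ i4 - 1" and u = "yA (vac fone)"])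
    show "E24 l (yB w) = - yB (E24 l w)" for w using Eop_comm[of l i2 i4 i3 i1 w] by simp
    show "E24 l (yC w) = E22 l w + E44 l w - yC (E24 l w)" for w
      using Eop_comm[of l i2 i4 i4 i2 w] by (simp add: algebra_simps)
    show "yC (yB w) = - yB (yC w)" for w using Eop_comm[of l i4 i2 i3 i1 w] by simp
    show "\<exists>v. w = yB v" if "yB w = 0" for w using y_ker_im that by blast
    show "v + w \<in> R" if "v \<in> R" "w \<in> R" for v w using that by (simp add: R_def)
    show "scV c w \<in> R" if "w \<in> R" for c w using that by (simp add: R_def)
    show "E22 l w + E44 l w \<in> R" if "w \<in> R" for w using that by (simp add: R_def E_defs yd_defs)
    show "\<exists>r\<in>R. \<exists>s\<in>R. \<exists>t. w = r + yC s + yB t" for w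
    proof (intro bexI exI)
      show "w = pr w + yC (pr (dC w)) + yB (dB w)"
        by (simp add: vrm_eq_iff all_bool_eq yd_defs pr_def)
    qed (rule pr)+
    show "s = 0" if "r \<in> R" "s \<in> R" "r + yC s = yB t" for r s t
      using that unfolding vrm_eq_iff all_bool_eq R_def by (simp add: yd_defs all_bool_eq)
    show "\<exists>r'\<in>R. \<exists>t. E24 l r = r' + yB t" if "r \<in> R" for r
    proof (intro bexI exI)
      show "E24 l r = pr (E24 l r) + yB (dB (E24 l r))"
        using that unfolding vrm_eq_iff all_bool_eq R_def
        by (simp add: yd_defs pr_def E_defs all_bool_eq)
    qed (rule pr)
    show "E22 l (yA (vac fone)) + E44 l (yA (vac fone)) = scV (l $ i2 + l $ i4 - 1) (yA (vac fone))"
      by (rule vrm_eqI) (simp add: E_defs yd_defs vac_def lookup_add lookup_minus algebra_simps)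
    show "\<exists>t. E24 l (yA (vac fone)) = yB t"
    proof
      show "E24 l (yA (vac fone)) = yB 0" by (simp add: vrm_eq_iff all_bool_eq E_defs yd_defs vac_def)
    qed
    show "\<exists>c. \<exists>r'\<in>R. \<exists>t'. r = scV c (yA (vac fone)) + E24 l r' + yB t'"
      if r: "r \<in> R" and e: "E24 l r = yB t" for r t
    proof -
      define n where "n a d = r a False False d" for a d
      have rn: "r = (\<lambda>a b c d. if b \<or> c then 0 else n a d)"
        using r by (auto simp: R_def n_def fun_eq_iff)
      have "\<forall>a d. E24 l r a False False d = 0" unfolding e by (simp add: yd_defs)
      then have n: "nE2 l (n True False) + up1 (n False True) = 0" "up1 (n True True) = 0"
        unfolding rn by (simp_all add: all_bool_eq E_defs yd_defs algebra_simps)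
      obtain c k where k: "n True False = scN c fone - up1 k" "n False True = nE2 l k"
        using koszul_nE2[OF surj n(1)] by blast
      have k': "n True True = 0" using up_inj n(2) by blast
      obtain m where m: "nE2 l m = n False False" using nE2_surj[OF surj] by blast
      define r' :: vrm where "r' = (\<lambda>a b c d. if b \<or> c then 0 else if a then if d then k else m else 0)"
      have "r = scV c (yA (vac fone)) + E24 l r' + yB (dB (r - E24 l r'))"
        unfolding rn by (simp add: vrm_eq_iff all_bool_eq r'_def k k' m E_defs yd_defs vac_def)
      moreover have "r' \<in> R" by (simp add: R_def r'_def)
      ultimately show ?thesis by blast
    qed
  qed (use l Eop_linear[of l i2 i4] Eop_linear[of l i4 i2] Eop_linear[of l i3 i1] in
      \<open>simp_all add: yy_zero EE_zero \<open>E24 l q = 0\<close>\<close>)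
qed

section \<open>Gradings by diagonal matrices, and sums of two root vectors\<close>

text \<open>\<open>dgr t\<close> is the eigenvalue of the diagonal matrix with entries \<open>t\<close> on a basis vector, minus the
  one on the highest weight vector.\<close>

definition dgr :: "(2 + 2 \<Rightarrow> int) \<Rightarrow> bool \<Rightarrow> bool \<Rightarrow> bool \<Rightarrow> bool \<Rightarrow> nat \<Rightarrow> nat \<Rightarrow> int" where
  "dgr t a b c d i j = of_bool a * (t i3 - t i2) + of_bool b * (t i3 - t i1) + of_bool c * (t i4 - t i2)
    + of_bool d * (t i4 - t i1) + int i * (t i2 - t i1) + int j * (t i4 - t i3)"

definition hop :: "(2 + 2 \<Rightarrow> int) \<Rightarrow> weight \<Rightarrow> vrm \<Rightarrow> vrm" where
  "hop t l w = (\<Sum>p\<in>UNIV. scV (of_int (t p)) (Eop l p p w))"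

lemma lookup_double [simp]: "Poly_Mapping.lookup (2 * n :: fvec) k = 2 * Poly_Mapping.lookup n k"
  by (simp only: mult_2 lookup_add)

lemma hop_lookup:
  "lk (hop t l w a b c d) i j =
    ((\<Sum>p\<in>UNIV. of_int (t p) * l $ p) + of_int (dgr t a b c d i j)) * lk (w a b c d) i j"
proof -
  have "\<forall>a b c d. lk (hop t l w a b c d) i j =
    ((\<Sum>p\<in>UNIV. of_int (t p) * l $ p) + of_int (dgr t a b c d i j)) * lk (w a b c d) i j"
    unfolding all_bool_eq
    by (simp add: hop_def sum_22 E_defs yd_defs n_defs dgr_def lookup_add lookup_minus algebra_simps)
  then show ?thesis by blast
qed

lemma hop_Eop: "hop t l (Eop l p q w) = Eop l p q (hop t l w) + scV (of_int (t p - t q)) (Eop l p q w)"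
proof -
  have "Eop l r r (Eop l p q w) = Eop l p q (Eop l r r w) +
      ((if r = p then Eop l r q w else 0) - (if r = q then Eop l p r w else 0))" for r
    using Eop_comm[of l r r p q w] by auto
  then have "hop t l (Eop l p q w) = (\<Sum>r\<in>UNIV. Eop l p q (scV (of_int (t r)) (Eop l r r w)) +
      ((if r = p then scV (of_int (t r)) (Eop l r q w) else 0) -
       (if r = q then scV (of_int (t r)) (Eop l p r w) else 0)))"
    unfolding hop_def by (intro sum.cong refl) (simp add: V.scale_right_distrib V.scale_right_diff_distrib)
  also have "\<dots> = Eop l p q (hop t l w) + (scV (of_int (t p)) (Eop l p q w) - scV (of_int (t q)) (Eop l p q w))"
    unfolding sum.distrib sum_subtractf hop_def Eop_sum by simp
  finally show ?thesis by (simp only: of_int_diff V.scale_left_diff_distrib)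
qed

definition sup_in :: "(2 + 2 \<Rightarrow> int) \<Rightarrow> int set \<Rightarrow> vrm \<Rightarrow> bool" where
  "sup_in t A w \<longleftrightarrow> (\<forall>a b c d i j. dgr t a b c d i j \<notin> A \<longrightarrow> lk (w a b c d) i j = 0)"

text \<open>Homogeneous vectors are the eigenvectors of the grading operator, whichever
  \<open>l\<close> is used; the degree of an operator can then be read off from a
  commutator.\<close>

lemma sup_in_pure: "sup_in t {k} w \<longleftrightarrow> hop t l w = scV ((\<Sum>p\<in>UNIV. of_int (t p) * l $ p) + of_int k) w"
proof
  assume "sup_in t {k} w"
  then show "hop t l w = scV ((\<Sum>p\<in>UNIV. of_int (t p) * l $ p) + of_int k) w"
    by (intro vrm_eqI) (auto simp: hop_lookup sup_in_def)
next
  assume h: "hop t l w = scV ((\<Sum>p\<in>UNIV. of_int (t p) * l $ p) + of_int k) w"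
  show "sup_in t {k} w"
    unfolding sup_in_def
  proof (intro allI impI)
    fix a b c d i j assume n: "dgr t a b c d i j \<notin> {k}"
    have "lk (hop t l w a b c d) i j = lk (scV ((\<Sum>p\<in>UNIV. of_int (t p) * l $ p) + of_int k) w a b c d) i j"
      unfolding h ..
    then show "lk (w a b c d) i j = 0" using n by (simp add: hop_lookup)
  qed
qed

lemma sup_in_pure_Eop: "sup_in t {k} w \<Longrightarrow> sup_in t {k + (t p - t q)} (Eop l p q w)"
  unfolding sup_in_pure[of t _ _ l] hop_Eop
  by (simp only: Eop_linear of_int_add V.scale_left_distrib add.assoc)

lemma sup_in_add: "sup_in t A v \<Longrightarrow> sup_in t A w \<Longrightarrow> sup_in t A (v + w)"
  unfolding sup_in_def by (force simp: lookup_add)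

lemma sup_in_scV: "sup_in t A w \<Longrightarrow> sup_in t A (scV c w)"
  unfolding sup_in_def by auto

lemma sup_in_mono: "sup_in t A w \<Longrightarrow> A \<subseteq> B \<Longrightarrow> sup_in t B w"
  unfolding sup_in_def by blast

lemma sup_in_zero: "sup_in t A 0"
  unfolding sup_in_def by simp

lemma sup_in_disjoint: "sup_in t A w \<Longrightarrow> sup_in t B w \<Longrightarrow> A \<inter> B = {} \<Longrightarrow> w = 0"
  unfolding sup_in_def by (intro vrm_eqI) (simp, blast)

definition gr_comp :: "(2 + 2 \<Rightarrow> int) \<Rightarrow> int \<Rightarrow> vrm \<Rightarrow> vrm" where
  "gr_comp t k w = (\<lambda>a b c d. dg (\<lambda>(i, j). if dgr t a b c d i j = k then 1 else 0) (w a b c d))"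

lemma gr_comp_lookup: "lk (gr_comp t k w a b c d) i j = (if dgr t a b c d i j = k then lk (w a b c d) i j else 0)"
  by (simp add: gr_comp_def)

lemma sup_in_gr_comp: "sup_in t {k} (gr_comp t k w)"
  unfolding sup_in_def by (simp add: gr_comp_lookup)

lemma sup_in_diff_gr_comp: "sup_in t A w \<Longrightarrow> sup_in t (A - {k}) (w - gr_comp t k w)"
  unfolding sup_in_def by (simp add: gr_comp_lookup lookup_minus)

lemma gr_comp_other: "sup_in t A w \<Longrightarrow> k \<notin> A \<Longrightarrow> gr_comp t k w = 0"
  unfolding sup_in_def by (intro vrm_eqI) (auto simp: gr_comp_lookup)

lemma finite_sup: "\<exists>K. finite K \<and> sup_in t K w"
proof -
  define K where "K = (\<Union>a\<in>UNIV. \<Union>b\<in>UNIV. \<Union>c\<in>UNIV. \<Union>d\<in>UNIV.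
    (\<lambda>(i, j). dgr t a b c d i j) ` Poly_Mapping.keys (w a b c d))"
  have "finite K" by (simp add: K_def)
  moreover have "sup_in t K w"
    unfolding sup_in_def K_def by (force simp: in_keys_iff)
  ultimately show ?thesis by blast
qed

text \<open>A vector involves finitely many degrees; its components are split off one by one, and
  each is covered by the homogeneous case.\<close>

lemma sup_in_Eop:
  assumes "sup_in t A w"
  shows "sup_in t ((\<lambda>k. k + (t p - t q)) ` A) (Eop l p q w)"
proof -
  have *: "sup_in t ((\<lambda>k. k + (t p - t q)) ` A) (Eop l p q w)" if "finite K" "sup_in t (A \<inter> K) w" for K w
    using that
  proof (induction K arbitrary: w)
    case empty
    then have "w = 0" by (intro sup_in_disjoint[of t "{}" w "{}"]) auto
    then show ?case by (simp only: Eop_zero sup_in_zero)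
  next
    case (insert k K)
    have e: "Eop l p q w = Eop l p q (gr_comp t k w) + Eop l p q (w - gr_comp t k w)"
      by (simp only: Eop_linear(1)[symmetric] add_diff_cancel_left' add_diff_eq)
    have "sup_in t (A \<inter> K) (w - gr_comp t k w)"
      using sup_in_mono[OF sup_in_diff_gr_comp[OF insert.prems]] by blast
    then have 1: "sup_in t ((\<lambda>k. k + (t p - t q)) ` A) (Eop l p q (w - gr_comp t k w))"
      by (rule insert.IH)
    have 2: "sup_in t ((\<lambda>k. k + (t p - t q)) ` A) (Eop l p q (gr_comp t k w))"
    proof (cases "k \<in> A")
      case True
      then show ?thesis by (intro sup_in_mono[OF sup_in_pure_Eop[OF sup_in_gr_comp]]) auto
    next
      case False
      then have "gr_comp t k w = 0" by (intro gr_comp_other[OF insert.prems]) simp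
      then show ?thesis by (simp only: Eop_zero sup_in_zero)
    qed
    show ?case unfolding e by (rule sup_in_add[OF 2 1])
  qed
  obtain K where K: "finite K" "sup_in t K w" using finite_sup by blast
  show ?thesis
    by (rule *[OF K(1)]) (use assms K(2) in \<open>auto simp: sup_in_def\<close>)
qed

text \<open>Lowest degree components of cycles are killed one after the other; this stops because the
  grading is bounded above.\<close>

lemma filtered_exact:
  fixes t :: "2 + 2 \<Rightarrow> int"
  defines "deg \<equiv> \<lambda>p q. t p - t q"
  assumes X: "\<And>w. X w = scV \<mu> (Eop l p q w) + scV \<nu> (Eop l r s w)" and \<mu>: "\<mu> \<noteq> 0"
    and XX: "\<And>w. X (X w) = 0" and less: "deg p q < deg r s"
    and bdd: "\<And>a b c d i j. dgr t a b c d i j \<le> K" and ex: "ex_op (Eop l p q)"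
  shows "ex_op X"
proof -
  have Xlin: "X (v + w) = X v + X w" "X (v - w) = X v - X w" for v w
    unfolding X by (simp_all only: Eop_linear Eop_diff V.scale_right_distrib V.scale_right_diff_distrib
        add_diff_add add_ac)
  \<comment> \<open>Induction on the number of degrees left between the lower bound \<open>k\<close>
    and the upper bound \<open>K\<close>; with none left the vector is zero.\<close>
  have step: "\<exists>v. w = X v" if "sup_in t {k..} w" "X w = 0" "K < k + int n" for k n w
    using that
  proof (induction n arbitrary: k w)
    case 0
    have "w = 0"
      by (rule sup_in_disjoint[OF 0(1), of "{..K}"]) (use bdd 0(3) in \<open>auto simp: sup_in_def\<close>)
    then have "w = X 0" unfolding X by (simp only: Eop_zero V.scale_zero_right add_0_right)
    then show ?case by blast
  next
    case (Suc n)
    let ?E = "Eop l p q" and ?F = "Eop l r s" and ?d = "deg p q" and ?d' = "deg r s"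
    define v where "v = gr_comp t k w"
    define w' where "w' = w - v"
    have v: "sup_in t {k} v" unfolding v_def by (rule sup_in_gr_comp)
    have w': "sup_in t {k + 1..} w'"
      unfolding w'_def v_def by (rule sup_in_mono[OF sup_in_diff_gr_comp[OF Suc.prems(1)]]) auto
    have Ev: "sup_in t {k + ?d} (?E v)" unfolding deg_def by (rule sup_in_pure_Eop[OF v])
    have "sup_in t {k + ?d + 1..} (?E w')"
      by (rule sup_in_mono[OF sup_in_Eop[OF w']]) (auto simp: deg_def)
    moreover have "sup_in t {k + ?d + 1..} (?F w)"
      by (rule sup_in_mono[OF sup_in_Eop[OF Suc.prems(1)]]) (use less in \<open>auto simp: deg_def\<close>)
    ultimately have rest: "sup_in t {k + ?d + 1..} (scV (- 1 / \<mu>) (scV \<mu> (?E w') + scV \<nu> (?F w)))"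
      by (intro sup_in_add sup_in_scV)
    have "scV \<mu> (?E v) + (scV \<mu> (?E w') + scV \<nu> (?F w)) = X w"
      unfolding X w'_def Eop_diff V.scale_right_diff_distrib by simp
    \<comment> \<open>A term of degree \<open>k + ?d\<close> equals terms of higher degree, so both
      vanish: the lowest component is a cycle of the first operator alone.\<close>
    then have "scV \<mu> (?E v) = - (scV \<mu> (?E w') + scV \<nu> (?F w))"
      using Suc.prems(2) by (simp only: eq_neg_iff_add_eq_0)
    then have "scV (1 / \<mu>) (scV \<mu> (?E v)) = scV (- 1 / \<mu>) (scV \<mu> (?E w') + scV \<nu> (?F w))"
      by (simp only: V.scale_minus_right V.scale_minus_left minus_divide_left[symmetric])
    then have "sup_in t {k + ?d + 1..} (?E v)"
      using rest \<mu> by (simp only: V.scale_scale) (simp del: scV_apply)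
    from sup_in_disjoint[OF Ev this] have "?E v = 0" by auto
    then obtain p0 where p0: "v = ?E p0" using ex unfolding ex_op_def by blast
    \<comment> \<open>The preimage is cut down to its component of the right degree, so that
      subtracting the image of its multiple under \<open>X\<close> leaves only degrees above
      \<open>k\<close>.\<close>
    define p1 where "p1 = gr_comp t (k - ?d) p0"
    have p1: "sup_in t {k - ?d} p1" unfolding p1_def by (rule sup_in_gr_comp)
    have "sup_in t {k} (?E p1)" using sup_in_pure_Eop[OF p1, of p q l] by (simp add: deg_def)
    moreover have "sup_in t (- {k}) (?E (p0 - p1))"
    proof -
      have "sup_in t (UNIV - {k - ?d}) (p0 - p1)"
        unfolding p1_def by (rule sup_in_diff_gr_comp) (simp add: sup_in_def)
      from sup_in_Eop[OF this, of p q l] show ?thesis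
        by (rule sup_in_mono) (auto simp: deg_def)
    qed
    moreover have "?E (p0 - p1) = v - ?E p1" unfolding Eop_diff p0 ..
    ultimately have "sup_in t {k} (v - ?E p1)" "sup_in t (- {k}) (v - ?E p1)"
      using sup_in_add[OF v sup_in_scV[of t "{k}" "?E p1" "- 1"]]
      by (simp_all only: V.scale_minus_left V.scale_one add_uminus_conv_diff)
    then have "v - ?E p1 = 0" by (rule sup_in_disjoint) auto
    then have vp: "v = ?E p1" by simp
    have Fp: "sup_in t {k + 1..} (?F p1)"
      by (rule sup_in_mono[OF sup_in_pure_Eop[OF p1]]) (use less in \<open>auto simp: deg_def\<close>)
    define z where "z = scV (1 / \<mu>) p1"
    have Xz: "X z = v + scV (\<nu> / \<mu>) (?F p1)"
      unfolding X z_def vp using \<mu> by (simp only: Eop_linear V.scale_scale) simp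
    have 1: "sup_in t {k + 1..} (w - X z)"
    proof -
      have "w - X z = w' + scV (- (\<nu> / \<mu>)) (?F p1)"
        unfolding Xz w'_def V.scale_minus_left by simp
      then show ?thesis using sup_in_add[OF w' sup_in_scV[OF Fp]] by metis
    qed
    have 2: "X (w - X z) = 0" unfolding Xlin XX Suc.prems(2) by simp
    have 3: "K < k + 1 + int n" using Suc.prems(3) by simp
    obtain u where "w - X z = X u" using Suc.IH[OF 1 2 3] by (elim exE)
    then have "w = X (u + z)" unfolding Xlin by (simp only: diff_eq_eq)
    then show ?case by blast
  qed
  show ?thesis
    unfolding ex_op_def
  proof (intro allI impI)
    fix w assume w: "X w = 0"
    obtain A where A: "finite A" "sup_in t A w" using finite_sup by blast
    have "sup_in t {Min (insert K A)..} w"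
      by (rule sup_in_mono[OF A(2)]) (use A(1) in auto)
    then show "\<exists>v. w = X v"
    proof (rule step[OF _ w])
      have "Min (insert K A) \<le> K" using A(1) by simp
      then show "K < Min (insert K A) + int (nat (K - Min (insert K A) + 1))" by simp
    qed
  qed
qed

text \<open>The bracket of E14 with E41 is E11 + E44, which is diagonal, commutes with E14 and has
  eigenvalues l1 + l4 plus integers. It is thus invertible, and its inverse followed by E41 is a
  contracting homotopy.\<close>

lemma E14_exact:
  assumes "l $ i1 + l $ i4 \<notin> \<int>"
  shows "ex_op (E14 l)"
  unfolding ex_op_def
proof (intro allI impI)
  fix w assume w: "E14 l w = 0"
  define t :: "2 + 2 \<Rightarrow> int" where "t p = (if p = i1 \<or> p = i4 then 1 else 0)" for p
  have h: "hop t l w = E11 l w + E44 l w" for w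
    by (simp only: hop_def sum_22) (simp add: t_def)
  have nz: "l $ i1 + l $ i4 + of_int k \<noteq> 0" for k
    using assms by (metis Ints_minus Ints_of_int eq_neg_iff_add_eq_0)
  have lkh: "lk (hop t l w a b c d) i j = (l $ i1 + l $ i4 + of_int (dgr t a b c d i j)) * lk (w a b c d) i j"
    for w a b c d i j unfolding hop_lookup by (simp add: sum_22 t_def)
  have inj: "v = 0" if "hop t l v = 0" for v
  proof (rule vrm_eqI)
    fix a b c d i j
    have "lk (hop t l v a b c d) i j = 0" unfolding that by simp
    then show "lk (v a b c d) i j = lk ((0 :: vrm) a b c d) i j" using nz by (simp add: lkh)
  qed
  define v where "v = (\<lambda>a b c d. dg (\<lambda>(i, j). 1 / (l $ i1 + l $ i4 + of_int (dgr t a b c d i j))) (w a b c d))"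
  have v: "hop t l v = w"
    by (rule vrm_eqI) (simp add: lkh v_def nz)
  have "hop t l (E14 l v) = E14 l (hop t l v)"
    using hop_Eop[of t l i1 i4 v] by (simp add: t_def)
  then have "E14 l v = 0" using inj v w by metis
  then have "E14 l (yD v) = hop t l v"
    using Eop_comm[of l i1 i4 i4 i1 v] Eop_zero[of l i4 i1] unfolding h by (simp add: add.commute)
  then show "\<exists>p. w = E14 l p" unfolding v by metis
qed

section \<open>Failure of exactness\<close>

lemma not_exI:
  assumes "X u = 0" "\<And>w. u = X w \<Longrightarrow> False"
  shows "\<not> ex_op X"
  using assms unfolding ex_op_def by blast

lemma fvec_finite_bound: "\<exists>N. \<forall>i j. N \<le> i + j \<longrightarrow> lk n i j = 0"
proof -
  let ?S = "(\<lambda>(i, j). i + j) ` Poly_Mapping.keys n"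
  have fin: "finite ?S" by simp
  have "lk n i j = 0" if "Suc (Max (insert 0 ?S)) \<le> i + j" for i j
  proof (rule ccontr)
    assume "lk n i j \<noteq> 0"
    then have "i + j \<in> ?S" by (force simp: in_keys_iff)
    then have "i + j \<le> Max (insert 0 ?S)" using fin by simp
    then show False using that by simp
  qed
  then show ?thesis by blast
qed

text \<open>The diagonal coefficients \<open>(i, i)\<close> of an element of the image satisfy a recursion that cannot
  stop if the coefficient at \<open>(0, 0)\<close> is nonzero.\<close>

lemma not_exact_alpha_delta:
  assumes a: "a \<noteq> 0" and l: "l $ i2 + l $ i3 = 0" "b \<noteq> 0 \<Longrightarrow> l $ i1 + l $ i4 = 0"
  shows "\<not> ex_op (\<lambda>w. scV a (E23 l w) + scV b (E14 l w))"
proof (rule not_exI[where u = "vac fone"])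
  show "scV a (E23 l (vac fone)) + scV b (E14 l (vac fone)) = 0"
    by (simp add: vrm_eq_iff all_bool_eq E_defs yd_defs vac_def)
next
  fix w assume e: "vac fone = scV a (E23 l w) + scV b (E14 l w)"
  define B where "B = w False True False False"
  define C where "C = w False False True False"
  \<comment> \<open>\<open>B\<close> and \<open>C\<close> are the coefficients of the generators of
    \<beta> and \<gamma>. On the diagonal the operators see only this sum, since l3 - l4 = l1 - l2
    when \<open>b\<close> is nonzero; the coefficients of \<alpha> and \<delta> drop out by
    atypicality.\<close>
  define s where "s i = lk B i (Suc i) + lk C (Suc i) i" for i
  have diag: "lk fone i i = a * (case i of 0 \<Rightarrow> 0 | Suc k \<Rightarrow> s k) +
      b * (of_nat (Suc i) * (l $ i1 - l $ i2 - of_nat i) * s i)" for i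
  proof -
    have l3: "l $ i3 = - l $ i2" using l(1) by (simp add: eq_neg_iff_add_eq_0 add.commute)
    have "lk fone i i = lk ((scV a (E23 l w) + scV b (E14 l w)) False False False False) i i"
      unfolding e[symmetric] by simp
    also have "\<dots> = a * (case i of 0 \<Rightarrow> 0 | Suc k \<Rightarrow> s k) +
      b * (of_nat (Suc i) * (l $ i1 - l $ i2 - of_nat i) * s i)"
    proof (cases "b = 0")
      case True
      then show ?thesis
        by (simp add: E_defs yd_defs n_defs lookup_add lookup_minus l3 s_def B_def C_def algebra_simps
            split: nat.split)
    next
      case False
      then have l4: "l $ i4 = - l $ i1" using l(2) by (simp add: eq_neg_iff_add_eq_0 add.commute)
      show ?thesis
        by (simp add: E_defs yd_defs n_defs lookup_add lookup_minus l3 l4 s_def B_def C_def algebra_simps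
            split: nat.split)
    qed
    finally show ?thesis .
  qed
  obtain N where N: "\<And>i. N \<le> i \<Longrightarrow> s i = 0"
  proof -
    obtain N1 where N1: "\<forall>i j. N1 \<le> i + j \<longrightarrow> lk B i j = 0" using fvec_finite_bound by blast
    obtain N2 where N2: "\<forall>i j. N2 \<le> i + j \<longrightarrow> lk C i j = 0" using fvec_finite_bound by blast
    have "s i = 0" if "N1 + N2 \<le> i" for i using N1 N2 that by (simp add: s_def)
    then show ?thesis using that by blast
  qed
  \<comment> \<open>Descending induction from the bound \<open>N\<close>: as \<open>a\<close> is
    nonzero, the equation at \<open>Suc i\<close> expresses \<open>s i\<close> by
    \<open>s (Suc i)\<close>.\<close>
  have "s i = 0" if "N \<le> i + k" for i k
    using that
  proof (induction k arbitrary: i)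
    case 0
    then show ?case using N by simp
  next
    case (Suc k)
    then have "s (Suc i) = 0" by simp
    then show ?case using diag[of "Suc i"] a by simp
  qed
  from this[of 0 N] show False using diag[of 0] by simp
qed

text \<open>The first two equations say that E21^p E43^q applied to the highest weight vector is
  singular for the even part, the third that E11 + E44 kills it. Multiplied by the generators of
  \<alpha>, \<beta>, \<gamma> it is a cycle. In a boundary the same coefficient can come only from
  the product of all four generators, and there it carries the vanishing eigenvalue of E11 +
  E44.\<close>

lemma not_exact_delta:
  assumes "b \<noteq> 0" and pq: "of_nat p * (l $ i1 - l $ i2 - of_nat p + 1) = 0"
      "of_nat q * (l $ i3 - l $ i4 - of_nat q + 1) = 0" "l $ i1 + l $ i4 - of_nat p + of_nat q = 0"
  shows "\<not> ex_op (\<lambda>w. scV b (E14 l w))"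
proof -
  define n :: fvec where "n = Poly_Mapping.single (p, q) 1"
  have n: "nE1 l n = 0" "nE2 l n = 0" "lk n p q = 1"
    using pq by (auto intro!: fvec_eqI simp: n_def n_defs lookup_single when_def)
  let ?u = "yA (yB (yC (vac n)))"
  show ?thesis
  proof (rule not_exI[where u = ?u])
    show "scV b (E14 l ?u) = 0"
      by (simp add: vrm_eq_iff all_bool_eq E_defs yd_defs vac_def n)
  next
    fix w assume e: "?u = scV b (E14 l w)"
    have "lk (?u True True True False) p q \<noteq> 0"
      by (simp add: yd_defs vac_def n)
    moreover have "lk (scV b (E14 l w) True True True False) p q =
        - (b * ((l $ i1 + l $ i4 - of_nat p + of_nat q) * lk (w True True True True) p q))"
      by (simp add: E_defs yd_defs n_defs lookup_add lookup_minus algebra_simps)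
    ultimately show False unfolding e[symmetric] pq(3) by simp
  qed
qed

text \<open>The cycle is the homology class of the exactness proofs. In a boundary its coefficient
  comes from products of the generator of \<alpha> with that of \<beta> or \<gamma>, carrying the
  factors l1 + l3 + 1 and l2 + l4 - 1, and from multiples of the variables, which have no constant
  term.\<close>

lemma not_exact_beta_gamma:
  assumes l: "l $ i1 + l $ i3 + 1 = 0" "l $ i2 + l $ i4 - 1 = 0"
  shows "\<not> ex_op (\<lambda>w. scV b (E13 l w) + scV c (E24 l w))"
proof (rule not_exI[where u = "yA (vac fone)"])
  show "scV b (E13 l (yA (vac fone))) + scV c (E24 l (yA (vac fone))) = 0"
    by (simp add: vrm_eq_iff all_bool_eq E_defs yd_defs vac_def)
next
  fix w assume e: "yA (vac fone) = scV b (E13 l w) + scV c (E24 l w)"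
  have l34: "l $ i3 = - 1 - l $ i1" "l $ i4 = 1 - l $ i2" using l by (simp_all add: algebra_simps eq_neg_iff_add_eq_0)
  have "lk ((scV b (E13 l w) + scV c (E24 l w)) True False False False) 0 0 = 0"
    by (simp add: E_defs yd_defs n_defs lookup_add lookup_minus l34 algebra_simps)
  then show False unfolding e[symmetric] by (simp add: yd_defs vac_def)
qed

text \<open>The functional used here is the invariant pairing of the finite-dimensional quotient of the even
  Verma module, restricted to the degree zero part.\<close>

lemma not_exact_dominant:
  assumes l: "l $ i2 + l $ i3 = 0" "l $ i1 + l $ i4 = 0" "l $ i1 - l $ i2 = of_nat m"
    and bc: "b \<noteq> 0 \<or> c \<noteq> 0"
  shows "\<not> ex_op (\<lambda>w. scV b (E13 l w) + scV c (E24 l w))"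
proof -
  define \<phi> where "\<phi> w = (\<Sum>i\<le>m. (- b) ^ i * c ^ (m - i) * lk (w False False False False) i (m - i))"
    for w :: vrm
  \<comment> \<open>The weight (-b)^k c^(m-k) of the chosen monomial has to be nonzero even if one
    of \<open>b\<close> and \<open>c\<close> is zero.\<close>
  define k where "k = (if b \<noteq> 0 then m else 0)"
  define u where "u = vac (Poly_Mapping.single (k, m - k) 1)"
  have l': "l $ i1 = l $ i2 + of_nat m" "l $ i3 = - l $ i2" "l $ i4 = - l $ i2 - of_nat m"
    using l by (simp_all add: algebra_simps eq_neg_iff_add_eq_0)
  have \<phi>X: "\<phi> (scV b (E13 l w) + scV c (E24 l w)) = 0" for w
  proof -
    define A where "A = w True False False False"
    define D where "D = w False False False True"
    \<comment> \<open>E13 contributes \<open>G (Suc i)\<close> and E24 contributes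
      \<open>G i\<close>, from the coefficients of the generators of \<alpha> and \<delta>; those of
      \<beta> and \<gamma> cancel in total degree \<open>m\<close>, where the diagonal brackets act
      by zero. The weights (-b)^i c^(m-i) make the sum telescope, and \<open>G\<close> vanishes at
      both ends.\<close>
    define G where "G i = of_nat i * (of_nat m + 1 - of_nat i) * lk A i (Suc m - i) +
      (if 0 < i \<and> i \<le> m then lk D (i - 1) (m - i) else 0)" for i
    define \<psi> where "\<psi> i = (- b) ^ i * c ^ (Suc m - i)" for i
    have "\<phi> (scV b (E13 l w) + scV c (E24 l w)) = (\<Sum>i\<le>m. \<psi> i * G i - \<psi> (Suc i) * G (Suc i))"
      unfolding \<phi>_def
    proof (intro sum.cong refl)
      fix i assume "i \<in> {..m}"
      then obtain j where m: "m = i + j" by (metis atMost_iff le_Suc_ex)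
      have "lk ((scV b (E13 l w) + scV c (E24 l w)) False False False False) i j = b * G (Suc i) + c * G i"
        unfolding m by (cases i; cases j)
          (simp_all add: E_defs yd_defs n_defs lookup_add lookup_minus l' G_def A_def D_def m algebra_simps)
      moreover have "\<psi> i = (- b) ^ i * c ^ j * c" "\<psi> (Suc i) = (- b) ^ i * c ^ j * (- b)"
        by (simp_all add: \<psi>_def m Suc_diff_le)
      ultimately show "(- b) ^ i * c ^ (m - i) *
          lk ((scV b (E13 l w) + scV c (E24 l w)) False False False False) i (m - i) =
          \<psi> i * G i - \<psi> (Suc i) * G (Suc i)"
        by (simp add: m algebra_simps)
    qed
    also have "\<dots> = \<psi> 0 * G 0 - \<psi> (Suc m) * G (Suc m)" by (rule sum_telescope)
    also have "\<dots> = 0" by (simp add: G_def)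
    finally show ?thesis .
  qed
  have \<phi>u: "\<phi> u \<noteq> 0"
  proof -
    have k: "k \<le> m" by (simp add: k_def)
    have "\<phi> u = (\<Sum>i\<le>m. if i = k then (- b) ^ i * c ^ (m - i) else 0)"
      unfolding \<phi>_def by (intro sum.cong refl) (auto simp: u_def lookup_single when_def)
    also have "\<dots> = (- b) ^ k * c ^ (m - k)" using k by simp
    finally show ?thesis using bc by (auto simp: k_def)
  qed
  show ?thesis
  proof (rule not_exI[where u = u])
    show "scV b (E13 l u) + scV c (E24 l u) = 0"
      by (simp add: vrm_eq_iff all_bool_eq E_defs yd_defs vac_def u_def)
    show False if "u = scV b (E13 l w) + scV c (E24 l w)" for w
      using \<phi>u \<phi>X[of w] that by simp
  qed
qed

section \<open>Roots\<close>

definition lroot :: "2 + 2 \<Rightarrow> 2 + 2 \<Rightarrow> weight" where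
  "lroot p q = axis p 1 - axis q 1"

lemma lroot_entry: "lroot p q $ k = (if k = p then 1 else 0) - (if k = q then 1 else 0)"
  by (simp add: lroot_def axis_def)

lemma named_roots:
  "r_alpha = lroot i2 i3" "r_beta = lroot i1 i3" "r_gamma = lroot i2 i4" "r_delta = lroot i1 i4"
  by (simp_all add: lroot_def r_alpha_def r_beta_def r_gamma_def r_delta_def eps_def dlt_def)

lemma wform_22: "wform l m = l $ i1 * m $ i1 + l $ i2 * m $ i2 - l $ i3 * m $ i3 - l $ i4 * m $ i4"
  by (simp add: wform_def sum_22)

lemma cartan_sbracket:
  assumes "h \<in> cartan"
  shows "sbracket h x $ p $ q = (h $ p $ p - h $ q $ q) * x $ p $ q"
proof -
  have h0: "h \<in> grade 0"
    unfolding grade_iff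
  proof (intro allI impI)
    fix i j assume "(par i + par j) mod 2 \<noteq> 0"
    then have "i \<noteq> j" by (metis mult_2 mod_mult_self1_is_0)
    then show "h $ i $ j = 0" using assms by (simp add: cartan_def)
  qed
  have br: "sbracket h x = h ** (proj 0 x + proj 1 x) - (proj 0 x + proj 1 x) ** h"
    unfolding sbracket_def numeral_2_eq_2 lessThan_Suc proj_grade[OF h0] matrix_add_diff
    by (simp add: algebra_simps)
  have px: "proj 0 x + proj 1 x = x"
    by (auto simp: proj_def vec_eq_iff)
  have "sbracket h x $ p $ q = (\<Sum>k\<in>UNIV. h $ p $ k * x $ k $ q) - (\<Sum>k\<in>UNIV. x $ p $ k * h $ k $ q)"
    unfolding br px by (simp add: matrix_matrix_mult_def)
  also have "(\<Sum>k\<in>UNIV. h $ p $ k * x $ k $ q) = (\<Sum>k\<in>UNIV. if k = p then h $ p $ p * x $ p $ q else 0)"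
    by (intro sum.cong refl) (use assms in \<open>auto simp: cartan_def\<close>)
  also have "(\<Sum>k\<in>UNIV. x $ p $ k * h $ k $ q) = (\<Sum>k\<in>UNIV. if k = q then x $ p $ q * h $ q $ q else 0)"
    by (intro sum.cong refl) (use assms in \<open>auto simp: cartan_def\<close>)
  finally show ?thesis by (simp add: algebra_simps)
qed

text \<open>Testing against the diagonal unit at \<open>k\<close> reads off the coordinate
  \<open>a $ k\<close> from any nonzero entry.\<close>

lemma root_space_entry:
  assumes x: "x \<in> root_space a" and "x $ p $ q \<noteq> 0"
  shows "a = lroot p q"
  unfolding vec_eq_iff
proof
  fix k
  have k: "munit k k \<in> cartan" by (auto simp: cartan_def)
  have "sbracket (munit k k) x = cscale (wt_eval a (munit k k)) x"
    using x k by (auto simp: root_space_def)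
  then have "sbracket (munit k k) x $ p $ q = wt_eval a (munit k k) * x $ p $ q"
    by (simp add: cscale_def)
  then have "munit k k $ p $ p - munit k k $ q $ q = wt_eval a (munit k k)"
    unfolding cartan_sbracket[OF k] using assms(2) by simp
  moreover have "wt_eval a (munit k k) = a $ k"
  proof -
    have "a $ i * munit k k $ i $ i = (if i = k then a $ k else 0)" for i by simp
    then show ?thesis unfolding wt_eval_def by simp
  qed
  ultimately show "a $ k = lroot p q $ k" by (auto simp: lroot_entry)
qed

lemma munit_root_space: "munit p q \<in> root_space (lroot p q)"
proof -
  have "sbracket h (munit p q) = cscale (wt_eval (lroot p q) h) (munit p q)" if h: "h \<in> cartan" for h
  proof -
    have "lroot p q $ i * h $ i $ i = (if i = p then h $ p $ p else 0) - (if i = q then h $ q $ q else 0)" for i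
      by (auto simp: lroot_entry)
    then have "wt_eval (lroot p q) h = h $ p $ p - h $ q $ q"
      unfolding wt_eval_def by (simp add: sum_subtractf)
    then show ?thesis
      by (auto simp: vec_eq_iff cartan_sbracket[OF h] cscale_def)
  qed
  then show ?thesis by (simp add: root_space_def)
qed

lemma lroot_inj: "p \<noteq> q \<Longrightarrow> lroot r s = lroot p q \<longleftrightarrow> r = p \<and> s = q"
proof
  assume pq: "p \<noteq> q" and e: "lroot r s = lroot p q"
  have "lroot r s $ k = lroot p q $ k" for k using e by simp
  from this[of p] this[of q] this[of r] this[of s] show "r = p \<and> s = q"
    using pq by (auto simp: lroot_entry split: if_splits)
qed simp

lemma root_space_root:
  assumes "p \<noteq> q" "x \<in> root_space (lroot p q)"
  shows "x = cscale (x $ p $ q) (munit p q)"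
proof -
  have "x $ r $ s = 0" if "\<not> (r = p \<and> s = q)" for r s
    using root_space_entry[OF assms(2), of r s] lroot_inj[OF assms(1), of r s] that by metis
  then show ?thesis by (auto simp: vec_eq_iff cscale_def)
qed

lemma graded_roots:
  "{a. a \<noteq> 0 \<and> root_space a \<inter> grade r \<noteq> {0}} = {lroot p q | p q. p \<noteq> q \<and> (par p + par q) mod 2 = r}"
proof (intro equalityI subsetI)
  fix a assume a: "a \<in> {a. a \<noteq> 0 \<and> root_space a \<inter> grade r \<noteq> {0}}"
  have "0 \<in> root_space a \<inter> grade r"
    by (auto simp: root_space_def grade_iff vec_eq_iff cartan_sbracket cscale_def)
  then obtain x where x: "x \<in> root_space a" "x \<in> grade r" "x \<noteq> 0" using a by blast
  then obtain p q where pq: "x $ p $ q \<noteq> 0" by (auto simp: vec_eq_iff)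
  have "a = lroot p q" by (rule root_space_entry[OF x(1) pq])
  moreover have "p \<noteq> q" using a \<open>a = lroot p q\<close> by (auto simp: lroot_def)
  ultimately show "a \<in> {lroot p q | p q. p \<noteq> q \<and> (par p + par q) mod 2 = r}"
    using grade_entry[OF x(2) pq] by blast
next
  fix a assume "a \<in> {lroot p q | p q. p \<noteq> q \<and> (par p + par q) mod 2 = r}"
  then obtain p q where a: "a = lroot p q" "p \<noteq> q" "(par p + par q) mod 2 = r" by blast
  have "munit p q \<in> root_space a \<inter> grade r"
    using munit_root_space[of p q] munit_grade[of p q] a by simp
  moreover have "munit p q \<noteq> 0" by (auto simp: vec_eq_iff)
  moreover have "a \<noteq> 0"
  proof -
    have "a $ p = 1" using a by (simp add: lroot_entry)
    then show ?thesis by auto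
  qed
  ultimately show "a \<in> {a. a \<noteq> 0 \<and> root_space a \<inter> grade r \<noteq> {0}}" by auto
qed

lemma even_roots_eq: "even_roots = {lroot p q | p q. p \<noteq> q \<and> par p = par q}"
proof -
  have "(par p + par q) mod 2 = 0 \<longleftrightarrow> par p = par q" for p q
    using par_cases[of p] par_cases[of q] by auto
  then show ?thesis unfolding even_roots_def graded_roots by simp
qed

lemma odd_roots_eq: "odd_roots = {lroot p q | p q. par p \<noteq> par q}"
proof -
  have "p \<noteq> q \<and> (par p + par q) mod 2 = 1 \<longleftrightarrow> par p \<noteq> par q" for p q
    using par_cases[of p] par_cases[of q] by auto
  then show ?thesis unfolding odd_roots_def graded_roots by simp
qed

lemma odd_named: "r_alpha \<in> odd_roots" "r_beta \<in> odd_roots" "r_gamma \<in> odd_roots" "r_delta \<in> odd_roots"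
proof -
  have "lroot p q \<in> odd_roots" if "par p \<noteq> par q" for p q
    using that unfolding odd_roots_eq by blast
  then show "r_alpha \<in> odd_roots" "r_beta \<in> odd_roots" "r_gamma \<in> odd_roots" "r_delta \<in> odd_roots"
    unfolding named_roots by simp_all
qed

lemma pos_odd_roots_eq: "pos_odd_roots = {r_alpha, r_beta, r_gamma, r_delta}"
proof -
  have ex_2: "(\<exists>i :: 2. P i) \<longleftrightarrow> P 1 \<or> P 2" for P by (metis exhaust_2)
  have "(\<exists>i j. a = eps i - dlt j) \<longleftrightarrow> a \<in> {r_alpha, r_beta, r_gamma, r_delta}" for a
    by (simp add: r_alpha_def r_beta_def r_gamma_def r_delta_def ex_2) blast
  then show ?thesis unfolding pos_odd_roots_def by blast
qed

lemma roots_distinct: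
  "r_alpha \<noteq> r_beta" "r_alpha \<noteq> r_gamma" "r_alpha \<noteq> r_delta"
  "r_beta \<noteq> r_gamma" "r_beta \<noteq> r_delta" "r_gamma \<noteq> r_delta"
  unfolding named_roots by (simp_all add: lroot_inj)

lemma rho_entries: "rho $ i1 = - 1 / 2" "rho $ i2 = - 3 / 2" "rho $ i3 = 3 / 2" "rho $ i4 = 1 / 2"
proof -
  have d: "eps 1 - eps 2 \<noteq> dlt 1 - dlt 2"
    by (auto simp: vec_eq_iff eps_def dlt_def axis_def all_22)
  have e: "\<Sum>pos_even_roots = eps 1 - eps 2 + (dlt 1 - dlt 2)"
    using d by (simp add: pos_even_roots_def)
  have o: "\<Sum>pos_odd_roots = r_alpha + (r_beta + (r_gamma + r_delta))"
    unfolding pos_odd_roots_eq using roots_distinct by simp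
  show "rho $ i1 = - 1 / 2" "rho $ i2 = - 3 / 2" "rho $ i3 = 3 / 2" "rho $ i4 = 1 / 2"
    unfolding rho_def e o named_roots by (simp_all add: lroot_entry eps_def dlt_def axis_def)
qed

lemma wform_named:
  "wform l r_alpha = l $ i2 + l $ i3" "wform l r_beta = l $ i1 + l $ i3"
  "wform l r_gamma = l $ i2 + l $ i4" "wform l r_delta = l $ i1 + l $ i4"
  unfolding named_roots wform_22 by (simp_all add: lroot_entry)

lemma atyp_iff:
  "r_alpha \<in> atyp_roots l \<longleftrightarrow> l $ i2 + l $ i3 = 0" "r_beta \<in> atyp_roots l \<longleftrightarrow> l $ i1 + l $ i3 + 1 = 0"
  "r_gamma \<in> atyp_roots l \<longleftrightarrow> l $ i2 + l $ i4 - 1 = 0" "r_delta \<in> atyp_roots l \<longleftrightarrow> l $ i1 + l $ i4 = 0"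
  unfolding atyp_roots_def pos_odd_roots_eq mem_Collect_eq wform_named vector_add_component rho_entries
  by (simp_all add: algebra_simps)

text \<open>The negative odd roots are excluded by their free action on the Verma module, so that only the
  following seven sets can occur.\<close>

abbreviation candidates :: "weight set set" where
  "candidates \<equiv> {{}, {r_alpha}, {r_beta}, {r_gamma}, {r_delta}, {r_alpha, r_delta}, {r_beta, r_gamma}}"

lemma mut_orth_insert: "mut_orth (insert a S) \<longleftrightarrow> mut_orth S \<and> (\<forall>b\<in>S. b \<noteq> a \<longrightarrow> wform a b = 0 \<and> wform b a = 0)"
  unfolding mut_orth_def pairwise_insert by blast

lemma mut_orth_empty: "mut_orth {}"
  by (simp add: mut_orth_def)

lemma wform_named_named:
  "wform r_alpha r_beta \<noteq> 0" "wform r_alpha r_gamma \<noteq> 0" "wform r_beta r_delta \<noteq> 0" "wform r_gamma r_delta \<noteq> 0"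
  "wform r_alpha r_delta = 0" "wform r_delta r_alpha = 0" "wform r_beta r_gamma = 0" "wform r_gamma r_beta = 0"
  "wform r_alpha r_alpha = 0" "wform r_beta r_beta = 0" "wform r_gamma r_gamma = 0" "wform r_delta r_delta = 0"
  unfolding wform_named unfolding named_roots by (simp_all add: lroot_entry)

text \<open>Distinct positive odd roots are orthogonal exactly when they share no index, which
  leaves the pairs {\<alpha>, \<delta>} and {\<beta>, \<gamma>}.\<close>

lemma orth_subsets: "{S. S \<subseteq> {r_alpha, r_beta, r_gamma, r_delta} \<and> mut_orth S} = candidates"
proof (intro equalityI subsetI)
  fix S assume "S \<in> {S. S \<subseteq> {r_alpha, r_beta, r_gamma, r_delta} \<and> mut_orth S}"
  then have sub: "S \<subseteq> {r_alpha, r_beta, r_gamma, r_delta}" and o: "mut_orth S" by auto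
  have w: "wform a b = 0" if "a \<in> S" "b \<in> S" "a \<noteq> b" for a b
    using o that unfolding mut_orth_def pairwise_def by blast
  have "\<not> (r_alpha \<in> S \<and> r_beta \<in> S)" "\<not> (r_alpha \<in> S \<and> r_gamma \<in> S)"
    "\<not> (r_beta \<in> S \<and> r_delta \<in> S)" "\<not> (r_gamma \<in> S \<and> r_delta \<in> S)"
    using w wform_named_named roots_distinct by blast+
  then show "S \<in> candidates" using sub by blast
next
  fix S assume "S \<in> candidates"
  then show "S \<in> {S. S \<subseteq> {r_alpha, r_beta, r_gamma, r_delta} \<and> mut_orth S}"
    by (elim insertE) (auto simp: mut_orth_insert mut_orth_empty wform_named_named)
qed

lemma candidates_S_sets:
  assumes "S \<in> candidates" shows "S \<in> S_sets"
proof -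
  have S: "S \<subseteq> {r_alpha, r_beta, r_gamma, r_delta}" "mut_orth S"
    using assms unfolding orth_subsets[symmetric] by auto
  have odd: "{r_alpha, r_beta, r_gamma, r_delta} \<subseteq> {a \<in> odd_roots. wform a a = 0}"
    using odd_named wform_named_named by simp
  have nz: "r_alpha \<noteq> 0" "r_beta \<noteq> 0" "r_gamma \<noteq> 0" "r_delta \<noteq> 0"
    unfolding named_roots by (auto simp: vec_eq_iff lroot_entry)
  have "r_alpha \<noteq> k *s r_delta" "r_beta \<noteq> k *s r_gamma" for k
  proof -
    have "(r_alpha - k *s r_delta) $ i2 = 1" "(r_beta - k *s r_gamma) $ i1 = 1"
      by (simp_all add: named_roots lroot_entry)
    then show "r_alpha \<noteq> k *s r_delta" "r_beta \<noteq> k *s r_gamma"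
      by (metis diff_self zero_index zero_neq_one)+
  qed
  then have "vec.independent S"
    using assms nz by (elim insertE) (auto simp: vec.independent_insert vec.span_singleton vec.independent_empty)
  then show ?thesis using S odd unfolding S_sets_def by blast
qed

section \<open>Membership in the sets S(lambda)\<close>

lemma mat_1_borel_group: "mat 1 \<in> borel_group" and matrix_inv_mat_1: "matrix_inv (mat 1 :: gl22) = mat 1"
proof -
  have "mat 1 \<in> borel_alg" by (simp add: borel_iff mat_def)
  moreover have "mat 1 \<in> grade 0" by (simp add: grade_iff all_22 mat_def)
  moreover have "invertible (mat 1 :: gl22)" unfolding invertible_def using matrix_mul_lid by blast
  ultimately show 1: "mat 1 \<in> borel_group" by (simp add: borel_group_def)
  show "matrix_inv (mat 1 :: gl22) = mat 1"
    using borel_group_inv(3)[OF 1] unfolding matrix_mul_lid .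
qed

text \<open>By \<open>X_mod_Ad\<close> the whole orbit lies in the set as soon as its base point
  does; the identity matrix gives the converse.\<close>

lemma S_of_iff:
  "S \<in> S_of l \<longleftrightarrow> S \<in> S_sets \<and>
    (\<forall>x. (\<forall>a\<in>S. x a \<in> root_space a \<and> x a \<noteq> 0) \<longrightarrow> (\<Sum>a\<in>S. x a) \<in> X_mod (verma l) (verma_act l))"
proof -
  have "Phi S \<subseteq> X_mod (verma l) (verma_act l) \<longleftrightarrow>
    (\<forall>x. (\<forall>a\<in>S. x a \<in> root_space a \<and> x a \<noteq> 0) \<longrightarrow> (\<Sum>a\<in>S. x a) \<in> X_mod (verma l) (verma_act l))"
  proof (intro iffI allI impI subsetI)
    fix x assume sub: "Phi S \<subseteq> X_mod (verma l) (verma_act l)" and x: "\<forall>a\<in>S. x a \<in> root_space a \<and> x a \<noteq> 0"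
    have "mat 1 ** (\<Sum>a\<in>S. x a) ** matrix_inv (mat 1) \<in> Phi S"
      unfolding Phi_def using x mat_1_borel_group by blast
    then show "(\<Sum>a\<in>S. x a) \<in> X_mod (verma l) (verma_act l)"
      using sub unfolding matrix_inv_mat_1 matrix_mul_lid matrix_mul_rid by blast
  next
    fix y assume all: "\<forall>x. (\<forall>a\<in>S. x a \<in> root_space a \<and> x a \<noteq> 0) \<longrightarrow>
      (\<Sum>a\<in>S. x a) \<in> X_mod (verma l) (verma_act l)" and "y \<in> Phi S"
    then obtain g x where g: "y = Ad g (\<Sum>a\<in>S. x a)" "g \<in> borel_group"
      "\<forall>a\<in>S. x a \<in> root_space a \<and> x a \<noteq> 0"
      unfolding Phi_def Ad_def by blast
    have "(\<Sum>a\<in>S. x a) \<in> X_mod (verma l) (verma_act l)" using all g(3) by blast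
    then show "y \<in> X_mod (verma l) (verma_act l)" unfolding g(1) by (rule X_mod_Ad[OF g(2)])
  qed
  then show ?thesis by (simp add: S_of_def)
qed

lemma S_of_sum:
  assumes "S \<in> S_of l" "\<And>a. a \<in> S \<Longrightarrow> x a \<in> root_space a \<and> x a \<noteq> 0"
  shows "(\<Sum>a\<in>S. x a) \<in> X_mod (verma l) (verma_act l)"
  using assms unfolding S_of_iff by blast

text \<open>Such a matrix lives in the upper right block, where all products vanish.\<close>

lemma X_cone_upper:
  assumes "\<And>i j. x $ i $ j \<noteq> 0 \<Longrightarrow> par i = 0 \<and> par j = 1"
  shows "x \<in> X_cone"
proof -
  have x: "x \<in> grade 1"
    unfolding grade_iff
  proof (intro allI impI)
    fix i j assume "(par i + par j) mod 2 \<noteq> 1"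
    then have "\<not> (par i = 0 \<and> par j = 1)" by auto
    then show "x $ i $ j = 0" using assms[of i j] by blast
  qed
  have "x $ i $ k * x $ k $ j = 0" for i j k
    using assms[of i k] assms[of k j] by (metis mult_eq_0_iff zero_neq_one)
  then have "(x ** x) $ i $ j = 0" for i j
    unfolding matrix_matrix_mult_def vec_lambda_beta by (intro sum.neutral ballI)
  then have "x ** x = 0" by (simp add: vec_eq_iff)
  then have "sbracket x x = 0"
    using sbracket_grade[of 1 1 x x] x by simp
  then show ?thesis using x by (simp add: X_cone_def)
qed

lemma exact_at_iff: "exact_at l x \<longleftrightarrow> ex_op (rep l x)"
  by (simp only: exact_at_def ex_op_def)

lemma rep_cscale: "rep l (cscale c x) w = scV c (rep l x w)"
  by (simp only: rep_def cscale_def vec_lambda_beta V.scale_sum_right V.scale_scale)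

lemma rep_plus: "rep l (x + y) w = rep l x w + rep l y w"
  by (simp only: rep_def vector_add_component V.scale_left_distrib sum.distrib)

lemma root_vector:
  assumes "p \<noteq> q" "x \<in> root_space (lroot p q)" "x \<noteq> 0"
  obtains c where "c \<noteq> 0" "x = cscale c (munit p q)"
proof
  show e: "x = cscale (x $ p $ q) (munit p q)" by (rule root_space_root[OF assms(1,2)])
  show "x $ p $ q \<noteq> 0"
  proof
    assume "x $ p $ q = 0"
    then have "x = cscale 0 (munit p q)" using e by metis
    then show False using assms(3) by (simp add: cscale_def vec_eq_iff)
  qed
qed

lemma S_of_empty: "{} \<in> S_of l"
proof -
  have "\<not> exact_at l 0"
  proof
    assume ex: "exact_at l 0"
    have z: "rep l 0 w = 0" for w using rep_cscale[of l 0 0 w] by (simp add: cscale_def rep_def)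
    obtain v where "vac fone = rep l 0 v" using ex z unfolding exact_at_def by blast
    then have "lk (vac fone False False False False) 0 0 = 0" unfolding z by simp
    then show False by simp
  qed
  moreover have "0 \<in> X_cone" by (rule X_cone_upper) simp
  ultimately show ?thesis
    using candidates_S_sets[of "{}"] by (simp add: S_of_iff X_mod_verma)
qed

section \<open>From exactness of operators to single roots and pairs\<close>

lemma S_of_single:
  assumes S: "{lroot p q} \<in> candidates" and p: "par p = 0" "par q = 1"
    and ne: "\<And>c. c \<noteq> 0 \<Longrightarrow> \<not> ex_op (\<lambda>w. scV c (Eop l p q w))"
  shows "{lroot p q} \<in> S_of l"
  unfolding S_of_iff
proof (intro conjI allI impI)
  fix x assume x: "\<forall>a\<in>{lroot p q}. x a \<in> root_space a \<and> x a \<noteq> 0"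
  have pq: "p \<noteq> q" using p by auto
  obtain c where c: "c \<noteq> 0" "x (lroot p q) = cscale c (munit p q)"
    using root_vector[OF pq, of "x (lroot p q)"] x by blast
  have "cscale c (munit p q) \<in> X_cone"
    by (rule X_cone_upper) (use p in \<open>auto simp: cscale_def split: if_splits\<close>)
  moreover have "\<not> exact_at l (cscale c (munit p q))"
    using ne[OF c(1)] unfolding exact_at_iff rep_cscale[abs_def] rep_munit .
  ultimately show "(\<Sum>a\<in>{lroot p q}. x a) \<in> X_mod (verma l) (verma_act l)"
    using c(2) by (simp add: X_mod_verma)
qed (rule candidates_S_sets[OF S])

lemma S_of_pair:
  assumes S: "{lroot p q, lroot r s} \<in> candidates" and p: "par p = 0" "par q = 1" "par r = 0" "par s = 1"
    and d: "p \<noteq> r"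
    and ne: "\<And>c d. c \<noteq> 0 \<Longrightarrow> d \<noteq> 0 \<Longrightarrow> \<not> ex_op (\<lambda>w. scV c (Eop l p q w) + scV d (Eop l r s w))"
  shows "{lroot p q, lroot r s} \<in> S_of l"
  unfolding S_of_iff
proof (intro conjI allI impI)
  fix x assume x: "\<forall>a\<in>{lroot p q, lroot r s}. x a \<in> root_space a \<and> x a \<noteq> 0"
  have pq: "p \<noteq> q" "r \<noteq> s" using p by auto
  obtain c where c: "c \<noteq> 0" "x (lroot p q) = cscale c (munit p q)"
    using root_vector[OF pq(1), of "x (lroot p q)"] x by blast
  obtain e where e: "e \<noteq> 0" "x (lroot r s) = cscale e (munit r s)"
    using root_vector[OF pq(2), of "x (lroot r s)"] x by blast
  let ?x = "cscale c (munit p q) + cscale e (munit r s)"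
  have "?x \<in> X_cone"
    by (rule X_cone_upper) (use p in \<open>auto simp: cscale_def split: if_splits\<close>)
  moreover have "\<not> exact_at l ?x"
    using ne[OF c(1) e(1)] unfolding exact_at_iff rep_plus[abs_def] rep_cscale[abs_def] rep_munit .
  moreover have "lroot p q \<noteq> lroot r s" using lroot_inj[OF pq(2)] d by simp
  ultimately show "(\<Sum>a\<in>{lroot p q, lroot r s}. x a) \<in> X_mod (verma l) (verma_act l)"
    using c(2) e(2) by (simp add: X_mod_verma)
qed (rule candidates_S_sets[OF S])

lemma munit_root_vector: "munit p q \<noteq> 0"
  by (auto simp: vec_eq_iff)

lemma not_S_of_single:
  assumes "p \<noteq> q" "ex_op (Eop l p q)"
  shows "{lroot p q} \<notin> S_of l"
proof
  assume "{lroot p q} \<in> S_of l"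
  then have "(\<Sum>a\<in>{lroot p q}. munit p q) \<in> X_mod (verma l) (verma_act l)"
    by (rule S_of_sum) (simp add: munit_root_space munit_root_vector)
  then have "\<not> exact_at l (munit p q)" by (simp add: X_mod_verma)
  then show False using assms(2) unfolding exact_at_iff rep_munit[abs_def] by blast
qed

text \<open>The conditions on \<open>t\<close> keep E21 and E43 from raising the degree, so only the
  four odd generators can do so and the grading is bounded above. Exactness of the operator of
  smaller degree then passes to the sum.\<close>

lemma not_S_of_pair:
  fixes t :: "2 + 2 \<Rightarrow> int"
  assumes d: "p \<noteq> q" "r \<noteq> s" "\<not> (p = r \<and> q = s)"
    and less: "t p - t q < t r - t s" and t: "t i2 \<le> t i1" "t i4 \<le> t i3"
    and ex: "ex_op (Eop l p q)"
  shows "{lroot p q, lroot r s} \<notin> S_of l"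
proof
  assume S: "{lroot p q, lroot r s} \<in> S_of l"
  have ne: "lroot p q \<noteq> lroot r s" using lroot_inj[OF d(2)] d(3) by blast
  define x where "x a = (if a = lroot p q then munit p q else munit r s)" for a
  have "(\<Sum>a\<in>{lroot p q, lroot r s}. x a) \<in> X_mod (verma l) (verma_act l)"
    using S by (rule S_of_sum) (use ne in \<open>auto simp: x_def munit_root_space munit_root_vector\<close>)
  moreover have "(\<Sum>a\<in>{lroot p q, lroot r s}. x a) = munit p q + munit r s"
    using ne by (simp add: x_def)
  ultimately have x: "munit p q + munit r s \<in> X_cone" "\<not> exact_at l (munit p q + munit r s)"
    by (simp_all add: X_mod_verma)
  let ?K = "\<bar>t i3 - t i2\<bar> + \<bar>t i3 - t i1\<bar> + \<bar>t i4 - t i2\<bar> + \<bar>t i4 - t i1\<bar>"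
  have "ex_op (rep l (munit p q + munit r s))"
  proof (rule filtered_exact[where t = t and \<mu> = 1 and \<nu> = 1 and K = ?K and p = p and q = q and r = r and s = s])
    show "rep l (munit p q + munit r s) w = scV 1 (Eop l p q w) + scV 1 (Eop l r s w)" for w
      by (simp only: rep_plus rep_munit V.scale_one)
    show "rep l (munit p q + munit r s) (rep l (munit p q + munit r s) w) = 0" for w
      by (rule rep_square[OF x(1)])
    show "dgr t a b c d i j \<le> ?K" for a b c d i j
    proof -
      have "int i * (t i2 - t i1) \<le> 0" "int j * (t i4 - t i3) \<le> 0"
        using t by (simp_all add: mult_nonneg_nonpos)
      moreover have "of_bool e * z \<le> \<bar>z\<bar>" for e and z :: int by (cases e) auto
      ultimately show ?thesis unfolding dgr_def by (smt (verit))
    qed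
  qed (use less ex in auto)
  then show False using x(2) unfolding exact_at_iff by blast
qed

section \<open>Sets containing a negative odd root\<close>

lemma ex_op_negative: "par q = 1 \<Longrightarrow> par p = 0 \<Longrightarrow> ex_op (Eop l q p)"
proof -
  have "\<forall>q p. par q = 1 \<longrightarrow> par p = 0 \<longrightarrow> ex_op (Eop l q p)"
    using ex_y by (simp add: all_22)
  then show "par q = 1 \<Longrightarrow> par p = 0 \<Longrightarrow> ex_op (Eop l q p)" by blast
qed

lemma orthogonal_to_negative:
  assumes "par q = 1" "par p = 0" "par u \<noteq> par v" "wform (lroot q p) (lroot u v) = 0"
  shows "u = q \<and> v = p \<or> u = p \<and> v = q \<or> {u, v} = UNIV - {p, q}"
proof -
  have "\<forall>p q u v. par q = 1 \<longrightarrow> par p = 0 \<longrightarrow> par u \<noteq> par v \<longrightarrow> wform (lroot q p) (lroot u v) = 0 \<longrightarrow>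
    u = q \<and> v = p \<or> u = p \<and> v = q \<or> {u, v} = UNIV - {p, q}"
    unfolding UNIV_22 wform_22 by (simp add: all_22 lroot_entry) auto
  then show ?thesis using assms by blast
qed

lemma independent_no_neg:
  assumes "vec.independent S" "lroot p q \<in> S" "lroot q p \<in> S"
  shows "p = q"
proof (rule ccontr)
  assume "p \<noteq> q"
  have "lroot q p = (- 1) *s lroot p q" by (simp add: vec_eq_iff lroot_entry)
  then have "lroot q p \<in> vec.span {lroot p q}" by (metis vec.span_singleton rangeI)
  moreover have "lroot q p \<noteq> lroot p q" using lroot_inj[OF \<open>p \<noteq> q\<close>, of q p] \<open>p \<noteq> q\<close> by auto
  ultimately have "lroot q p \<in> vec.span (S - {lroot q p})"
    using assms(2) vec.span_mono[of "{lroot p q}" "S - {lroot q p}"] by blast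
  then show False using assms(1,3) unfolding vec.dependent_def by blast
qed

text \<open>Orthogonality confines any further root to the two remaining indices or to the opposite
  root, and independence forbids opposite pairs; so \<open>S\<close> has at most two elements. A
  negative root vector, which is exact, is made the part of lower degree.\<close>

lemma S_of_negative:
  assumes S: "S \<in> S_sets" and q: "par q = 1" and p: "par p = 0" and a: "lroot q p \<in> S"
  shows "S \<notin> S_of l"
proof -
  have odd: "S \<subseteq> odd_roots" and o: "mut_orth S" and ind: "vec.independent S"
    using S by (auto simp: S_sets_def)
  have qp: "q \<noteq> p" using p q by auto
  have b: "\<exists>u v. b = lroot u v \<and> par u \<noteq> par v \<and> {u, v} = UNIV - {p, q}" if bS: "b \<in> S" "b \<noteq> lroot q p" for b
  proof -
    obtain u v where uv: "b = lroot u v" "par u \<noteq> par v" using bS(1) odd odd_roots_eq by blast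
    have "wform (lroot q p) (lroot u v) = 0"
      using o a bS uv(1) unfolding mut_orth_def pairwise_def by metis
    then consider "u = q \<and> v = p" | "u = p \<and> v = q" | "{u, v} = UNIV - {p, q}"
      using orthogonal_to_negative[OF q p uv(2)] by blast
    then show ?thesis
    proof cases
      case 2
      then show ?thesis using independent_no_neg[OF ind, of q p] a bS uv(1) qp by blast
    qed (use bS uv in auto)
  qed
  show ?thesis
  proof (cases "S = {lroot q p}")
    case True
    then show ?thesis using not_S_of_single[OF qp ex_op_negative[OF q p]] by simp
  next
    case False
    then obtain b0 where b0: "b0 \<in> S" "b0 \<noteq> lroot q p" using a by blast
    then obtain u v where uv: "b0 = lroot u v" "par u \<noteq> par v" "{u, v} = UNIV - {p, q}"
      using b[OF b0] by blast
    have "c = b0" if cS: "c \<in> S" "c \<noteq> lroot q p" for c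
    proof (rule ccontr)
      assume "c \<noteq> b0"
      obtain u' v' where c: "c = lroot u' v'" "{u', v'} = UNIV - {p, q}" using b[OF cS] by blast
      then have "{u', v'} = {u, v}" using uv(3) by simp
      then have "c = lroot v u" using c(1) uv(1) \<open>c \<noteq> b0\<close> by (metis doubleton_eq_iff)
      then show False using independent_no_neg[OF ind, of u v] cS(1) b0(1) uv(1,2) by auto
    qed
    then have Seq: "S = {lroot q p, lroot u v}" using a b0 uv(1) by blast
    have ne: "\<not> (q = u \<and> p = v)" using b0(2) uv(1) by blast
    have uv': "u \<noteq> v" using uv(2) by auto
    show ?thesis
    proof (cases "par u = 0")
      case True
      then have v: "par v = 1" using uv(2) par_cases[of v] by auto
      \<comment> \<open>Grading by parity: the negative root vector has degree -1, the positive one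
        degree 1.\<close>
      show ?thesis unfolding Seq
        by (rule not_S_of_pair[where t = "\<lambda>k. 1 - int (par k)"])
           (use qp uv' ne True v p q ex_op_negative[OF q p] in auto)
    next
      case False
      then have u: "par u = 1" and v: "par v = 0" using uv(2) par_cases[of u] par_cases[of v] by auto
      have "p \<noteq> v" using uv(3) by blast
      then have pv: "p = i1 \<and> v = i2 \<or> p = i2 \<and> v = i1"
      proof -
        have "\<forall>p v. par p = 0 \<longrightarrow> par v = 0 \<longrightarrow> p \<noteq> v \<longrightarrow> p = i1 \<and> v = i2 \<or> p = i2 \<and> v = i1"
          by (simp add: all_22)
        then show ?thesis using p v \<open>p \<noteq> v\<close> by blast
      qed
      \<comment> \<open>Both roots are negative and use different even indices: the one with the
        first even index gets degree -1, the other 0.\<close>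
      let ?t = "\<lambda>k :: 2 + 2. if k = i1 then 1 else 0 :: int"
      have t: "?t q = 0" "?t u = 0" using q u by auto
      from pv show ?thesis
      proof
        assume "p = i1 \<and> v = i2"
        then show ?thesis unfolding Seq
          by (intro not_S_of_pair[where t = ?t]) (use qp uv' ne t ex_op_negative[OF q p] in auto)
      next
        assume pv: "p = i2 \<and> v = i1"
        have "{lroot u v, lroot q p} \<notin> S_of l"
          by (rule not_S_of_pair[where t = ?t]) (use qp uv' ne t pv ex_op_negative[OF u v] in auto)
        then show ?thesis unfolding Seq by (simp add: insert_commute)
      qed
    qed
  qed
qed

lemma S_of_candidates: "S_of l \<subseteq> candidates"
proof
  fix S assume S: "S \<in> S_of l"
  then have SS: "S \<in> S_sets" by (simp add: S_of_iff)
  have "S \<subseteq> {r_alpha, r_beta, r_gamma, r_delta}"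
  proof
    fix b assume b: "b \<in> S"
    then obtain u v where uv: "b = lroot u v" "par u \<noteq> par v"
      using SS unfolding S_sets_def odd_roots_eq by blast
    have "\<not> (par u = 1 \<and> par v = 0)" using S_of_negative[OF SS, of u v l] S b uv by blast
    then have "par u = 0" "par v = 1" using uv(2) par_cases[of u] par_cases[of v] by auto
    moreover have "\<forall>u v. par u = 0 \<longrightarrow> par v = 1 \<longrightarrow> lroot u v \<in> {r_alpha, r_beta, r_gamma, r_delta}"
      unfolding named_roots by (simp add: all_22)
    ultimately show "b \<in> {r_alpha, r_beta, r_gamma, r_delta}" using uv(1) by blast
  qed
  moreover have "mut_orth S" using SS by (simp add: S_sets_def)
  ultimately show "S \<in> candidates" using orth_subsets by blast
qed

section \<open>Deciding the seven candidates from the coordinates of the weight\<close>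

lemma S_of_named:
  shows "l $ i2 + l $ i3 = 0 \<Longrightarrow> {r_alpha} \<in> S_of l"
    and "l $ i2 + l $ i3 = 0 \<Longrightarrow> l $ i1 + l $ i4 = 0 \<Longrightarrow> {r_alpha, r_delta} \<in> S_of l"
    and "of_nat p * (l $ i1 - l $ i2 - of_nat p + 1) = 0 \<Longrightarrow>
      of_nat q * (l $ i3 - l $ i4 - of_nat q + 1) = 0 \<Longrightarrow>
      l $ i1 + l $ i4 - of_nat p + of_nat q = 0 \<Longrightarrow> {r_delta} \<in> S_of l"
proof -
  assume l: "l $ i2 + l $ i3 = 0"
  show "{r_alpha} \<in> S_of l"
    unfolding named_roots
  proof (rule S_of_single)
    show "\<not> ex_op (\<lambda>w. scV c (Eop l i2 i3 w))" if "c \<noteq> 0" for c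
      using not_exact_alpha_delta[of c l 0] that l by (simp only: V.scale_zero_left add_0_right Eop_simps) blast
  qed (simp_all add: named_roots)
next
  assume l: "l $ i2 + l $ i3 = 0" "l $ i1 + l $ i4 = 0"
  show "{r_alpha, r_delta} \<in> S_of l"
    unfolding named_roots
  proof (rule S_of_pair)
    show "\<not> ex_op (\<lambda>w. scV c (Eop l i2 i3 w) + scV d (Eop l i1 i4 w))" if "c \<noteq> 0" "d \<noteq> 0" for c d
      unfolding Eop_simps by (rule not_exact_alpha_delta) (use that l in auto)
  qed (simp_all add: named_roots)
next
  assume pq: "of_nat p * (l $ i1 - l $ i2 - of_nat p + 1) = 0"
      "of_nat q * (l $ i3 - l $ i4 - of_nat q + 1) = 0" "l $ i1 + l $ i4 - of_nat p + of_nat q = 0"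
  show "{r_delta} \<in> S_of l"
    unfolding named_roots
  proof (rule S_of_single)
    show "\<not> ex_op (\<lambda>w. scV c (Eop l i1 i4 w))" if "c \<noteq> 0" for c
      unfolding Eop_simps by (rule not_exact_delta[OF that pq])
  qed (simp_all add: named_roots)
qed

lemma S_of_beta_gamma:
  assumes ne: "\<And>b c. b \<noteq> 0 \<or> c \<noteq> 0 \<Longrightarrow> \<not> ex_op (\<lambda>w. scV b (E13 l w) + scV c (E24 l w))"
  shows "{r_beta} \<in> S_of l" "{r_gamma} \<in> S_of l" "{r_beta, r_gamma} \<in> S_of l"
proof -
  show "{r_beta} \<in> S_of l"
    unfolding named_roots
  proof (rule S_of_single)
    show "\<not> ex_op (\<lambda>w. scV c (Eop l i1 i3 w))" if "c \<noteq> 0" for c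
      using ne[of c 0] that by (simp only: V.scale_zero_left add_0_right Eop_simps) blast
  qed (simp_all add: named_roots)
  show "{r_gamma} \<in> S_of l"
    unfolding named_roots
  proof (rule S_of_single)
    show "\<not> ex_op (\<lambda>w. scV c (Eop l i2 i4 w))" if "c \<noteq> 0" for c
      using ne[of 0 c] that by (simp only: V.scale_zero_left add_0_left Eop_simps) blast
  qed (simp_all add: named_roots)
  show "{r_beta, r_gamma} \<in> S_of l"
    unfolding named_roots
  proof (rule S_of_pair)
    show "\<not> ex_op (\<lambda>w. scV c (Eop l i1 i3 w) + scV d (Eop l i2 i4 w))" if "c \<noteq> 0" "d \<noteq> 0" for c d
      unfolding Eop_simps by (rule ne) (use that in auto)
  qed (simp_all add: named_roots)
qed

lemma not_S_of_alpha:
  assumes "l $ i2 + l $ i3 \<noteq> 0"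
  shows "{r_alpha} \<notin> S_of l" "{r_alpha, r_delta} \<notin> S_of l"
proof -
  have ex: "ex_op (Eop l i2 i3)" using E23_exact[OF assms] by simp
  show "{r_alpha} \<notin> S_of l"
    unfolding named_roots by (rule not_S_of_single[OF _ ex]) simp
  \<comment> \<open>In this grading E23 has degree 0 and E14 degree 1.\<close>
  show "{r_alpha, r_delta} \<notin> S_of l"
    unfolding named_roots
    by (rule not_S_of_pair[where t = "\<lambda>k. if k = i1 then 1 else 0", OF _ _ _ _ _ _ ex]) simp_all
qed

lemma not_S_of_beta_gamma:
  assumes l: "l $ i1 + l $ i3 + 1 \<noteq> 0" "\<And>k :: nat. l $ i1 - l $ i2 \<noteq> of_nat k"
    "l $ i2 + l $ i4 - 1 \<noteq> 0" "\<And>k :: nat. l $ i3 - l $ i4 \<noteq> of_nat k"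
  shows "{r_beta} \<notin> S_of l" "{r_gamma} \<notin> S_of l" "{r_beta, r_gamma} \<notin> S_of l"
proof -
  have ex: "ex_op (Eop l i1 i3)" "ex_op (Eop l i2 i4)"
    using E13_exact[OF l(1,2)] E24_exact[OF l(3,4)] by simp_all
  show "{r_beta} \<notin> S_of l" "{r_gamma} \<notin> S_of l"
    unfolding named_roots by (rule not_S_of_single[OF _ ex(1)] not_S_of_single[OF _ ex(2)]; simp)+
  \<comment> \<open>In this grading E13 has degree 0 and E24 degree 1.\<close>
  show "{r_beta, r_gamma} \<notin> S_of l"
    unfolding named_roots
    by (rule not_S_of_pair[where t = "\<lambda>k. if k = i4 then - 1 else 0", OF _ _ _ _ _ _ ex(1)]) simp_all
qed

lemma not_S_of_delta:
  assumes "l $ i1 + l $ i4 \<notin> \<int>"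
  shows "{r_delta} \<notin> S_of l"
proof -
  have ex: "ex_op (Eop l i1 i4)" using E14_exact[OF assms] by simp
  show ?thesis unfolding named_roots by (rule not_S_of_single[OF _ ex]) simp
qed

section \<open>Atypicality, dominance and integrality in coordinates\<close>

lemma atyp_degree_2:
  assumes "atyp_degree l = 2"
  shows "l $ i2 + l $ i3 = 0 \<and> l $ i1 + l $ i4 = 0 \<or> l $ i1 + l $ i3 + 1 = 0 \<and> l $ i2 + l $ i4 - 1 = 0"
proof -
  have sub: "atyp_roots l \<subseteq> {r_alpha, r_beta, r_gamma, r_delta}"
    by (auto simp: atyp_roots_def pos_odd_roots_eq)
  let ?T = "{S. S \<subseteq> atyp_roots l \<and> mut_orth S}"
  have "finite (atyp_roots l)" using sub finite_subset by blast
  then have "finite ?T" by simp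
  moreover have "{} \<in> ?T" by (simp add: mut_orth_empty)
  ultimately have "Max (card ` ?T) \<in> card ` ?T" by (intro Max_in) auto
  then obtain S where S: "S \<subseteq> atyp_roots l" "mut_orth S" "card S = 2"
    using assms unfolding atyp_degree_def by auto
  have "S \<in> candidates" unfolding orth_subsets[symmetric] using S sub by blast
  then have "S = {r_alpha, r_delta} \<or> S = {r_beta, r_gamma}" using S(3) by auto
  then show ?thesis using S(1) atyp_iff[of l] by auto
qed

lemma wform_rho_even:
  "wform (l + rho) (eps 1 - eps 2) = l $ i1 - l $ i2 + 1"
  "wform (l + rho) (dlt 1 - dlt 2) = - (l $ i3 - l $ i4 + 1)"
  unfolding wform_22 vector_add_component rho_entries by (simp_all add: eps_def dlt_def axis_def)

lemma even_root_12: "lroot i1 i2 \<in> even_roots"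
  unfolding even_roots_eq mem_Collect_eq by (intro exI[of _ i1] exI[of _ i2]) simp

lemma regular_neq:
  assumes "regular_wt l"
  shows "l $ i1 - l $ i2 + 1 \<noteq> 0"
proof -
  have "eps 1 - eps 2 \<in> even_roots"
    using even_root_12 by (simp add: lroot_def eps_def)
  then show ?thesis using assms wform_rho_even(1)[of l] unfolding regular_wt_def by metis
qed

lemma integral_diff:
  assumes "integral_wt l"
  shows "l $ i1 - l $ i2 \<in> \<int>"
proof -
  have "wform l (lroot i1 i2) \<in> \<int>" using assms even_root_12 by (simp add: integral_wt_def)
  then show ?thesis by (simp add: wform_22 lroot_entry)
qed

text \<open>Once l1 - l2 is an integer, double atypicality makes l3 and l4 equal to -l2 up to
  integers, and l2 cancels in the pairing with any root.\<close>

lemma integral_iff: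
  assumes "l $ i2 + l $ i3 = 0 \<and> l $ i1 + l $ i4 = 0 \<or> l $ i1 + l $ i3 + 1 = 0 \<and> l $ i2 + l $ i4 - 1 = 0"
  shows "integral_wt l \<longleftrightarrow> l $ i1 - l $ i2 \<in> \<int>"
proof
  assume d: "l $ i1 - l $ i2 \<in> \<int>"
  obtain n where n: "l $ i1 = l $ i2 + of_int n" using d by (metis Ints_cases diff_eq_eq add.commute)
  have "wform l (lroot p q) \<in> \<int>" for p q
  proof -
    have "\<exists>a b c d :: int. l $ i1 = l $ i2 + of_int a \<and> l $ i3 = - l $ i2 + of_int b \<and> l $ i4 = - l $ i2 + of_int c"
      using assms
    proof
      assume "l $ i2 + l $ i3 = 0 \<and> l $ i1 + l $ i4 = 0"
      then have "l $ i3 = - l $ i2 + of_int 0" "l $ i4 = - l $ i2 + of_int (- n)"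
        using n by (simp_all add: algebra_simps eq_neg_iff_add_eq_0)
      then show ?thesis using n by blast
    next
      assume "l $ i1 + l $ i3 + 1 = 0 \<and> l $ i2 + l $ i4 - 1 = 0"
      then have "l $ i3 = - l $ i2 + of_int (- n - 1)" "l $ i4 = - l $ i2 + of_int 1"
        using n by (simp_all add: algebra_simps eq_neg_iff_add_eq_0)
      then show ?thesis using n by blast
    qed
    then obtain a b c :: int where abc: "l $ i1 = l $ i2 + of_int a" "l $ i3 = - l $ i2 + of_int b"
      "l $ i4 = - l $ i2 + of_int c" by blast
    have "\<forall>p q. wform l (lroot p q) \<in> \<int>"
      unfolding wform_22 abc by (simp add: all_22 lroot_entry)
    then show ?thesis by blast
  qed
  then show "integral_wt l" unfolding integral_wt_def even_roots_eq odd_roots_eq by auto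
qed (rule integral_diff)

theorem lemma5p19:
  fixes lam :: weight
  assumes "atyp_degree lam = 2"
  shows
    "(regular_wt lam \<and> integral_wt lam \<and> dominant_wt lam \<longrightarrow>
        S_of lam = {S. S \<subseteq> {r_alpha, r_beta, r_gamma, r_delta} \<and> mut_orth S}) \<and>
     (regular_wt lam \<and> integral_wt lam \<and> \<not> dominant_wt lam \<and> \<not> antidominant_wt lam \<longrightarrow>
        S_of lam = {{r_delta}, {r_beta, r_gamma}, {r_beta}, {r_gamma}, {}}) \<and>
     (lam = - rho \<longrightarrow>
        S_of lam = {S. S \<subseteq> pos_odd_roots \<and> mut_orth S} \<and>
        pos_odd_roots = atyp_roots (- rho)) \<and>
     (regular_wt lam \<and> (\<not> integral_wt lam \<or> integral_wt lam \<and> antidominant_wt lam) \<longrightarrow>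
        S_of lam = Pow (atyp_roots lam))"
proof -
  let ?l = "\<lambda>i. lam $ i"
  let ?AD = "?l i2 + ?l i3 = 0 \<and> ?l i1 + ?l i4 = 0"
  let ?BG = "?l i1 + ?l i3 + 1 = 0 \<and> ?l i2 + ?l i4 - 1 = 0"
  have cases: "?AD \<or> ?BG" by (rule atyp_degree_2[OF assms])
  note int = integral_iff[OF cases]
  have AD_in: "{r_alpha} \<in> S_of lam" "{r_delta} \<in> S_of lam" "{r_alpha, r_delta} \<in> S_of lam" if ?AD
    using S_of_named(1,2)[of lam] S_of_named(3)[of 0 lam 0] that by simp_all
  have BG_in: "{r_beta} \<in> S_of lam" "{r_gamma} \<in> S_of lam" "{r_beta, r_gamma} \<in> S_of lam" if ?BG
    using S_of_beta_gamma[OF not_exact_beta_gamma] that by blast+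
  \<comment> \<open>Signs separate the two kinds of double atypicality. For {\<alpha>, \<delta>} the
    pairings with the two even roots are opposite, so a regular integral weight is dominant or
    anti-dominant; for {\<beta>, \<gamma>} they agree, so it is neither.\<close>
  have AD_dom: "wform (lam + rho) (dlt 1 - dlt 2) = - (?l i1 - ?l i2 + 1)" if ?AD
    unfolding wform_rho_even using conjunct1[OF that] conjunct2[OF that] by algebra
  have BG_dom: "wform (lam + rho) (dlt 1 - dlt 2) = ?l i1 - ?l i2 + 1" if ?BG
    unfolding wform_rho_even using conjunct1[OF that] conjunct2[OF that] by algebra
  note dom = dominant_wt_def[of lam] antidominant_wt_def[of lam] wform_rho_even(1)[of lam]
  have 1: "S_of lam = candidates" if i: "integral_wt lam" and d: "dominant_wt lam"
  proof -
    have AD: ?AD using cases BG_dom d by (auto simp: dom)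
    obtain n where n: "?l i1 - ?l i2 = of_int n" using int i by (auto elim: Ints_cases)
    have "0 < n + 1" using d n unfolding dom by simp
    then obtain m :: nat where "n = int m" by (metis zless_add1_eq nonneg_int_cases le_less add.commute)
    then have m: "?l i1 - ?l i2 = of_nat m" using n by simp
    show ?thesis
      using S_of_candidates[of lam] S_of_empty[of lam] AD_in[OF AD]
        S_of_beta_gamma[of lam, OF not_exact_dominant[OF conjunct1[OF AD] conjunct2[OF AD] m]]
      by blast
  qed
  have 2: "S_of lam = {{r_delta}, {r_beta, r_gamma}, {r_beta}, {r_gamma}, {}}"
    if reg: "regular_wt lam" and i: "integral_wt lam" and nd: "\<not> dominant_wt lam" "\<not> antidominant_wt lam"
  proof -
    obtain n where n: "?l i1 - ?l i2 = of_int n" using int i by (auto elim: Ints_cases)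
    have n1: "n + 1 \<noteq> 0" using regular_neq[OF reg] unfolding n by (metis of_int_add of_int_0 of_int_1)
    have BG: ?BG
    proof (rule ccontr)
      assume "\<not> ?BG"
      then have "?AD" using cases by blast
      from AD_dom[OF this] have "\<not> 0 < n + 1" "\<not> n + 1 < 0" using nd n unfolding dom by auto
      then show False using n1 by simp
    qed
    have l: "?l i3 = - ?l i1 - 1" "?l i4 = 1 - ?l i2" "?l i1 = ?l i2 + of_int n"
      using conjunct1[OF BG] conjunct2[OF BG] n by algebra+
    have al: "?l i2 + ?l i3 \<noteq> 0"
    proof
      assume "?l i2 + ?l i3 = 0"
      then have "of_int n + 1 = (0 :: complex)" using l(1,3) by algebra
      then have "of_int (n + 1) = (0 :: complex)" by simp
      then show False using n1 by (simp only: of_int_eq_0_iff)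
    qed
    \<comment> \<open>The singular vector comes from E21^(n+1) if n \<ge> 0 and from E43^(-n-1)
      otherwise. Since l1 + l4 = n + 1, either exponent makes l1 + l4 - p + q vanish.\<close>
    have "{r_delta} \<in> S_of lam"
    proof (cases "0 \<le> n")
      case True
      then obtain m where m: "n = int m" by (metis nonneg_int_cases)
      show ?thesis by (rule S_of_named(3)[of "Suc m" _ 0]) (simp_all add: l m)
    next
      case False
      define m where "m = nat (- n - 1)"
      have m: "n = - int m - 1" using False by (simp add: m_def)
      show ?thesis by (rule S_of_named(3)[of 0 _ m]) (simp_all add: l m)
    qed
    then show ?thesis
      using S_of_candidates[of lam] S_of_empty[of lam] BG_in[OF BG] not_S_of_alpha[OF al] by blast
  qed
  have 3: "S_of lam = candidates" "pos_odd_roots = atyp_roots (- rho)" if lam: "lam = - rho"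
  proof -
    \<comment> \<open>At -\<rho> all four odd pairings vanish, so both families of cycles are
      available.\<close>
    have "?AD" "?BG" unfolding lam vector_uminus_component rho_entries by simp_all
    then show "S_of lam = candidates"
      using S_of_candidates[of lam] S_of_empty[of lam] AD_in BG_in by blast
    show "pos_odd_roots = atyp_roots (- rho)"
      unfolding atyp_roots_def by (simp add: wform_22)
  qed
  have 4: "S_of lam = Pow (atyp_roots lam)"
    if reg: "regular_wt lam" and ia: "\<not> integral_wt lam \<or> antidominant_wt lam"
  proof -
    note r = regular_neq[OF reg]
    have sub: "atyp_roots lam \<subseteq> {r_alpha, r_beta, r_gamma, r_delta}"
      by (auto simp: atyp_roots_def pos_odd_roots_eq)
    from cases show ?thesis
    proof
      assume AD: ?AD
      then have l: "?l i3 = - ?l i2" "?l i4 = - ?l i1" by (simp_all add: add_eq_0_iff)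
      \<comment> \<open>A natural number here would make the weight integral, hence anti-dominant,
        against l1 - l2 + 1 > 0. As l3 - l4 = l1 - l2, this also covers E34.\<close>
      have "?l i1 - ?l i2 \<noteq> of_nat k" for k :: nat
      proof
        assume k: "?l i1 - ?l i2 = of_nat k"
        then have "antidominant_wt lam" using ia int by simp
        then show False unfolding dom k by simp
      qed
      moreover have be: "?l i1 + ?l i3 + 1 \<noteq> 0" "?l i2 + ?l i4 - 1 \<noteq> 0"
        using r l by algebra+
      ultimately have n: "{r_beta} \<notin> S_of lam" "{r_gamma} \<notin> S_of lam" "{r_beta, r_gamma} \<notin> S_of lam"
        by (intro not_S_of_beta_gamma; simp add: l)+
      have A: "atyp_roots lam = {r_alpha, r_delta}"
        using sub be AD atyp_iff[of lam] by blast
      have P: "Pow {r_alpha, r_delta} = {{}, {r_alpha}, {r_delta}, {r_alpha, r_delta}}"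
        by (auto simp: Pow_insert)
      show ?thesis
        unfolding A P using S_of_candidates[of lam] S_of_empty[of lam] AD_in[OF AD] n by blast
    next
      assume BG: ?BG
      then have l: "?l i3 = - ?l i1 - 1" "?l i4 = 1 - ?l i2"
        using conjunct1[OF BG] conjunct2[OF BG] by algebra+
      \<comment> \<open>The pairings with the two even roots agree, so only the non-integral case
        remains, in which l1 + l4 = l1 - l2 + 1 is not an integer.\<close>
      have "\<not> antidominant_wt lam" using BG_dom[OF BG] unfolding dom by auto
      then have ni: "?l i1 - ?l i2 \<notin> \<int>" using ia int by simp
      have al: "?l i2 + ?l i3 \<noteq> 0" using r l by algebra
      have de: "?l i1 + ?l i4 \<notin> \<int>"
      proof
        assume "?l i1 + ?l i4 \<in> \<int>"
        then have "?l i1 + ?l i4 - 1 \<in> \<int>" by (rule Ints_diff) simp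
        then show False using ni unfolding l by simp
      qed
      then have de0: "?l i1 + ?l i4 \<noteq> 0" by (metis Ints_0)
      have A: "atyp_roots lam = {r_beta, r_gamma}"
        using sub al de0 BG atyp_iff[of lam] by blast
      have P: "Pow {r_beta, r_gamma} = {{}, {r_beta}, {r_gamma}, {r_beta, r_gamma}}"
        by (auto simp: Pow_insert)
      show ?thesis
        unfolding A P using S_of_candidates[of lam] S_of_empty[of lam] BG_in[OF BG] not_S_of_alpha[OF al]
          not_S_of_delta[OF de] by blast
    qed
  qed
  have orth: "{S. S \<subseteq> pos_odd_roots \<and> mut_orth S} = candidates"
    unfolding pos_odd_roots_eq by (rule orth_subsets)
  show ?thesis
    unfolding orth_subsets orth
  proof (intro conjI impI)
    show "pos_odd_roots = atyp_roots (- rho)" if "lam = - rho" by (rule 3(2)[OF that])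
    show "S_of lam = candidates" if "lam = - rho" by (rule 3(1)[OF that])
    show "S_of lam = candidates" if "regular_wt lam \<and> integral_wt lam \<and> dominant_wt lam"
      using that by (elim conjE) (rule 1)
    show "S_of lam = {{r_delta}, {r_beta, r_gamma}, {r_beta}, {r_gamma}, {}}"
      if "regular_wt lam \<and> integral_wt lam \<and> \<not> dominant_wt lam \<and> \<not> antidominant_wt lam"
      using that by (elim conjE) (rule 2)
    show "S_of lam = Pow (atyp_roots lam)"
      if "regular_wt lam \<and> (\<not> integral_wt lam \<or> integral_wt lam \<and> antidominant_wt lam)"
      by (rule 4) (use that in blast)+
  qed
qed

end
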